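(* Let $\mathcal{A}$ be a real hyperplane arrangement (possibly non-central) with finitely many hyperplanes in an $n$-dimensional space $V$, and let $x\ne 0$ be real. The card-shuffling Markov chain associated to $\mathcal{A}$, i.e. the chain on chambers with face weights $v_x(F)=\frac{\chi(L^{z(F)},x)}{x^n|z^{-1}(z(F))|}$, has eigenvalues $\frac{1}{x^i}$ with multiplicity $\sum_{X\in L:\ \dim(X)=n-i}|\mu(V,X)|$ for $0\le i\le n-1$. In particular, for a finite Coxeter group $W$, the eigenvalues and multiplicities of $H_{W,x}$ agree with those of $M_{W,x}$ (as operators of left multiplication on the group algebra of $W$ by $\sum_w H_{W,x}(w)w$ and $\sum_w M_{W,x}(w)w$).
   Context: Arrangements. Let $\mathcal{A}=\{H_i\}_{i\in I}$ be a finite hyperplane arrangement in a real vector space $V$ of dimension $n$. Chambers are the components of the complement; faces are the nonempty sets $\bigcap_{i}H_i^{\epsilon_i}$, $\epsilon_i\in\{0,+,-\}$, with $H_i^0=H_i$ and $H_i^\pm$ the two open half-spaces. $L$ is the set of nonempty intersections of hyperplanes (including $V$), ordered by reverse inclusion, with Möbius function $\mu$; for $X\in L$, $L^X=\{Y\in L:Y\ge X\}$ and $\chi(L^X,x)=\sum_{Y\ge X}\mu(X,Y)x^{\dim Y}$. The map $z$ sends a face $F$ to its support $z(F)\in L$, the intersection of $V$ with all hyperplanes containing $F$. A face $F$ moves a chamber $C$ to the unique chamber whose closure contains $F$ and which among such chambers is separated from $C$ by the fewest hyperplanes. The chain has transition matrix (entries possibly negative) whose $(C,C')$ entry is the sum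 of $v_x(F)$ over faces $F$ moving $C$ to $C'$. The stated multiplicity is the one contributed by the index $i$; for special $x$ at which some of the numbers $1/x^i$ coincide, contributions of different indices add. Coxeter groups. $W$ is a finite Coxeter group of rank $n$ acting on its $n$-dimensional real reflection representation $V$, with (reduced, $W$-stable) root system and base $\Pi$ of simple roots; its arrangement is that of the root hyperplanes, with intersection lattice $L$. $Des(w)=\{\alpha\in\Pi: w(\alpha)\text{ negative}\}$. On subsets of $\Pi$ put $J\sim K$ iff $w(J)=K$ for some $w\in W$; $\lambda$ denotes a class, $\lambda(K)$ the class of $K$, $|\lambda|$ its number of elements, $\|\lambda\|=|J|$ for $J\in\lambda$. $W_K$ is the parabolic subgroup generated by reflections in the roots of $K$, $Fix(W_K)$ its fixed space, $N_W(W_K)$ its normalizer. $H_{W,x}(w)=\sum_{K\subseteq\Pi-Des(w)}\frac{|W_K|\chi(L^{Fix(W_K)},x)}{x^n|N_W(W_K)||\lambda(K)|}$. For $M_{W,x}$: for $J\subseteq\Pi$ let $X_J=\{w: Des(w)\cap J=\emptyset\}$, $x_J=\sum_{w\in X_J}w$. For $K\subseteq J$ let $\mu_K^J=\frac{|\{w\in X_J:w(K)\subseteq\Pi\}|}{|\lambda(K)|}$ and $\mu_K^J=0$ if $K\not\subseteq J$; let $(\beta_K^J)$ be the inverse of the matrix $(\mu_K^J)$ (rows $J$, columns $K$); $e_\lambda=\frac1{|\lambda|}\sum_{J\in\lambda}\sum_{K\subseteq J}\beta_K^Jx_K$; $M_{W,x}=\sum_\lambda e_\lambda/x^{\|\lambda\|}$,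 and $M_{W,x}(w)$ is the coefficient of $w$. *)

theory Defs
  imports
    "HOL-Analysis.Analysis"
    "HOL-Algebra.Bij"
    "HOL-Algebra.Generated_Groups"
    "HOL-Algebra.Group_Action"
    "Jordan_Normal_Form.Char_Poly"
begin

section \<open>Kernels on finite sets\<close>

text \<open>
  A kernel on a finite set is turned into a matrix by means of the enumeration
  \<^const>\<open>from_nat_into\<close>, which is a bijection from the numbers below the cardinality;
  the characteristic polynomial does not depend on the enumeration.  The multiplicity of an
  eigenvalue is its multiplicity as a root of this polynomial.
\<close>

definition kernel_matrix :: "'i set \<Rightarrow> ('i \<Rightarrow> 'i \<Rightarrow> real) \<Rightarrow> real mat" where
  "kernel_matrix S P =
     Matrix.mat (card S) (card S) (\<lambda>(i, j). P (from_nat_into S i) (from_nat_into S j))"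

definition kernel_char_poly :: "'i set \<Rightarrow> ('i \<Rightarrow> 'i \<Rightarrow> real) \<Rightarrow> real poly" where
  "kernel_char_poly S P = char_poly (kernel_matrix S P)"

text \<open>The two-sided inverse of a matrix with rows and columns indexed by a finite set, set to
  zero outside the index set so that it is unique as a function.\<close>

definition kernel_inverse :: "'i set \<Rightarrow> ('i \<Rightarrow> 'i \<Rightarrow> real) \<Rightarrow> 'i \<Rightarrow> 'i \<Rightarrow> real" where
  "kernel_inverse S M = (THE N.
     (\<forall>i j. \<not> (i \<in> S \<and> j \<in> S) \<longrightarrow> N i j = 0) \<and>
     (\<forall>i\<in>S. \<forall>j\<in>S. (\<Sum>k\<in>S. M i k * N k j) = (if i = j then 1 else 0)) \<and>
     (\<forall>i\<in>S. \<forall>j\<in>S. (\<Sum>k\<in>S. N i k * M k j) = (if i = j then 1 else 0)))"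

section \<open>Hyperplane arrangements\<close>

definition hyperplane_arrangement :: "'a::euclidean_space set set \<Rightarrow> bool" where
  "hyperplane_arrangement A \<longleftrightarrow>
     finite A \<and> (\<forall>H\<in>A. \<exists>a b. a \<noteq> 0 \<and> H = {v. a \<bullet> v = b})"

definition chambers :: "'a::euclidean_space set set \<Rightarrow> 'a set set" where
  "chambers A = components (- \<Union>A)"

text \<open>Replacing \<open>(a, b)\<close> by \<open>(- a, - b)\<close> keeps the hyperplane, so both of its sides occur here.\<close>

definition open_halfspaces :: "'a::euclidean_space set \<Rightarrow> 'a set set" where
  "open_halfspaces H = {{v. a \<bullet> v < b} | a b. a \<noteq> 0 \<and> H = {v. a \<bullet> v = b}}"

definition faces :: "'a::euclidean_space set set \<Rightarrow> 'a set set" where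
  "faces A = {F. F \<noteq> {} \<and>
     (\<exists>S. (\<forall>H\<in>A. S H = H \<or> S H \<in> open_halfspaces H) \<and> F = (\<Inter>H\<in>A. S H))}"

text \<open>Since \<open>\<Inter>{}\<close> is the whole space, the whole space is a flat, and it is the support of
  the faces contained in no hyperplane.\<close>

definition flats :: "'a::euclidean_space set set \<Rightarrow> 'a set set" where
  "flats A = {\<Inter>B | B. B \<subseteq> A} - {{}}"

definition face_support :: "'a::euclidean_space set set \<Rightarrow> 'a set \<Rightarrow> 'a set" where
  "face_support A F = \<Inter>{H \<in> A. F \<subseteq> H}"

definition flat_dim :: "'a::euclidean_space set \<Rightarrow> nat" where
  "flat_dim X = nat (aff_dim X)"

text \<open>The Moebius function of a finite family of sets ordered by reverse inclusion:
  the value is 1 on the diagonal, and for \<open>Y \<subset> X\<close> it is minus the sum of the values at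
  \<open>(X, Z)\<close> over \<open>X \<supseteq> Z \<supset> Y\<close>.\<close>

function moebius :: "'b set set \<Rightarrow> 'b set \<Rightarrow> 'b set \<Rightarrow> int" where
  "moebius L X Y =
     (if finite L \<and> X \<in> L \<and> Y \<in> L \<and> Y \<subseteq> X
      then if X = Y then 1 else - (\<Sum>Z\<in>{Z \<in> L. Z \<subseteq> X \<and> Y \<subset> Z}. moebius L X Z)
      else 0)"
  by pat_completeness auto
termination
proof (relation "Wellfounded.measure (\<lambda>(L, X, Y). card {Z \<in> L. Z \<subseteq> X \<and> Y \<subset> Z})")
  fix L :: "'b set set" and X Y Z
  assume "finite L \<and> X \<in> L \<and> Y \<in> L \<and> Y \<subseteq> X" "Z \<in> {Z \<in> L. Z \<subseteq> X \<and> Y \<subset> Z}"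
  then have "{Z' \<in> L. Z' \<subseteq> X \<and> Z \<subset> Z'} \<subset> {Z' \<in> L. Z' \<subseteq> X \<and> Y \<subset> Z'}" "finite L"
    by auto
  then show "((L, X, Z), (L, X, Y)) \<in> Wellfounded.measure (\<lambda>(L, X, Y). card {Z \<in> L. Z \<subseteq> X \<and> Y \<subset> Z})"
    by (simp add: psubset_card_mono)
qed simp

declare moebius.simps [simp del]

definition flat_poly :: "'a::euclidean_space set set \<Rightarrow> 'a set \<Rightarrow> real \<Rightarrow> real" where
  "flat_poly A X x =
     (\<Sum>Y\<in>{Y \<in> flats A. Y \<subseteq> X}. real_of_int (moebius (flats A) X Y) * x ^ flat_dim Y)"

definition separates :: "'a::euclidean_space set \<Rightarrow> 'a set \<Rightarrow> 'a set \<Rightarrow> bool" where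
  "separates H C D \<longleftrightarrow>
     (\<exists>a b. a \<noteq> 0 \<and> H = {v. a \<bullet> v = b} \<and> C \<subseteq> {v. a \<bullet> v < b} \<and> D \<subseteq> {v. a \<bullet> v > b})"

definition face_move :: "'a::euclidean_space set set \<Rightarrow> 'a set \<Rightarrow> 'a set \<Rightarrow> 'a set" where
  "face_move A F C =
     (THE D. is_arg_min (\<lambda>D. card {H \<in> A. separates H C D})
                        (\<lambda>D. D \<in> chambers A \<and> F \<subseteq> closure D) D)"

definition face_weight :: "'a::euclidean_space set set \<Rightarrow> real \<Rightarrow> 'a set \<Rightarrow> real" where
  "face_weight A x F =
     flat_poly A (face_support A F) x /
       (x ^ DIM('a) * real (card {G \<in> faces A. face_support A G = face_support A F}))"

definition shuffle_kernel :: "'a::euclidean_space set set \<Rightarrow> real \<Rightarrow> 'a set \<Rightarrow> 'a set \<Rightarrow> real" where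
  "shuffle_kernel A x C D = (\<Sum>F\<in>{F \<in> faces A. face_move A F C = D}. face_weight A x F)"

text \<open>The value at \<open>i = DIM('a)\<close> is nonzero exactly when some flat is a point, as for an
  essential arrangement.\<close>

definition shuffle_multiplicity :: "'a::euclidean_space set set \<Rightarrow> nat \<Rightarrow> nat" where
  "shuffle_multiplicity A i =
     nat (\<Sum>X\<in>{X \<in> flats A. int (flat_dim X) = int DIM('a) - int i}. \<bar>moebius (flats A) UNIV X\<bar>)"

section \<open>Finite Coxeter groups\<close>

definition reflection :: "'a::euclidean_space \<Rightarrow> 'a \<Rightarrow> 'a" where
  "reflection \<alpha> v = v - (2 * (v \<bullet> \<alpha>) / (\<alpha> \<bullet> \<alpha>)) *\<^sub>R \<alpha>"

definition nonneg_combination :: "'a::euclidean_space set \<Rightarrow> 'a \<Rightarrow> bool" where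
  "nonneg_combination \<Delta> v \<longleftrightarrow> (\<exists>c. (\<forall>\<alpha>\<in>\<Delta>. 0 \<le> c \<alpha>) \<and> v = (\<Sum>\<alpha>\<in>\<Delta>. c \<alpha> *\<^sub>R \<alpha>))"

text \<open>A finite Coxeter group is given through its root system in a Euclidean space with an
  invariant inner product.  No crystallographic condition is imposed.  The roots span the space,
  so its dimension is the rank.\<close>

definition root_system :: "'a::euclidean_space set \<Rightarrow> bool" where
  "root_system \<Phi> \<longleftrightarrow>
     finite \<Phi> \<and> 0 \<notin> \<Phi> \<and> span \<Phi> = UNIV \<and>
     (\<forall>\<alpha>\<in>\<Phi>. \<Phi> \<inter> span {\<alpha>} = {\<alpha>, - \<alpha>}) \<and>
     (\<forall>\<alpha>\<in>\<Phi>. reflection \<alpha> ` \<Phi> = \<Phi>)"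

definition root_base :: "'a::euclidean_space set \<Rightarrow> 'a set \<Rightarrow> bool" where
  "root_base \<Phi> \<Delta> \<longleftrightarrow>
     \<Delta> \<subseteq> \<Phi> \<and> independent \<Delta> \<and>
     (\<forall>\<beta>\<in>\<Phi>. nonneg_combination \<Delta> \<beta> \<or> nonneg_combination \<Delta> (- \<beta>))"

definition reflection_subgroup :: "'a::euclidean_space set \<Rightarrow> ('a \<Rightarrow> 'a) set" where
  "reflection_subgroup K = generate (BijGroup UNIV) (reflection ` K)"

definition coxeter_group :: "'a::euclidean_space set \<Rightarrow> ('a \<Rightarrow> 'a) monoid" where
  "coxeter_group \<Phi> = (BijGroup UNIV)\<lparr>carrier := reflection_subgroup \<Phi>\<rparr>"

definition root_arrangement :: "'a::euclidean_space set \<Rightarrow> 'a set set" where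
  "root_arrangement \<Phi> = (\<lambda>\<alpha>. {v. \<alpha> \<bullet> v = 0}) ` \<Phi>"

definition fixed_space :: "('a \<Rightarrow> 'a) set \<Rightarrow> 'a set" where
  "fixed_space U = {v. \<forall>w\<in>U. w v = v}"

definition descents :: "'a::euclidean_space set \<Rightarrow> ('a \<Rightarrow> 'a) \<Rightarrow> 'a set" where
  "descents \<Delta> w = {\<alpha> \<in> \<Delta>. nonneg_combination \<Delta> (- w \<alpha>)}"

definition subset_class :: "'a::euclidean_space set \<Rightarrow> 'a set \<Rightarrow> 'a set \<Rightarrow> 'a set set" where
  "subset_class \<Phi> \<Delta> K = {J. J \<subseteq> \<Delta> \<and> (\<exists>w\<in>carrier (coxeter_group \<Phi>). w ` K = J)}"

definition subset_classes :: "'a::euclidean_space set \<Rightarrow> 'a set \<Rightarrow> 'a set set set" where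
  "subset_classes \<Phi> \<Delta> = subset_class \<Phi> \<Delta> ` Pow \<Delta>"

text \<open>All members of a class have the same cardinality.\<close>

definition class_rank :: "'a set set \<Rightarrow> nat" where
  "class_rank \<Lambda> = card (SOME J. J \<in> \<Lambda>)"

text \<open>Elements of the real group algebra of \<open>W\<close> are written as functions on \<open>W\<close>.  The column of
  the following kernel at \<open>v\<close> is the product of \<open>a\<close> (on the left) with the basis element \<open>v\<close>.\<close>

definition left_mult_kernel ::
    "('g, 'm) monoid_scheme \<Rightarrow> ('g \<Rightarrow> real) \<Rightarrow> 'g \<Rightarrow> 'g \<Rightarrow> real" where
  "left_mult_kernel G a u v = a (u \<otimes>\<^bsub>G\<^esub> inv\<^bsub>G\<^esub> v)"

definition H_elt :: "'a::euclidean_space set \<Rightarrow> 'a set \<Rightarrow> real \<Rightarrow> ('a \<Rightarrow> 'a) \<Rightarrow> real" where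
  "H_elt \<Phi> \<Delta> x w =
     (\<Sum>K\<in>Pow (\<Delta> - descents \<Delta> w).
        real (card (reflection_subgroup K)) *
          flat_poly (root_arrangement \<Phi>) (fixed_space (reflection_subgroup K)) x /
        (x ^ DIM('a) * real (card (normalizer (coxeter_group \<Phi>) (reflection_subgroup K))) *
          real (card (subset_class \<Phi> \<Delta> K))))"

definition X_set :: "'a::euclidean_space set \<Rightarrow> 'a set \<Rightarrow> 'a set \<Rightarrow> ('a \<Rightarrow> 'a) set" where
  "X_set \<Phi> \<Delta> J = {w \<in> carrier (coxeter_group \<Phi>). descents \<Delta> w \<inter> J = {}}"

definition x_elt :: "'a::euclidean_space set \<Rightarrow> 'a set \<Rightarrow> 'a set \<Rightarrow> ('a \<Rightarrow> 'a) \<Rightarrow> real" where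
  "x_elt \<Phi> \<Delta> J w = (if w \<in> X_set \<Phi> \<Delta> J then 1 else 0)"

definition mu_coeff :: "'a::euclidean_space set \<Rightarrow> 'a set \<Rightarrow> 'a set \<Rightarrow> 'a set \<Rightarrow> real" where
  "mu_coeff \<Phi> \<Delta> J K =
     (if K \<subseteq> J
      then real (card {w \<in> X_set \<Phi> \<Delta> J. w ` K \<subseteq> \<Delta>}) / real (card (subset_class \<Phi> \<Delta> K))
      else 0)"

definition beta_coeff :: "'a::euclidean_space set \<Rightarrow> 'a set \<Rightarrow> 'a set \<Rightarrow> 'a set \<Rightarrow> real" where
  "beta_coeff \<Phi> \<Delta> = kernel_inverse (Pow \<Delta>) (mu_coeff \<Phi> \<Delta>)"

definition e_elt :: "'a::euclidean_space set \<Rightarrow> 'a set \<Rightarrow> 'a set set \<Rightarrow> ('a \<Rightarrow> 'a) \<Rightarrow> real" where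
  "e_elt \<Phi> \<Delta> \<Lambda> w =
     (1 / real (card \<Lambda>)) *
       (\<Sum>J\<in>\<Lambda>. \<Sum>K\<in>Pow J. beta_coeff \<Phi> \<Delta> J K * x_elt \<Phi> \<Delta> K w)"

definition M_elt :: "'a::euclidean_space set \<Rightarrow> 'a set \<Rightarrow> real \<Rightarrow> ('a \<Rightarrow> 'a) \<Rightarrow> real" where
  "M_elt \<Phi> \<Delta> x w =
     (\<Sum>\<Lambda>\<in>subset_classes \<Phi> \<Delta>. e_elt \<Phi> \<Delta> \<Lambda> w / x ^ class_rank \<Lambda>)"

end

theory Submission
  imports Defs "Jordan_Normal_Form.Schur_Decomposition"
begin

text \<open>
  The characteristic polynomial of a kernel is determined by the traces of its powers.  Faces, seen
  as sign vectors, form a semigroup acting on chambers, and a product of faces lies in a flat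
  \<open>Y\<close> iff all factors do.  Hence for arbitrary face weights \<open>v\<close> the trace of the \<open>k\<close>-th power of
  the walk is \<open>\<Sum>Y. \<bar>\<mu>(V, Y)\<bar> (\<Sum>F\<subseteq>Y. v F)^k\<close>, as soon as the number of chambers fixed by a
  face \<open>F\<close> is known to be \<open>\<Sum>Y\<supseteq>F. \<bar>\<mu>(V, Y)\<bar>\<close>.  This count comes from the Euler relation for the
  faces of a relatively open convex set cut by hyperplanes.  For the weights \<open>v\<^sub>x\<close>, Moebius
  inversion gives \<open>\<Sum>F\<subseteq>Y. v\<^sub>x F = x^(dim Y - n)\<close>.

  In a Coxeter group, left multiplication by a combination \<open>\<Sum>K. c K x\<^sub>K\<close> is the face walk whose
  weights are \<open>c\<close> of the type of the face.  Both \<open>H\<close> and \<open>M\<close> are such combinations; the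
  weights of \<open>H\<close> are \<open>v\<^sub>x\<close>, and for \<open>M\<close> the inner sums are again \<open>x^(dim Y - n)\<close>, because the
  faces of type \<open>K\<close> inside the fixed space of \<open>W\<^sub>J\<close> number \<open>\<Sum>J'\<sim>J. \<mu>(K, J')\<close>, in the
  notation of the matrix \<open>\<mu>\<close> whose inverse is \<open>\<beta>\<close>.
\<close>

text \<open>Traces fit because every positive power of the walk is again a weighted sum of single
  faces, so its trace asks only for the number of chambers fixed by one face. No eigenvectors are
  constructed, and neither negative weights nor coincidences among the numbers
  \<open>1 / x ^ i\<close> disturb the argument. The obstacle is a sign: the Euler relation yields
  \<open>(- 1) ^ (DIM('a) - flat_dim Y)\<close> times a Moebius value, whereas the theorem speaks of
  absolute values. That the two agree is itself read off from a spectrum, for weights that give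
  different flats different eigenvalues. Faces are represented by points, so that a product of faces
  is a short move from one point towards another, which makes sense for affine arrangements as well.
  In the Coxeter half the two elements are never compared coefficient by coefficient: the spectrum
  depends only on the total weights inside flats, so it suffices to sum coefficients over the faces
  in a flat. The facts on reflection groups behind this (exchange, fundamental domain, structure of
  the normalizer) are derived from the root system.\<close>

no_notation scalar_prod (infix \<open>\<bullet>\<close> 70)
hide_const (open) Matrix.orthogonal


section \<open>Traces of powers and characteristic polynomials\<close>

lemma bij_betw_from_nat_into_lessThan:
  assumes "finite S"
  shows "bij_betw (from_nat_into S) {..<card S} S"
  using bij_betw_from_nat_into_finite[OF assms] .

lemma sum_from_nat_into:
  assumes "finite S"
  shows "(\<Sum>i<card S. f (from_nat_into S i)) = (\<Sum>s\<in>S. f s)"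
  using sum.reindex_bij_betw[OF bij_betw_from_nat_into_lessThan[OF assms]] .

lemma kernel_matrix_carrier [simp]: "kernel_matrix S P \<in> carrier_mat (card S) (card S)"
  by (simp add: kernel_matrix_def)

lemma kernel_matrix_mult:
  assumes "finite S"
  shows "kernel_matrix S P * kernel_matrix S Q = kernel_matrix S (\<lambda>i j. \<Sum>k\<in>S. P i k * Q k j)"
  by (rule eq_matI)
     (auto simp: kernel_matrix_def scalar_prod_def lessThan_atLeast0[symmetric]
           sum_from_nat_into[OF assms, of "\<lambda>k. P _ k * Q k _"])

lemma kernel_matrix_eq_one_iff:
  assumes "finite S"
  shows "kernel_matrix S P = 1\<^sub>m (card S) \<longleftrightarrow> (\<forall>i\<in>S. \<forall>j\<in>S. P i j = (if i = j then 1 else 0))"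
proof -
  note bij = bij_betw_from_nat_into_lessThan[OF assms]
  have inj: "from_nat_into S i = from_nat_into S j \<longleftrightarrow> i = j" if "i < card S" "j < card S" for i j
    using bij that by (auto simp: bij_betw_def inj_on_def)
  have img: "S = from_nat_into S ` {..<card S}"
    using bij by (simp add: bij_betw_def)
  have "kernel_matrix S P = 1\<^sub>m (card S) \<longleftrightarrow>
      (\<forall>i<card S. \<forall>j<card S. P (from_nat_into S i) (from_nat_into S j) = (if i = j then 1 else 0))"
    by (auto simp: kernel_matrix_def mat_eq_iff)
  also have "\<dots> \<longleftrightarrow> (\<forall>i\<in>from_nat_into S ` {..<card S}. \<forall>j\<in>from_nat_into S ` {..<card S}.
      P i j = (if i = j then 1 else 0))"
    using inj by auto
  finally show ?thesis
    unfolding img[symmetric] .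
qed

text \<open>A one-sided inverse of a finite square matrix is two-sided. Thanks to this the Moebius
  function and the inverse of the matrix \<open>mu_coeff\<close> need to be examined on one side
  only.\<close>

lemma kernel_left_inverse_imp_right_inverse:
  assumes S: "finite S"
    and "\<And>i j. i \<in> S \<Longrightarrow> j \<in> S \<Longrightarrow> (\<Sum>k\<in>S. M i k * N k j) = (if i = j then 1 else (0::real))"
    and ij: "i \<in> S" "j \<in> S"
  shows "(\<Sum>k\<in>S. N i k * M k j) = (if i = j then 1 else 0)"
proof -
  have "kernel_matrix S M * kernel_matrix S N = 1\<^sub>m (card S)"
    unfolding kernel_matrix_mult[OF S] kernel_matrix_eq_one_iff[OF S]
    using assms(2) by simp
  then have "kernel_matrix S N * kernel_matrix S M = 1\<^sub>m (card S)"
    by (rule mat_mult_left_right_inverse[OF kernel_matrix_carrier kernel_matrix_carrier])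
  then show ?thesis
    unfolding kernel_matrix_mult[OF S] kernel_matrix_eq_one_iff[OF S] using ij by blast
qed

section \<open>Powers and traces of kernels\<close>

primrec kernel_power :: "'i set \<Rightarrow> ('i \<Rightarrow> 'i \<Rightarrow> real) \<Rightarrow> nat \<Rightarrow> 'i \<Rightarrow> 'i \<Rightarrow> real" where
  "kernel_power S P 0 i j = (if i = j then 1 else 0)"
| "kernel_power S P (Suc m) i j = (\<Sum>k\<in>S. kernel_power S P m i k * P k j)"

definition kernel_trace :: "'i set \<Rightarrow> ('i \<Rightarrow> 'i \<Rightarrow> real) \<Rightarrow> real" where
  "kernel_trace S P = (\<Sum>i\<in>S. P i i)"

lemma kernel_matrix_power:
  assumes "finite S"
  shows "kernel_matrix S P ^\<^sub>m m = kernel_matrix S (kernel_power S P m)"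
proof (induction m)
  case 0
  have "kernel_matrix S (kernel_power S P 0) = 1\<^sub>m (card S)"
    by (subst kernel_matrix_eq_one_iff[OF assms]) simp
  then show ?case
    by (simp add: kernel_matrix_def)
next
  case (Suc m)
  have "kernel_power S P (Suc m) = (\<lambda>i j. \<Sum>k\<in>S. kernel_power S P m i k * P k j)"
    by (intro ext) simp
  then show ?case
    by (simp only: pow_mat.simps Suc kernel_matrix_mult[OF assms])
qed

text \<open>Used to replace chambers by group elements as indices of the same walk; a bijection
  carries the sum over intermediate states along at every step.\<close>

lemma kernel_trace_reindex:
  assumes "bij_betw f S T" "\<And>i j. i \<in> S \<Longrightarrow> j \<in> S \<Longrightarrow> P i j = Q (f i) (f j)"
  shows "kernel_trace S (kernel_power S P m) = kernel_trace T (kernel_power T Q m)"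
proof -
  have "kernel_power S P m i j = kernel_power T Q m (f i) (f j)" if "i \<in> S" "j \<in> S" for i j
    using that
  proof (induction m arbitrary: j)
    case 0
    then show ?case using assms(1) by (auto simp: bij_betw_def inj_on_def)
  next
    case (Suc m)
    have "kernel_power S P (Suc m) i j = (\<Sum>k\<in>S. kernel_power T Q m (f i) (f k) * Q (f k) (f j))"
      using Suc assms(2) by (simp cong: sum.cong)
    also have "\<dots> = kernel_power T Q (Suc m) (f i) (f j)"
      using sum.reindex_bij_betw[OF assms(1), of "\<lambda>k. kernel_power T Q m (f i) k * Q k (f j)"] by simp
    finally show ?case .
  qed
  then have "kernel_trace S (kernel_power S P m) = (\<Sum>i\<in>S. kernel_power T Q m (f i) (f i))"
    by (simp add: kernel_trace_def cong: sum.cong)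
  then show ?thesis
    using sum.reindex_bij_betw[OF assms(1), of "\<lambda>i. kernel_power T Q m i i"]
    by (simp add: kernel_trace_def)
qed

section \<open>Traces of matrix powers and multiplicities of eigenvalues\<close>

definition mat_trace :: "'a::comm_semiring_1 mat \<Rightarrow> 'a" where
  "mat_trace A = (\<Sum>i<dim_row A. A $$ (i, i))"

lemma mat_trace_kernel_matrix:
  assumes "finite S"
  shows "mat_trace (kernel_matrix S P) = kernel_trace S P"
  using sum_from_nat_into[OF assms, of "\<lambda>i. P i i"]
  by (simp add: mat_trace_def kernel_trace_def kernel_matrix_def)

lemma mat_trace_comm:
  assumes "A \<in> carrier_mat n m" "B \<in> carrier_mat m n"
  shows "mat_trace (A * B) = mat_trace (B * A)"
proof -
  have "mat_trace (A * B) = (\<Sum>i<n. \<Sum>k<m. A $$ (i, k) * B $$ (k, i))"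
    using assms by (auto simp: mat_trace_def scalar_prod_def lessThan_atLeast0 intro!: sum.cong)
  also have "\<dots> = (\<Sum>k<m. \<Sum>i<n. B $$ (k, i) * A $$ (i, k))"
    by (subst sum.swap) (simp add: mult.commute)
  also have "\<dots> = mat_trace (B * A)"
    using assms by (auto simp: mat_trace_def scalar_prod_def lessThan_atLeast0 intro!: sum.cong)
  finally show ?thesis .
qed

lemma upper_triangular_mult:
  assumes "A \<in> carrier_mat n n" "B \<in> carrier_mat n n"
    and "upper_triangular A" "upper_triangular (B :: 'a::comm_semiring_1 mat)"
  shows "upper_triangular (A * B)" and "i < n \<Longrightarrow> (A * B) $$ (i, i) = A $$ (i, i) * B $$ (i, i)"
proof -
  have entry: "(A * B) $$ (i, j) = (\<Sum>k<n. A $$ (i, k) * B $$ (k, j))" if "i < n" "j < n" for i j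
    using assms(1,2) that by (simp add: scalar_prod_def lessThan_atLeast0)
  have zero: "A $$ (i, k) * B $$ (k, j) = 0" if "i < n" "k < n" "k < i \<or> j < k" for i j k
    using that(3) upper_triangularD[OF assms(3), of k i] upper_triangularD[OF assms(4), of j k]
      that(1,2) carrier_matD(1)[OF assms(1)] carrier_matD(1)[OF assms(2)] by auto
  show "upper_triangular (A * B)"
  proof
    fix i j assume "j < i" "i < dim_row (A * B)"
    then have ij: "j < i" "i < n" using assms by auto
    \<comment> \<open>Below the diagonal every intermediate index is below \<open>i\<close> or above
      \<open>j\<close>, so one of the two factors is itself an entry below the diagonal.\<close>
    have "k < i \<or> j < k" for k using ij by auto
    then show "(A * B) $$ (i, j) = 0"
      using ij by (subst entry) (auto intro!: sum.neutral zero)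
  qed
  assume i: "i < n"
  have "(A * B) $$ (i, i) = (\<Sum>k\<in>{i}. A $$ (i, k) * B $$ (k, i))"
    unfolding entry[OF i i] using i by (intro sum.mono_neutral_right) (auto intro!: zero)
  then show "(A * B) $$ (i, i) = A $$ (i, i) * B $$ (i, i)" by simp
qed

lemma upper_triangular_pow:
  assumes "A \<in> carrier_mat n n" "upper_triangular (A :: 'a::comm_semiring_1 mat)"
  shows "upper_triangular (A ^\<^sub>m k) \<and> (\<forall>i<n. (A ^\<^sub>m k) $$ (i, i) = (A $$ (i, i)) ^ k)"
proof (induction k)
  case 0
  then show ?case using assms by auto
next
  case (Suc k)
  have "A ^\<^sub>m k \<in> carrier_mat n n" using assms by simp
  then show ?case
    using Suc upper_triangular_mult[of "A ^\<^sub>m k" n A] assms by (simp add: mult.commute)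
qed

text \<open>A Schur decomposition makes the matrix triangular with exactly the listed roots on the
  diagonal. Powers of a triangular matrix act entrywise on its diagonal, and conjugation preserves
  the trace.\<close>

lemma mat_trace_pow_eigenvalues:
  fixes A :: "complex mat"
  assumes A: "A \<in> carrier_mat n n" and cp: "char_poly A = (\<Prod>a\<leftarrow>as. [:- a, 1:])"
  shows "mat_trace (A ^\<^sub>m k) = (\<Sum>a\<leftarrow>as. a ^ k)"
proof -
  obtain B P Q where sd: "schur_decomposition A as = (B, P, Q)"
    by (cases "schur_decomposition A as") auto
  from schur_decomposition[OF A cp sd]
  have sim: "similar_mat_wit A B P Q" and ut: "upper_triangular B" and diag: "diag_mat B = as"
    by auto
  from similar_mat_witD2[OF A sim]
  have B: "B \<in> carrier_mat n n" and P: "P \<in> carrier_mat n n" and Q: "Q \<in> carrier_mat n n"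
    and QP: "Q * P = 1\<^sub>m n" by auto
  have Bk: "B ^\<^sub>m k \<in> carrier_mat n n" using B by simp
  have "mat_trace (A ^\<^sub>m k) = mat_trace (P * B ^\<^sub>m k * Q)"
    using similar_mat_wit_pow_id[OF sim] by simp
  also have "\<dots> = mat_trace (Q * (P * B ^\<^sub>m k))"
    using P Q Bk by (intro mat_trace_comm) auto
  also have "Q * (P * B ^\<^sub>m k) = B ^\<^sub>m k"
    using P Q Bk QP by (simp add: left_mult_one_mat[OF Bk] flip: assoc_mult_mat[of Q n n P n "B ^\<^sub>m k" n])
  also have "mat_trace (B ^\<^sub>m k) = (\<Sum>i<n. (B $$ (i, i)) ^ k)"
    using upper_triangular_pow[OF B ut, of k] B Bk by (simp add: mat_trace_def)
  also have "\<dots> = (\<Sum>a\<leftarrow>diag_mat B. a ^ k)"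
    using B by (simp add: diag_mat_def comp_def sum_list_distinct_conv_sum_set lessThan_atLeast0)
  finally show ?thesis using diag by simp
qed

text \<open>Equal power sums for all exponents, 0 included, give equal sums of values of every
  polynomial. The polynomial with a simple root at each occurring number except \<open>z\<close>
  then isolates the multiplicity of \<open>z\<close>. The integers \<open>m\<close> may be negative
  and the values \<open>l j\<close> may repeat.\<close>

lemma power_sums_determine_count:
  fixes l :: "'j \<Rightarrow> complex" and m :: "'j \<Rightarrow> int"
  assumes "finite I"
    and sums: "\<And>k. (\<Sum>a\<leftarrow>as. a ^ k) = (\<Sum>j\<in>I. of_int (m j) * l j ^ k)"
  shows "int (count (mset as) z) = (\<Sum>j\<in>{j \<in> I. l j = z}. m j)"
proof -
  have poly_sum: "(\<Sum>a\<leftarrow>as. poly p a) = (\<Sum>j\<in>I. of_int (m j) * poly p (l j))" for p :: "complex poly"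
  proof -
    have "(\<Sum>a\<leftarrow>as. \<Sum>i\<le>degree p. coeff p i * a ^ i) =
        (\<Sum>i\<le>degree p. coeff p i * (\<Sum>a\<leftarrow>as. a ^ i))"
      by (induction as) (simp_all add: sum.distrib distrib_left)
    then have "(\<Sum>a\<leftarrow>as. poly p a) = (\<Sum>i\<le>degree p. coeff p i * (\<Sum>a\<leftarrow>as. a ^ i))"
      by (simp add: poly_altdef)
    also have "\<dots> = (\<Sum>i\<le>degree p. \<Sum>j\<in>I. of_int (m j) * (coeff p i * l j ^ i))"
      by (simp add: sums sum_distrib_left mult.left_commute)
    also have "\<dots> = (\<Sum>j\<in>I. \<Sum>i\<le>degree p. of_int (m j) * (coeff p i * l j ^ i))"
      by (rule sum.swap)
    also have "\<dots> = (\<Sum>j\<in>I. of_int (m j) * poly p (l j))"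
      by (simp add: poly_altdef sum_distrib_left)
    finally show ?thesis .
  qed
  define Z where "Z = (set as \<union> l ` I) - {z}"
  have "finite Z" using assms(1) by (simp add: Z_def)
  define p where "p = (\<Prod>y\<in>Z. [:- y, 1:])"
  have p0: "poly p y = 0 \<longleftrightarrow> y \<in> Z" for y
    using \<open>finite Z\<close> by (auto simp: p_def poly_prod)
  have "poly p z \<noteq> 0" by (simp add: p0 Z_def)
  have "a \<noteq> z \<Longrightarrow> poly p a = 0" if "a \<in> set as" for a
    using that by (simp add: p0 Z_def)
  then have 1: "(\<Sum>a\<leftarrow>as. poly p a) = of_nat (count (mset as) z) * poly p z"
    by (induction as) (auto simp: algebra_simps)
  have "(\<Sum>j\<in>I. of_int (m j) * poly p (l j)) = (\<Sum>j\<in>I. if l j = z then of_int (m j) * poly p z else 0)"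
    by (intro sum.cong) (auto simp: p0 Z_def)
  also have "\<dots> = of_int (\<Sum>j\<in>{j \<in> I. l j = z}. m j) * poly p z"
    using assms(1) by (simp add: sum.inter_filter[symmetric] sum_distrib_right)
  finally have "of_nat (count (mset as) z) = (of_int (\<Sum>j\<in>{j \<in> I. l j = z}. m j) :: complex)"
    using 1 poly_sum[of p] \<open>poly p z \<noteq> 0\<close> by simp
  then have "of_int (int (count (mset as) z)) = (of_int (\<Sum>j\<in>{j \<in> I. l j = z}. m j) :: complex)"
    by (simp only: of_int_of_nat_eq)
  then show ?thesis
    by (simp only: of_int_eq_iff)
qed

text \<open>Passing to the complex numbers guarantees that the characteristic polynomial splits,
  which for a real matrix is not known in advance.\<close>

lemma kernel_char_poly_roots:
  assumes "finite S" "finite I"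
    and tr: "\<And>k. kernel_trace S (kernel_power S P k) = (\<Sum>j\<in>I. of_int (m j) * l j ^ k)"
  shows "\<exists>as. map_poly complex_of_real (kernel_char_poly S P) = (\<Prod>a\<leftarrow>as. [:- a, 1:]) \<and>
    (\<forall>z. int (count (mset as) z) = (\<Sum>j\<in>{j \<in> I. complex_of_real (l j) = z}. m j))"
proof -
  let ?A = "map_mat complex_of_real (kernel_matrix S P)"
  have A: "?A \<in> carrier_mat (card S) (card S)" by simp
  then obtain as where as: "char_poly ?A = (\<Prod>a\<leftarrow>as. [:- a, 1:])"
    using char_poly_factorized by blast
  have "(\<Sum>a\<leftarrow>as. a ^ k) = (\<Sum>j\<in>I. of_int (m j) * complex_of_real (l j) ^ k)" for k
  proof -
    have "?A ^\<^sub>m k = map_mat complex_of_real (kernel_matrix S P ^\<^sub>m k)"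
      by (simp add: of_real_hom.mat_hom_pow[OF kernel_matrix_carrier])
    then have "(\<Sum>a\<leftarrow>as. a ^ k) = mat_trace (map_mat complex_of_real (kernel_matrix S (kernel_power S P k)))"
      using mat_trace_pow_eigenvalues[OF A as, of k] kernel_matrix_power[OF assms(1)] by simp
    also have "\<dots> = complex_of_real (mat_trace (kernel_matrix S (kernel_power S P k)))"
      by (simp add: mat_trace_def kernel_matrix_def)
    also have "\<dots> = (\<Sum>j\<in>I. of_int (m j) * complex_of_real (l j) ^ k)"
      by (simp add: mat_trace_kernel_matrix[OF assms(1)] tr)
    finally show ?thesis .
  qed
  from power_sums_determine_count[OF assms(2) this]
  have "\<And>z. int (count (mset as) z) = (\<Sum>j\<in>{j \<in> I. complex_of_real (l j) = z}. m j)" .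
  moreover have "map_poly complex_of_real (kernel_char_poly S P) = char_poly ?A"
    by (simp add: kernel_char_poly_def of_real_hom.char_poly_hom[OF kernel_matrix_carrier])
  ultimately show ?thesis using as by auto
qed

text \<open>For pairwise different \<open>l\<close> the integer \<open>m j\<close> counts how often
  \<open>l j\<close> occurs among the roots.\<close>

lemma kernel_trace_multiplicity_nonneg:
  assumes "finite S" "finite I" "inj_on l I" "j \<in> I"
    and "\<And>k. kernel_trace S (kernel_power S P k) = (\<Sum>j\<in>I. of_int (m j) * l j ^ k)"
  shows "m j \<ge> 0"
proof -
  obtain as where "\<And>z. int (count (mset as) z) = (\<Sum>j\<in>{j \<in> I. complex_of_real (l j) = z}. m j)"
    using kernel_char_poly_roots[OF assms(1,2,5)] by blast
  from this[of "complex_of_real (l j)"] have "(\<Sum>j\<in>{i \<in> I. l i = l j}. m j) \<ge> 0"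
    using of_nat_0_le_iff[of "count (mset as) (complex_of_real (l j))", where 'a = int]
    by (simp only: of_real_eq_iff)
  moreover have "{i \<in> I. l i = l j} = {j}"
    using assms(3,4) by (auto simp: inj_on_def)
  ultimately show ?thesis by simp
qed

text \<open>Indices with the same \<open>l j\<close> simply add their exponents. The two polynomials
  are compared after embedding into the complex ones, and the embedding is injective.\<close>

lemma kernel_char_poly_eqI:
  assumes "finite S" "finite I" "\<And>j. j \<in> I \<Longrightarrow> m j \<ge> 0"
    and "\<And>k. kernel_trace S (kernel_power S P k) = (\<Sum>j\<in>I. of_int (m j) * l j ^ k)"
  shows "kernel_char_poly S P = (\<Prod>j\<in>I. [:- l j, 1:] ^ nat (m j))"
proof -
  interpret of_real_hom': map_poly_inj_idom_hom complex_of_real ..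
  obtain as where as: "map_poly complex_of_real (kernel_char_poly S P) = (\<Prod>a\<leftarrow>as. [:- a, 1:])"
    and cnt: "\<And>z. int (count (mset as) z) = (\<Sum>j\<in>{j \<in> I. complex_of_real (l j) = z}. m j)"
    using kernel_char_poly_roots[OF assms(1,2,4)] by blast
  have "mset as = (\<Sum>j\<in>I. replicate_mset (nat (m j)) (complex_of_real (l j)))"
  proof (rule multiset_eqI)
    fix z
    have "int (count (\<Sum>j\<in>I. replicate_mset (nat (m j)) (complex_of_real (l j))) z) =
        (\<Sum>j\<in>I. if complex_of_real (l j) = z then m j else 0)"
      using assms(3) by (auto simp: count_sum intro!: sum.cong)
    also have "\<dots> = int (count (mset as) z)"
      using assms(2) by (simp add: cnt sum.inter_filter)
    finally show "count (mset as) z = count (\<Sum>j\<in>I. replicate_mset (nat (m j)) (complex_of_real (l j))) z"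
      by simp
  qed
  moreover have "(\<Prod>a\<in>#(\<Sum>j\<in>I. replicate_mset (nat (m j)) (complex_of_real (l j))). [:- a, 1:]) =
      (\<Prod>j\<in>I. [:- complex_of_real (l j), 1:] ^ nat (m j))"
    using assms(2) by (induction rule: finite_induct) simp_all
  ultimately have "(\<Prod>a\<leftarrow>as. [:- a, 1:]) = (\<Prod>j\<in>I. [:- complex_of_real (l j), 1:] ^ nat (m j))"
    using prod_mset_prod_list[of "map (\<lambda>a. [:- a, 1:]) as"] by simp
  then have "map_poly complex_of_real (kernel_char_poly S P) =
      map_poly complex_of_real (\<Prod>j\<in>I. [:- l j, 1:] ^ nat (m j))"
    by (simp add: as of_real_hom'.hom_prod of_real_hom'.hom_power)
  then show ?thesis by simp
qed

section \<open>Moebius inversion\<close>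

text \<open>The recursion defining \<open>moebius\<close>, with the term for \<open>Z = Y\<close>
  brought to the other side.\<close>

lemma moebius_sum_left:
  assumes "finite L" "X \<in> L" "Y \<in> L" "Y \<subseteq> X"
  shows "(\<Sum>Z\<in>{Z \<in> L. Z \<subseteq> X \<and> Y \<subseteq> Z}. moebius L X Z) = (if X = Y then 1 else 0)"
proof -
  have "{Z \<in> L. Z \<subseteq> X \<and> Y \<subseteq> Z} = insert Y {Z \<in> L. Z \<subseteq> X \<and> Y \<subset> Z}"
    using assms by auto
  then have "(\<Sum>Z\<in>{Z \<in> L. Z \<subseteq> X \<and> Y \<subseteq> Z}. moebius L X Z) =
      moebius L X Y + (\<Sum>Z\<in>{Z \<in> L. Z \<subseteq> X \<and> Y \<subset> Z}. moebius L X Z)"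
    using assms(1) by simp
  moreover have "moebius L X X = 1"
    using assms by (subst moebius.simps) simp
  moreover have "(\<Sum>Z\<in>{Z \<in> L. Z \<subseteq> X \<and> Y \<subset> Z}. moebius L X Z) = 0" if "X = Y"
    using that by (intro sum.neutral) auto
  moreover have "moebius L X Y = - (\<Sum>Z\<in>{Z \<in> L. Z \<subseteq> X \<and> Y \<subset> Z}. moebius L X Z)" if "X \<noteq> Y"
    using assms that by (subst moebius.simps) simp
  ultimately show ?thesis
    by (cases "X = Y") simp_all
qed

lemma moebius_eq_0: "\<not> Y \<subseteq> X \<Longrightarrow> moebius L X Y = 0"
  by (subst moebius.simps) simp

lemma moebius_nonzero_imp_subset: "moebius L X Y \<noteq> 0 \<Longrightarrow> Y \<subseteq> X"
  by (rule ccontr) (simp add: moebius_eq_0)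

text \<open>As matrices over \<open>L\<close>, the defining recursion says that the Moebius function
  times the zeta function is the identity; on a finite set the factors may then be
  exchanged.\<close>

lemma moebius_sum_right:
  assumes L: "finite L" and XY: "X \<in> L" "Y \<in> L"
  shows "(\<Sum>Z\<in>{Z \<in> L. Z \<subseteq> X}. real_of_int (moebius L Z Y)) = (if X = Y then 1 else 0)"
proof -
  define \<zeta> where "\<zeta> X Y = (if Y \<subseteq> X then 1 else 0 :: real)" for X Y :: "'a set"
  have "(\<Sum>Z\<in>L. real_of_int (moebius L X Z) * \<zeta> Z Y) = (if X = Y then 1 else 0)"
    if "X \<in> L" "Y \<in> L" for X Y
  proof (cases "Y \<subseteq> X")
    case True
    have "(\<Sum>Z\<in>L. real_of_int (moebius L X Z) * \<zeta> Z Y) =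
        (\<Sum>Z\<in>{Z \<in> L. Z \<subseteq> X \<and> Y \<subseteq> Z}. real_of_int (moebius L X Z))"
      using L by (intro sum.mono_neutral_cong_right)
        (auto simp: \<zeta>_def dest: moebius_nonzero_imp_subset)
    also have "\<dots> = real_of_int (\<Sum>Z\<in>{Z \<in> L. Z \<subseteq> X \<and> Y \<subseteq> Z}. moebius L X Z)"
      by simp
    finally show ?thesis
      unfolding moebius_sum_left[OF L that True] by simp
  next
    case False
    have "moebius L X Z = 0 \<or> \<zeta> Z Y = 0" for Z
      using False by (auto simp: \<zeta>_def intro!: moebius_eq_0)
    then show ?thesis
      using False by (auto intro!: sum.neutral)
  qed
  from kernel_left_inverse_imp_right_inverse[OF L this XY]
  have "(\<Sum>Z\<in>L. \<zeta> X Z * real_of_int (moebius L Z Y)) = (if X = Y then 1 else 0)"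
    by simp
  moreover have "(\<Sum>Z\<in>L. \<zeta> X Z * real_of_int (moebius L Z Y)) =
      (\<Sum>Z\<in>{Z \<in> L. Z \<subseteq> X}. real_of_int (moebius L Z Y))"
    using L by (intro sum.mono_neutral_cong_right) (auto simp: \<zeta>_def)
  ultimately show ?thesis by simp
qed

text \<open>After interchanging the sums, the coefficient of \<open>f Z\<close> is the sum of
  \<open>moebius L Y Z\<close> over all \<open>Y\<close> inside \<open>X\<close>, and this vanishes
  unless \<open>Z = X\<close>.\<close>

lemma moebius_inversion:
  assumes L: "finite L" and X: "X \<in> L"
  shows "(\<Sum>Y\<in>{Y \<in> L. Y \<subseteq> X}. \<Sum>Z\<in>{Z \<in> L. Z \<subseteq> Y}. real_of_int (moebius L Y Z) * f Z) = f X"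
proof -
  have "(\<Sum>Y\<in>{Y \<in> L. Y \<subseteq> X}. \<Sum>Z\<in>{Z \<in> L. Z \<subseteq> Y}. real_of_int (moebius L Y Z) * f Z) =
      (\<Sum>Y\<in>{Y \<in> L. Y \<subseteq> X}. \<Sum>Z\<in>L. real_of_int (moebius L Y Z) * f Z)"
    using L by (intro sum.cong sum.mono_neutral_left) (auto simp: moebius_eq_0)
  also have "\<dots> = (\<Sum>Z\<in>L. (\<Sum>Y\<in>{Y \<in> L. Y \<subseteq> X}. real_of_int (moebius L Y Z)) * f Z)"
    by (subst sum.swap) (simp add: sum_distrib_right)
  also have "\<dots> = (\<Sum>Z\<in>L. if X = Z then f Z else 0)"
    by (intro sum.cong) (auto simp: moebius_sum_right[OF L X])
  also have "\<dots> = f X"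
    using L X by simp
  finally show ?thesis .
qed

section \<open>Sign vectors of a hyperplane arrangement\<close>

text \<open>Half-spaces and separation are defined through an arbitrary equation of the hyperplane;
  this compares it with a fixed one. The component \<open>w\<close> of \<open>a'\<close> orthogonal
  to \<open>a\<close> is a direction inside the hyperplane, so \<open>a'\<close> is orthogonal to it
  as well, and \<open>w\<close> is zero.\<close>

lemma hyperplane_eq_imp_proportional:
  fixes a a' :: "'a::euclidean_space"
  assumes "a \<noteq> 0" "a' \<noteq> 0" and eq: "{v. a \<bullet> v = b} = {v. a' \<bullet> v = b'}"
  obtains c where "c \<noteq> 0" "a' = c *\<^sub>R a" "b' = c * b"
proof -
  define p where "p = (b / (a \<bullet> a)) *\<^sub>R a"
  have mem: "a \<bullet> v = b \<longleftrightarrow> a' \<bullet> v = b'" for v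
    using eq by blast
  have p: "a \<bullet> p = b"
    using assms(1) by (simp add: p_def)
  define c where "c = (a' \<bullet> a) / (a \<bullet> a)"
  define w where "w = a' - c *\<^sub>R a"
  have aw: "a \<bullet> w = 0"
    using assms(1) by (simp add: w_def c_def inner_diff_right inner_commute)
  have "a' \<bullet> w = 0"
    using mem[of p] mem[of "p + w"] p aw by (simp add: inner_add_right)
  then have "w \<bullet> w = 0"
    using aw by (simp add: w_def inner_diff_left inner_diff_right inner_commute)
  then have a': "a' = c *\<^sub>R a"
    by (simp add: w_def)
  moreover have "b' = c * b"
    using mem[of p] p a' by auto
  ultimately show thesis
    using that assms(2) by auto
qed

text \<open>Fixing one equation per hyperplane turns its two sides into the signs 1 and -1, and a
  face into the sign vector shared by its points.\<close>

locale arrangement =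
  fixes A :: "'a::euclidean_space set set" and nrm :: "'a set \<Rightarrow> 'a" and off :: "'a set \<Rightarrow> real"
  assumes finite_A: "finite A"
    and nrm_nonzero: "H \<in> A \<Longrightarrow> nrm H \<noteq> 0"
    and hyperplane: "H \<in> A \<Longrightarrow> H = {v. nrm H \<bullet> v = off H}"
begin

lemma mem_hyperplane: "H \<in> A \<Longrightarrow> v \<in> H \<longleftrightarrow> nrm H \<bullet> v = off H"
  using hyperplane[of H] by blast

lemma hyperplane_uminus: "H \<in> A \<Longrightarrow> H = {v. (- nrm H) \<bullet> v = - off H}"
  using mem_hyperplane by auto

definition sg :: "'a set \<Rightarrow> 'a \<Rightarrow> real" where
  "sg H v = sgn (nrm H \<bullet> v - off H)"

text \<open>The face containing \<open>v\<close>. Working with points makes identities between faces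
  into identities between signs.\<close>

definition cell :: "'a \<Rightarrow> 'a set" where
  "cell v = {u. \<forall>H\<in>A. sg H u = sg H v}"

definition zeros :: "'a \<Rightarrow> 'a set set" where
  "zeros v = {H \<in> A. v \<in> H}"

definition supp :: "'a \<Rightarrow> 'a set" where
  "supp v = \<Inter>(zeros v)"

lemma sg_cases: "sg H v = 0 \<or> sg H v = 1 \<or> sg H v = - 1"
  by (simp add: sg_def sgn_if)

lemma sg_eq_0_iff: "H \<in> A \<Longrightarrow> sg H v = 0 \<longleftrightarrow> v \<in> H"
  by (simp add: mem_hyperplane sg_def sgn_zero_iff)

lemma sg_pos_iff: "sg H v = 1 \<longleftrightarrow> nrm H \<bullet> v > off H"
  by (simp add: sg_def sgn_if)

lemma sg_neg_iff: "sg H v = - 1 \<longleftrightarrow> nrm H \<bullet> v < off H"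
  by (simp add: sg_def sgn_if)

lemma open_sg_eq: "s \<noteq> 0 \<Longrightarrow> open {u. sg H u = s}"
proof -
  assume "s \<noteq> 0"
  show ?thesis
  proof (cases "s = 1 \<or> s = - 1")
    case True
    then show ?thesis
      using open_halfspace_gt[of "off H" "nrm H"] open_halfspace_lt[of "nrm H" "off H"]
      by (auto simp: sg_pos_iff sg_neg_iff)
  next
    case False
    then have "{u. sg H u = s} = {}"
      using sg_cases[of H] \<open>s \<noteq> 0\<close> by force
    then show ?thesis by simp
  qed
qed

lemma convex_sg_eq: "convex {u. sg H u = s}"
proof -
  consider "s = 0" | "s = 1" | "s = - 1" | "{u. sg H u = s} = {}"
    using sg_cases[of H] by blast
  then show ?thesis
  proof cases
    case 1
    then have "{u. sg H u = s} = {u. nrm H \<bullet> u = off H}"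
      by (auto simp: sg_def sgn_zero_iff)
    then show ?thesis by (simp add: convex_hyperplane)
  next
    case 2
    then have "{u. sg H u = s} = {u. nrm H \<bullet> u > off H}"
      by (simp add: sg_pos_iff)
    then show ?thesis by (simp add: convex_halfspace_gt)
  next
    case 3
    then have "{u. sg H u = s} = {u. nrm H \<bullet> u < off H}"
      by (simp add: sg_neg_iff)
    then show ?thesis by (simp add: convex_halfspace_lt)
  qed simp
qed

lemma cell_alt: "cell v = (\<Inter>H\<in>A. {u. sg H u = sg H v})"
  by (auto simp: cell_def)

lemma convex_cell: "convex (cell v)"
  unfolding cell_alt by (intro convex_INT convex_sg_eq)

lemma mem_cell: "v \<in> cell v"
  by (simp add: cell_def)

lemma cell_eq_iff: "cell u = cell v \<longleftrightarrow> (\<forall>H\<in>A. sg H u = sg H v)"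
  by (auto simp: cell_def)

lemma mem_cell_iff: "u \<in> cell v \<longleftrightarrow> cell u = cell v"
  by (auto simp: cell_def)

lemma zeros_alt: "zeros v = {H \<in> A. sg H v = 0}"
  by (auto simp: zeros_def sg_eq_0_iff)

lemma cell_subset_iff:
  assumes "H \<in> A"
  shows "cell v \<subseteq> H \<longleftrightarrow> v \<in> H"
  using assms by (auto simp: cell_def simp flip: sg_eq_0_iff)

lemma face_support_cell: "face_support A (cell v) = supp v"
  by (simp add: face_support_def supp_def zeros_def cell_subset_iff cong: conj_cong)

lemma mem_supp: "v \<in> supp v"
  by (simp add: supp_def zeros_def)

lemma supp_flat: "supp v \<in> flats A"
  using mem_supp[of v] by (auto simp: flats_def supp_def zeros_def)

lemma flat_mem_iff_supp:
  assumes "Y \<in> flats A"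
  shows "v \<in> Y \<longleftrightarrow> supp v \<subseteq> Y"
  using assms by (auto simp: flats_def supp_def zeros_def)

lemma flat_mem_iff_cell:
  assumes "Y \<in> flats A"
  shows "v \<in> Y \<longleftrightarrow> cell v \<subseteq> Y"
proof
  assume "v \<in> Y"
  obtain B where B: "B \<subseteq> A" "Y = \<Inter>B" using assms by (auto simp: flats_def)
  then show "cell v \<subseteq> Y"
    using \<open>v \<in> Y\<close> cell_subset_iff by blast
qed (use mem_cell in auto)

lemma finite_flats: "finite (flats A)"
proof -
  have "flats A \<subseteq> Inter ` Pow A" by (auto simp: flats_def)
  then show ?thesis using finite_A by (meson finite_Pow_iff finite_imageI finite_subset)
qed

lemma UNIV_flat: "UNIV \<in> flats A"
  by (force simp: flats_def)

lemma affine_flat: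
  assumes "Y \<in> flats A"
  shows "affine Y"
proof -
  obtain B where B: "B \<subseteq> A" "Y = \<Inter>B" using assms by (auto simp: flats_def)
  have "affine H" if "H \<in> B" for H
    using hyperplane[of H] affine_hyperplane[of "nrm H" "off H"] that B(1) by (metis subsetD)
  then show ?thesis unfolding B(2) by (intro affine_Inter) auto
qed

lemma flat_nonempty: "Y \<in> flats A \<Longrightarrow> Y \<noteq> {}"
  by (simp add: flats_def)

lemma aff_dim_flat: "Y \<in> flats A \<Longrightarrow> aff_dim Y = int (flat_dim Y)"
  using aff_dim_geq[of Y] aff_dim_negative_iff[of Y] flat_nonempty[of Y] by (simp add: flat_dim_def not_less[symmetric] del: aff_dim_negative_iff)

lemma flat_dim_le: "Y \<in> flats A \<Longrightarrow> flat_dim Y \<le> DIM('a)"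
  using aff_dim_le_DIM[of Y] aff_dim_flat[of Y] by simp

text \<open>Any equation of \<open>H\<close> is a nonzero multiple of the chosen one, and the sign
  of the factor decides which of the two sides it describes.\<close>

lemma open_halfspaces_eq:
  assumes H: "H \<in> A"
  shows "open_halfspaces H = {{u. sg H u = 1}, {u. sg H u = - 1}}"
proof (intro equalityI subsetI)
  fix S assume "S \<in> open_halfspaces H"
  then obtain a b where ab: "S = {v. a \<bullet> v < b}" "a \<noteq> 0" "H = {v. a \<bullet> v = b}"
    by (auto simp: open_halfspaces_def)
  obtain c where c: "c \<noteq> 0" "a = c *\<^sub>R nrm H" "b = c * off H"
    using hyperplane_eq_imp_proportional[of "nrm H" a "off H" b] nrm_nonzero[OF H] hyperplane[OF H] ab
    by metis
  show "S \<in> {{u. sg H u = 1}, {u. sg H u = - 1}}"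
  proof (cases "c > 0")
    case True
    then have "S = {u. sg H u = - 1}" by (simp add: ab(1) c(2,3) sg_neg_iff)
    then show ?thesis by simp
  next
    case False
    then have "c < 0" using c by simp
    then have "S = {u. sg H u = 1}" by (simp add: ab(1) c(2,3) sg_pos_iff)
    then show ?thesis by simp
  qed
next
  fix S assume "S \<in> {{u. sg H u = 1}, {u. sg H u = - 1}}"
  then consider "S = {u. sg H u = 1}" | "S = {u. sg H u = - 1}" by blast
  then show "S \<in> open_halfspaces H"
  proof cases
    case 1
    have "S = {v. (- nrm H) \<bullet> v < - off H}" "- nrm H \<noteq> 0"
      using 1 nrm_nonzero[OF H] by (simp_all add: sg_pos_iff)
    with hyperplane_uminus[OF H] show ?thesis unfolding open_halfspaces_def by blast
  next
    case 2
    have "S = {v. nrm H \<bullet> v < off H}"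
      using 2 by (simp add: sg_neg_iff)
    with nrm_nonzero[OF H] hyperplane[OF H] show ?thesis unfolding open_halfspaces_def by blast
  qed
qed

text \<open>A nonempty intersection contains a point \<open>v\<close>, and then the side chosen for
  each hyperplane can only be the one on which \<open>v\<close> lies.\<close>

lemma faces_eq: "faces A = range cell"
proof (intro equalityI subsetI)
  fix F assume "F \<in> faces A"
  then obtain S where F: "F \<noteq> {}" "F = (\<Inter>H\<in>A. S H)"
    and S: "\<And>H. H \<in> A \<Longrightarrow> S H = H \<or> S H \<in> open_halfspaces H"
    by (auto simp: faces_def)
  obtain v where v: "v \<in> F" using F by auto
  have "S H = {u. sg H u = sg H v}" if H: "H \<in> A" for H
  proof -
    have "v \<in> S H" using v F H by auto
    moreover have "S H = {u. sg H u = 0} \<or> S H = {u. sg H u = 1} \<or> S H = {u. sg H u = - 1}"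
    proof -
      have "H = {u. sg H u = 0}" using sg_eq_0_iff[OF H] by blast
      then show ?thesis using S[OF H] unfolding open_halfspaces_eq[OF H] by (metis insertE singletonD)
    qed
    ultimately show ?thesis by (elim disjE) simp_all
  qed
  then have "F = cell v" unfolding F cell_alt by (intro INF_cong) auto
  then show "F \<in> range cell" by simp
next
  fix F assume "F \<in> range cell"
  then obtain v where v: "F = cell v" by auto
  have "{u. sg H u = sg H v} = H \<or> {u. sg H u = sg H v} \<in> open_halfspaces H" if H: "H \<in> A" for H
  proof (cases "sg H v = 0")
    case True
    moreover have "{u. sg H u = 0} = H" using sg_eq_0_iff[OF H] by blast
    ultimately show ?thesis by simp
  next
    case False
    then have "sg H v = 1 \<or> sg H v = - 1" using sg_cases by blast
    then show ?thesis by (elim disjE) (simp_all add: open_halfspaces_eq[OF H])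
  qed
  then show "F \<in> faces A"
    using mem_cell[of v] unfolding faces_def v cell_alt
    by (intro CollectI conjI exI[of _ "\<lambda>H. {u. sg H u = sg H v}"]) auto
qed

text \<open>The parts into which the hyperplanes of \<open>B\<close> cut \<open>G\<close>.
  Subfamilies \<open>B\<close> of the arrangement are allowed for the sake of the induction in the
  Euler relation.\<close>

definition pieces :: "'a set set \<Rightarrow> 'a set \<Rightarrow> 'a set set" where
  "pieces B G = (\<lambda>v. {u \<in> G. \<forall>H\<in>B. sg H u = sg H v}) ` G"

lemma finite_pieces:
  assumes "finite B"
  shows "finite (pieces B G)"
proof -
  let ?S = "B \<rightarrow>\<^sub>E {0, 1, - 1 :: real}"
  have "pieces B G \<subseteq> (\<lambda>s. {u \<in> G. \<forall>H\<in>B. sg H u = s H}) ` ?S"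
    unfolding pieces_def
  proof safe
    fix v
    have "restrict (\<lambda>H. sg H v) B \<in> ?S" using sg_cases by auto
    moreover have "{u \<in> G. \<forall>H\<in>B. sg H u = sg H v} = {u \<in> G. \<forall>H\<in>B. sg H u = restrict (\<lambda>H. sg H v) B H}"
      by auto
    ultimately show "{u \<in> G. \<forall>H\<in>B. sg H u = sg H v} \<in> (\<lambda>s. {u \<in> G. \<forall>H\<in>B. sg H u = s H}) ` ?S"
      by blast
  qed
  moreover have "finite ?S" using assms by (intro finite_PiE) auto
  ultimately show ?thesis by (meson finite_imageI finite_subset)
qed

lemma finite_faces: "finite (faces A)"
proof -
  have "faces A = pieces A UNIV"
    by (simp add: faces_eq pieces_def cell_def)
  then show ?thesis
    using finite_pieces[OF finite_A] by simp
qed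

text \<open>A cell off all hyperplanes is convex, hence connected. Conversely, a connected set with
  points on both sides of a hyperplane meets it by the intermediate value theorem, so no sign
  changes within a component.\<close>

lemma chambers_eq: "chambers A = {cell v | v. zeros v = {}}"
proof -
  have eq: "connected_component_set (- \<Union>A) v = cell v" if v: "v \<notin> \<Union>A" for v
  proof
    have z: "sg H v \<noteq> 0" if "H \<in> A" for H using v that by (auto simp: sg_eq_0_iff)
    then have "cell v \<subseteq> - \<Union>A" by (auto simp: cell_def simp flip: sg_eq_0_iff)
    then show "cell v \<subseteq> connected_component_set (- \<Union>A) v"
      by (intro connected_component_maximal mem_cell convex_connected convex_cell)
    show "connected_component_set (- \<Union>A) v \<subseteq> cell v"
    proof
      fix u assume u: "u \<in> connected_component_set (- \<Union>A) v"
      let ?C = "connected_component_set (- \<Union>A) v"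
      have sub: "?C \<subseteq> - \<Union>A" by (rule connected_component_subset)
      have vC: "v \<in> ?C" using v by (simp add: connected_component_refl)
      have "sg H u = sg H v" if H: "H \<in> A" for H
      proof (rule ccontr)
        assume ne: "sg H u \<noteq> sg H v"
        have u0: "sg H u \<noteq> 0" using u sub H by (auto simp: sg_eq_0_iff)
        have "\<exists>w\<in>?C. nrm H \<bullet> w = off H"
        proof (cases "sg H u = 1")
          case True
          then have "sg H v = - 1" using ne z[OF H] sg_cases[of H v] by auto
          then show ?thesis using True u vC connected_ivt_hyperplane[of ?C v u "nrm H" "off H"]
            by (auto simp: sg_pos_iff sg_neg_iff)
        next
          case False
          then have "sg H u = - 1" "sg H v = 1" using u0 ne z[OF H] sg_cases[of H v] sg_cases[of H u] by auto
          then show ?thesis using u vC connected_ivt_hyperplane[of ?C u v "nrm H" "off H"]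
            by (auto simp: sg_pos_iff sg_neg_iff)
        qed
        then show False using sub mem_hyperplane[OF H] H by blast
      qed
      then show "u \<in> cell v" by (simp add: cell_def)
    qed
  qed
  have z: "zeros v = {} \<longleftrightarrow> v \<in> - \<Union>A" for v by (auto simp: zeros_def)
  have "chambers A = connected_component_set (- \<Union>A) ` (- \<Union>A)"
    unfolding chambers_def components_def by simp
  also have "\<dots> = cell ` (- \<Union>A)" using eq by (intro image_cong) auto
  finally show ?thesis unfolding z by blast
qed

lemma chambers_subset_faces: "chambers A \<subseteq> faces A"
  by (auto simp: chambers_eq faces_eq)

lemma finite_chambers: "finite (chambers A)"
  using finite_subset[OF chambers_subset_faces finite_faces] .

lemma chamber_sg_nonzero: "zeros d = {} \<Longrightarrow> H \<in> A \<Longrightarrow> sg H d \<noteq> 0"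
  by (auto simp: zeros_alt)

section \<open>Moving a point along a segment\<close>

lemma ex_isolating_radius:
  "\<exists>r>0. \<forall>q\<in>ball u r. \<forall>H\<in>A. sg H u \<noteq> 0 \<longrightarrow> sg H q = sg H u"
proof -
  let ?O = "\<Inter>H\<in>{H \<in> A. sg H u \<noteq> 0}. {q. sg H q = sg H u}"
  have "open ?O" using finite_A by (intro open_INT ballI open_sg_eq) auto
  moreover have "u \<in> ?O" by simp
  ultimately obtain r where "r > 0" "ball u r \<subseteq> ?O" by (meson open_contains_ball)
  then show ?thesis by (intro exI[of _ r]) blast
qed

text \<open>Along the segment the affine function of \<open>H\<close> is a convex combination with a
  positive share of its value at \<open>v\<close>; a value at \<open>u\<close> that is zero or of
  the same sign cannot cancel it.\<close>

lemma sg_segment: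
  assumes "0 < t" "t \<le> 1" "sg H v \<noteq> 0" "sg H u = 0 \<or> sg H u = sg H v"
  shows "sg H (u + t *\<^sub>R (v - u)) = sg H v"
proof -
  have e: "nrm H \<bullet> (u + t *\<^sub>R (v - u)) - off H =
      (1 - t) * (nrm H \<bullet> u - off H) + t * (nrm H \<bullet> v - off H)"
    by (simp add: inner_add_right inner_diff_right algebra_simps)
  have mono: "(1 - t) * x + t * y > 0" if "x \<ge> 0" "y > 0" for x y :: real
    using that assms(1,2) by (simp add: add_nonneg_pos)
  have anti: "(1 - t) * x + t * y < 0" if "x \<le> 0" "y < 0" for x y :: real
    using mono[of "- x" "- y"] that by simp
  consider "sg H v = 1" | "sg H v = - 1" using assms(3) sg_cases by blast
  then show ?thesis
  proof cases
    case 1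
    then have "nrm H \<bullet> u - off H \<ge> 0" "nrm H \<bullet> v - off H > 0"
      using assms(4) sg_pos_iff[of H u] sg_pos_iff[of H v] by (auto simp: sg_def sgn_zero_iff)
    then show ?thesis using mono 1 unfolding sg_def e by (simp add: sg_def)
  next
    case 2
    then have "nrm H \<bullet> u - off H \<le> 0" "nrm H \<bullet> v - off H < 0"
      using assms(4) sg_neg_iff[of H u] sg_neg_iff[of H v] by (auto simp: sg_def sgn_zero_iff)
    then show ?thesis using anti 2 unfolding sg_def e by (simp add: sg_def)
  qed
qed

lemma segment_near:
  fixes u v :: 'a
  assumes "e > 0"
  obtains t where "0 < t" "t \<le> 1" "dist u (u + t *\<^sub>R (v - u)) < e"
proof -
  \<comment> \<open>The summand 1 keeps the denominator positive when \<open>u = v\<close>.\<close>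
  define t where "t = min 1 (e / (2 * (norm (v - u) + 1)))"
  have pos: "norm (v - u) + 1 > 0" by (simp add: add_nonneg_pos)
  have "0 < t" "t \<le> 1" using assms pos by (auto simp: t_def)
  moreover have "t * norm (v - u) \<le> e / (2 * (norm (v - u) + 1)) * norm (v - u)"
    by (intro mult_right_mono) (auto simp: t_def)
  moreover have "\<dots> < e" using assms pos
    by (simp add: field_simps) (smt (verit) mult_nonneg_nonneg norm_ge_zero)
  ultimately show thesis using that[of t] by (simp add: dist_norm)
qed

text \<open>A short move from \<open>u\<close> towards \<open>v\<close> keeps the nonzero signs of
  \<open>u\<close> and replaces the zero ones by the signs of \<open>v\<close>. So the product of
  two sign vectors belongs to a point, and even to one arbitrarily close to \<open>u\<close>, which
  is what the count of fixed chambers uses.\<close>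

lemma ex_mult_near:
  assumes "e > 0"
  shows "\<exists>p. dist u p < e \<and> (\<forall>H\<in>A. sg H p = (if sg H u = 0 then sg H v else sg H u))"
proof -
  obtain r where r: "r > 0" "\<And>q H. q \<in> ball u r \<Longrightarrow> H \<in> A \<Longrightarrow> sg H u \<noteq> 0 \<Longrightarrow> sg H q = sg H u"
    using ex_isolating_radius[of u] by blast
  obtain t where t: "0 < t" "t \<le> 1" "dist u (u + t *\<^sub>R (v - u)) < min r e"
    using segment_near[of "min r e" u v] r assms by auto
  let ?p = "u + t *\<^sub>R (v - u)"
  have "sg H ?p = sg H v" if "H \<in> A" "sg H u = 0" for H
  proof (cases "sg H v = 0")
    case True
    have "nrm H \<bullet> ?p - off H = (1 - t) * (nrm H \<bullet> u - off H) + t * (nrm H \<bullet> v - off H)"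
      by (simp add: inner_add_right inner_diff_right algebra_simps)
    then show ?thesis using True that by (simp add: sg_def sgn_zero_iff)
  qed (use sg_segment t that in auto)
  then show ?thesis using t r(2)[of ?p] by (intro exI[of _ ?p]) auto
qed

text \<open>Only the signs of \<open>pmult u v\<close> matter; the point itself is an arbitrary
  choice.\<close>

definition pmult :: "'a \<Rightarrow> 'a \<Rightarrow> 'a" where
  "pmult u v = (SOME p. \<forall>H\<in>A. sg H p = (if sg H u = 0 then sg H v else sg H u))"

lemma sg_mult:
  assumes "H \<in> A"
  shows "sg H (pmult u v) = (if sg H u = 0 then sg H v else sg H u)"
proof -
  have "\<exists>p. \<forall>H\<in>A. sg H p = (if sg H u = 0 then sg H v else sg H u)"
  proof -
    have "\<exists>p. dist u p < 1 \<and> (\<forall>H\<in>A. sg H p = (if sg H u = 0 then sg H v else sg H u))"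
      by (rule ex_mult_near) simp
    then show ?thesis by (elim exE conjE) (rule exI)
  qed
  from someI_ex[OF this, folded pmult_def] assms show ?thesis by (rule bspec)
qed

text \<open>A point of \<open>Y\<close> on as few hyperplanes as possible lies only on hyperplanes
  containing \<open>Y\<close>: for any other \<open>H\<close>, the product with a point of
  \<open>Y\<close> off \<open>H\<close> would stay in \<open>Y\<close> and lie on fewer
  hyperplanes.\<close>

lemma ex_generic_point:
  assumes Y: "Y \<in> flats A"
  shows "\<exists>p. supp p = Y"
proof -
  obtain B where B: "B \<subseteq> A" "Y = \<Inter>B" using assms by (auto simp: flats_def)
  obtain p where p: "p \<in> Y" "\<And>q. q \<in> Y \<Longrightarrow> card (zeros p) \<le> card (zeros q)"
    using ex_has_least_nat[of "\<lambda>p. p \<in> Y" _ "\<lambda>p. card (zeros p)"] flat_nonempty[OF Y] by auto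
  have "Y \<subseteq> H" if H: "H \<in> zeros p" for H
  proof (rule ccontr)
    assume "\<not> Y \<subseteq> H"
    then obtain q where q: "q \<in> Y" "q \<notin> H" by auto
    have z: "zeros (pmult p q) = zeros p \<inter> zeros q"
      by (auto simp: zeros_alt sg_mult split: if_splits)
    have "B \<subseteq> zeros p \<inter> zeros q" using B p(1) q(1) by (auto simp: zeros_def)
    then have "pmult p q \<in> Y" unfolding z[symmetric] using B by (auto simp: zeros_def)
    moreover have "zeros p \<inter> zeros q \<subset> zeros p" using H q by (auto simp: zeros_def)
    then have "card (zeros (pmult p q)) < card (zeros p)"
      unfolding z using finite_A by (intro psubset_card_mono) (auto simp: zeros_def)
    ultimately show False using p(2) by fastforce
  qed
  then have "Y \<subseteq> supp p" by (auto simp: supp_def)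
  moreover have "supp p \<subseteq> Y" using p(1) flat_mem_iff_supp[OF Y] by simp
  ultimately show ?thesis by blast
qed

section \<open>The product of faces\<close>

text \<open>Independent of the chosen points when \<open>F\<close> and \<open>G\<close> are faces,
  because the signs of \<open>pmult\<close> depend only on those of its arguments.\<close>

definition fmul :: "'a set \<Rightarrow> 'a set \<Rightarrow> 'a set" where
  "fmul F G = cell (pmult (SOME u. u \<in> F) (SOME v. v \<in> G))"

lemma fmul_cell: "fmul (cell u) (cell v) = cell (pmult u v)"
proof -
  have "(SOME w. w \<in> cell u) \<in> cell u" "(SOME w. w \<in> cell v) \<in> cell v"
    using mem_cell by (metis someI)+
  then show ?thesis
    unfolding fmul_def cell_eq_iff by (auto simp: sg_mult cell_def)
qed

lemma fmul_face: "fmul F G \<in> faces A"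
  by (simp add: fmul_def faces_eq)

lemma fmul_assoc:
  assumes "F \<in> faces A" "G \<in> faces A" "K \<in> faces A"
  shows "fmul (fmul F G) K = fmul F (fmul G K)"
  using assms unfolding faces_eq by (clarsimp simp: fmul_cell cell_eq_iff sg_mult)

lemma fmul_chamber:
  assumes "F \<in> faces A" "C \<in> chambers A"
  shows "fmul F C \<in> chambers A"
proof -
  obtain u v where "F = cell u" "C = cell v" "zeros v = {}"
    using assms by (auto simp: faces_eq chambers_eq)
  moreover have "zeros (pmult u v) = {}"
    using \<open>zeros v = {}\<close> by (auto simp: zeros_alt sg_mult)
  ultimately show ?thesis by (auto simp: fmul_cell chambers_eq)
qed

text \<open>A sign of the product is zero exactly when both factors have sign zero there. This is
  why the total weight inside \<open>Y\<close> is multiplicative under convolution of face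
  weights.\<close>

lemma fmul_subset_flat_iff:
  assumes "F \<in> faces A" "G \<in> faces A" "Y \<in> flats A"
  shows "fmul F G \<subseteq> Y \<longleftrightarrow> F \<subseteq> Y \<and> G \<subseteq> Y"
proof -
  obtain u v where uv: "F = cell u" "G = cell v" using assms by (auto simp: faces_eq)
  obtain B where B: "B \<subseteq> A" "Y = \<Inter>B" using assms(3) by (auto simp: flats_def)
  have "pmult u v \<in> H \<longleftrightarrow> u \<in> H \<and> v \<in> H" if "H \<in> B" for H
    using that B by (auto simp: subset_iff sg_mult simp flip: sg_eq_0_iff split: if_splits)
  then show ?thesis
    unfolding uv fmul_cell flat_mem_iff_cell[OF assms(3), symmetric] using B(2) by auto
qed

text \<open>An open half-space that contains a point of the closure meets the cell itself, which
  gives the signs. Conversely, the segment from a point of the face to \<open>d\<close> runs inside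
  the chamber right after its start.\<close>

lemma face_subset_closure_iff:
  assumes "zeros d = {}"
  shows "cell p \<subseteq> closure (cell d) \<longleftrightarrow> (\<forall>H\<in>A. sg H p \<noteq> 0 \<longrightarrow> sg H d = sg H p)"
proof
  assume sub: "cell p \<subseteq> closure (cell d)"
  show "\<forall>H\<in>A. sg H p \<noteq> 0 \<longrightarrow> sg H d = sg H p"
  proof safe
    fix H assume H: "H \<in> A" "sg H p \<noteq> 0"
    have "p \<in> closure (cell d)" using sub mem_cell by blast
    then have "{u. sg H u = sg H p} \<inter> cell d \<noteq> {}"
      using open_sg_eq[OF H(2), of H] open_Int_closure_eq_empty[of "{u. sg H u = sg H p}" "cell d"] by blast
    then show "sg H d = sg H p" using H by (auto simp: cell_def)
  qed
next
  assume s: "\<forall>H\<in>A. sg H p \<noteq> 0 \<longrightarrow> sg H d = sg H p"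
  show "cell p \<subseteq> closure (cell d)"
  proof
    fix q assume "q \<in> cell p"
    then have sq: "sg H q = 0 \<or> sg H q = sg H d" if "H \<in> A" for H
      using s that by (auto simp: cell_def)
    have "\<exists>y\<in>cell d. dist y q < e" if "e > 0" for e
    proof -
      obtain t where t: "0 < t" "t \<le> 1" "dist q (q + t *\<^sub>R (d - q)) < e"
        using segment_near[OF \<open>e > 0\<close>, of q d] by auto
      have "q + t *\<^sub>R (d - q) \<in> cell d"
        unfolding cell_def using sg_segment[OF t(1,2)] chamber_sg_nonzero[OF assms] sq by simp
      then show ?thesis using t(3) by (metis dist_commute)
    qed
    then show "q \<in> closure (cell d)" by (simp add: closure_approachable)
  qed
qed

lemma separates_cell_iff:
  assumes H: "H \<in> A" and "zeros c = {}" "zeros d = {}"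
  shows "separates H (cell c) (cell d) \<longleftrightarrow> sg H c \<noteq> sg H d"
proof
  assume "separates H (cell c) (cell d)"
  then obtain a b where ab: "a \<noteq> 0" "H = {v. a \<bullet> v = b}" "a \<bullet> c < b" "a \<bullet> d > b"
    unfolding separates_def using mem_cell[of c] mem_cell[of d] by blast
  have "{v. nrm H \<bullet> v = off H} = {v. a \<bullet> v = b}" using hyperplane[OF H] ab(2) by (rule trans[OF sym])
  then obtain k where k: "k \<noteq> 0" "a = k *\<^sub>R nrm H" "b = k * off H"
    by (rule hyperplane_eq_imp_proportional[OF nrm_nonzero[OF H] ab(1)])
  show "sg H c \<noteq> sg H d"
  proof (cases "k > 0")
    case True
    then show ?thesis using ab(3,4) k by (auto simp: sg_def sgn_if)
  next
    case False
    then show ?thesis using ab(3,4) k by (auto simp: sg_def sgn_if mult_less_cancel_left)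
  qed
next
  assume ne: "sg H c \<noteq> sg H d"
  have nz: "sg H c \<noteq> 0" "sg H d \<noteq> 0" using assms chamber_sg_nonzero by auto
  have mem: "sg H u = sg H w" if "u \<in> cell w" for u w using that H by (simp add: cell_def)
  show "separates H (cell c) (cell d)"
  proof (cases "sg H c = - 1")
    case True
    then have "sg H d = 1" using ne nz sg_cases[of H d] by auto
    then show ?thesis
      unfolding separates_def using True mem
      by (intro exI[of _ "nrm H"] exI[of _ "off H"] conjI nrm_nonzero[OF H] hyperplane[OF H])
        (auto simp flip: sg_pos_iff sg_neg_iff)
  next
    case False
    then have 1: "sg H c = 1" using nz sg_cases[of H c] by auto
    then have "sg H d = - 1" using ne nz sg_cases[of H d] by auto
    then show ?thesis
      unfolding separates_def using 1 mem nrm_nonzero[OF H]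
      by (intro exI[of _ "- nrm H"] exI[of _ "- off H"] conjI hyperplane_uminus[OF H])
        (auto simp flip: sg_pos_iff sg_neg_iff)
  qed
qed

text \<open>Each hyperplane separating \<open>C\<close> from the product also separates
  \<open>C\<close> from every chamber whose closure contains \<open>F\<close>. Hence the product is
  a minimiser, and another minimiser is separated from \<open>C\<close> by the same hyperplanes, so
  it has the same signs.\<close>

lemma face_move_eq_fmul:
  assumes "F \<in> faces A" "C \<in> chambers A"
  shows "face_move A F C = fmul F C"
proof -
  obtain p c where pc: "F = cell p" "C = cell c" "zeros c = {}"
    using assms by (auto simp: faces_eq chambers_eq)
  let ?m = "pmult p c"
  have zm: "zeros ?m = {}" using pc(3) by (auto simp: zeros_alt sg_mult)
  define sep where "sep d = {H \<in> A. sg H c \<noteq> sg H d}" for d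
  have card_sep: "{H \<in> A. separates H C (cell d)} = sep d" if "zeros d = {}" for d
    using separates_cell_iff[OF _ pc(3) that] pc(2) by (auto simp: sep_def)
  have fin: "finite (sep d)" for d using finite_A by (simp add: sep_def)
  have sub: "sep ?m \<subseteq> sep d" if "zeros d = {}" "F \<subseteq> closure (cell d)" for d
    using that(2) unfolding pc(1) face_subset_closure_iff[OF that(1)]
    by (auto simp: sep_def sg_mult split: if_splits)
  have eqm: "fmul F (cell c) = cell ?m" by (simp add: pc(1) fmul_cell)
  have cl: "cell ?m \<in> chambers A \<and> F \<subseteq> closure (cell ?m)"
    using zm by (auto simp: chambers_eq pc(1) face_subset_closure_iff[OF zm] sg_mult)
  show ?thesis
    unfolding face_move_def pc(2)
  proof (rule the_equality)
    show "is_arg_min (\<lambda>D. card {H \<in> A. separates H (cell c) D})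
        (\<lambda>D. D \<in> chambers A \<and> F \<subseteq> closure D) (fmul F (cell c))"
      unfolding is_arg_min_linorder eqm
    proof (intro conjI allI impI)
      fix D assume "D \<in> chambers A \<and> F \<subseteq> closure D"
      then obtain d where d: "D = cell d" "zeros d = {}" "F \<subseteq> closure (cell d)"
        by (auto simp: chambers_eq)
      show "card {H \<in> A. separates H (cell c) (cell ?m)} \<le> card {H \<in> A. separates H (cell c) D}"
        using card_mono[OF fin sub[OF d(2,3)]] card_sep[OF zm] card_sep[OF d(2)] pc(2) d(1) by simp
    qed (use cl in auto)
  next
    fix D assume D: "is_arg_min (\<lambda>D. card {H \<in> A. separates H (cell c) D})
        (\<lambda>D. D \<in> chambers A \<and> F \<subseteq> closure D) D"
    then obtain d where d: "D = cell d" "zeros d = {}" "F \<subseteq> closure D"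
      by (auto simp: is_arg_min_def chambers_eq)
    have "card (sep d) \<le> card (sep ?m)"
      using D cl card_sep[OF zm] card_sep[OF d(2)] unfolding is_arg_min_linorder d(1) pc(2) by auto
    then have "sep ?m = sep d"
      using sub[OF d(2)] d(1,3) fin[of d] by (simp add: card_seteq)
    then have "\<forall>H\<in>A. sg H c \<noteq> sg H ?m \<longleftrightarrow> sg H c \<noteq> sg H d" by (auto simp: sep_def)
    moreover have "\<forall>H\<in>A. sg H p \<noteq> 0 \<longrightarrow> sg H d = sg H p"
      using d face_subset_closure_iff[OF d(2)] pc(1) by simp
    ultimately have "\<forall>H\<in>A. sg H d = sg H ?m"
      using chamber_sg_nonzero[OF d(2)] by (auto simp: sg_mult)
    then show "D = fmul F (cell c)" unfolding d(1) pc(1) fmul_cell cell_eq_iff by simp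
  qed
qed

section \<open>Counting chambers\<close>

text \<open>The Euler characteristic with compact support of a relatively open convex set. The empty
  set gets its own value because \<open>flat_dim {}\<close> is 0, which would give 1.\<close>

definition euler :: "'a set \<Rightarrow> int" where
  "euler G = (if G = {} then 0 else (- 1) ^ flat_dim G)"

lemma flat_dim_Int_open:
  assumes "affine X" "open U" "X \<inter> U \<noteq> {}"
  shows "flat_dim (X \<inter> U) = flat_dim X"
  using aff_dim_convex_Int_open[of X U] assms by (simp add: flat_dim_def affine_imp_convex)

text \<open>If the hyperplane properly crosses the set, both open sides keep the dimension while the
  section loses one, so two terms of one sign and one of the opposite sign remain. In all other
  cases a single part is the whole set.\<close>

lemma euler_split:
  assumes X: "affine X" and U: "open U" "convex U" and H: "H \<in> A"
  shows "(\<Sum>s\<in>{0, 1, - 1}. euler {u \<in> X \<inter> U. sg H u = s}) = euler (X \<inter> U)"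
proof -
  define G where "G = X \<inter> U"
  define P where "P s = {u \<in> G. sg H u = s}" for s
  have G: "convex G" using X U by (simp add: G_def convex_Int affine_imp_convex)
  have P_open: "P s = X \<inter> (U \<inter> {u. sg H u = s})" for s
    by (auto simp: P_def G_def)
  have dim_open: "euler (P s) = euler G" if "s \<noteq> 0" "P s \<noteq> {}" for s
  proof -
    have ne: "X \<inter> (U \<inter> {u. sg H u = s}) \<noteq> {}" "X \<inter> U \<noteq> {}" using that(2) unfolding P_open by auto
    have "flat_dim (P s) = flat_dim X"
      unfolding P_open using X U open_sg_eq[OF that(1)] ne by (intro flat_dim_Int_open) auto
    moreover have "flat_dim G = flat_dim X"
      unfolding G_def using X U ne by (intro flat_dim_Int_open)
    ultimately show ?thesis using that(2) ne(2) by (simp add: euler_def G_def)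
  qed
  have sum: "(\<Sum>s\<in>{0, 1, - 1}. euler (P s)) = euler (P 0) + euler (P 1) + euler (P (- 1))"
    by simp
  have H0: "{u. sg H u = 0} = {u. nrm H \<bullet> u = off H}"
    using sg_eq_0_iff[OF H] mem_hyperplane[OF H] by auto
  have "euler (P 0) + euler (P 1) + euler (P (- 1)) = euler G"
  proof (cases "P 0 = {}")
    case True
    have no: "P 1 = {} \<or> P (- 1) = {}"
    proof (rule ccontr)
      assume "\<not> ?thesis"
      then obtain u w where "u \<in> G" "sg H u = 1" "w \<in> G" "sg H w = - 1" by (auto simp: P_def)
      then have "\<exists>z\<in>G. nrm H \<bullet> z = off H"
        using connected_ivt_hyperplane[OF convex_connected[OF G], of w u "nrm H" "off H"]
        by (auto simp: sg_pos_iff sg_neg_iff)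
      then show False using True H0 by (auto simp: P_def)
    qed
    have e: "euler {} = 0" by (simp add: euler_def)
    have un: "G = P 0 \<union> P 1 \<union> P (- 1)" using sg_cases[of H] by (auto simp: P_def)
    show ?thesis
    proof (cases "P 1 = {}")
      case True
      then have "P (- 1) = G" using un \<open>P 0 = {}\<close> by simp
      then show ?thesis using True \<open>P 0 = {}\<close> e by simp
    next
      case False
      then have "P (- 1) = {}" "P 1 = G" using un \<open>P 0 = {}\<close> no by auto
      then show ?thesis using \<open>P 0 = {}\<close> e by simp
    qed
  next
    case ne: False
    then obtain p where p: "p \<in> G" "sg H p = 0" by (auto simp: P_def)
    show ?thesis
    proof (cases "X \<subseteq> H")
      case True
      then have "sg H u = 0" if "u \<in> G" for u
        using sg_eq_0_iff[OF H, of u] that by (auto simp: G_def)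
      then have "P 0 = G" "P 1 = {}" "P (- 1) = {}"
        by (force simp: P_def)+
      then show ?thesis by (simp add: euler_def)
    next
      case False
      then obtain q where q: "q \<in> X" "sg H q \<noteq> 0" using sg_eq_0_iff[OF H] by auto
      have pX: "p \<in> X" "p \<in> U" using p(1) by (auto simp: G_def)
      obtain r where r: "r > 0" "ball p r \<subseteq> U" using U(1) pX(2) by (meson open_contains_ball)
      have side: "\<exists>s. s \<noteq> 0 \<and> sg H (p + s *\<^sub>R (q - p)) = \<sigma> \<and> p + s *\<^sub>R (q - p) \<in> G"
        if "\<sigma> = 1 \<or> \<sigma> = - 1" for \<sigma>
      proof -
        obtain t where t: "0 < t" "t \<le> 1" "dist p (p + t *\<^sub>R (q - p)) < r"
          using segment_near[OF r(1), of p q] by auto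
        \<comment> \<open>The factor \<open>\<sigma> * sg H q\<close> is 1 or -1 and directs the
          move from \<open>p\<close> towards \<open>q\<close> or away from it, so as to reach the
          side \<open>\<sigma>\<close>; the affine set \<open>X\<close> contains both
          directions.\<close>
        define s where "s = \<sigma> * sg H q * t"
        have s: "s = t \<or> s = - t" using that q(2) sg_cases[of H q] by (auto simp: s_def)
        have in_X: "p + s *\<^sub>R (q - p) \<in> X"
          using mem_affine_3_minus[of X p q p s] X pX q by simp
        have "dist p (p + s *\<^sub>R (q - p)) = dist p (p + t *\<^sub>R (q - p))"
          using s by (auto simp: dist_norm)
        then have in_G: "p + s *\<^sub>R (q - p) \<in> G" using t(3) r(2) in_X by (auto simp: G_def)
        have "nrm H \<bullet> (p + s *\<^sub>R (q - p)) - off H = s * (nrm H \<bullet> q - off H)"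
          using p(2) by (simp add: sg_def sgn_zero_iff inner_add_right inner_diff_right algebra_simps)
        then have "sg H (p + s *\<^sub>R (q - p)) = sgn s * sg H q"
          by (simp add: sg_def sgn_mult)
        also have "\<dots> = \<sigma>"
          using that q(2) sg_cases[of H q] t(1) by (auto simp: s_def sgn_mult)
        finally show ?thesis using in_G s t(1) by (intro exI[of _ s]) auto
      qed
      have ne1: "P 1 \<noteq> {}" "P (- 1) \<noteq> {}" using side[of 1] side[of "- 1"] by (auto simp: P_def)
      have "P 0 = (X \<inter> {u. nrm H \<bullet> u = off H}) \<inter> U"
        using H0 by (auto simp: P_def G_def)
      moreover have "affine (X \<inter> {u. nrm H \<bullet> u = off H})"
        using X by (intro affine_Int affine_hyperplane)
      ultimately have "flat_dim (P 0) = flat_dim (X \<inter> {u. nrm H \<bullet> u = off H})"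
        using ne U by (simp add: flat_dim_Int_open)
      moreover have "aff_dim (X \<inter> {u. nrm H \<bullet> u = off H}) = aff_dim X - 1"
        using aff_dim_affine_Int_hyperplane[OF X, of "nrm H" "off H"] p q pX(1) H0 by auto
      moreover have "aff_dim (X \<inter> {u. nrm H \<bullet> u = off H}) \<ge> 0"
        using p pX H0 aff_dim_negative_iff[of "X \<inter> {u. nrm H \<bullet> u = off H}"] by (auto simp: not_less[symmetric])
      moreover have "flat_dim G = flat_dim X"
        unfolding G_def using X U p by (intro flat_dim_Int_open) (auto simp: G_def)
      ultimately have "flat_dim G = Suc (flat_dim (P 0))"
        by (simp add: flat_dim_def)
      then have "euler (P 0) = - euler G"
        using ne p by (auto simp: euler_def)
      then show ?thesis using dim_open ne1 by simp
    qed
  qed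
  then show ?thesis using sum by (simp add: P_def G_def)
qed

text \<open>One cut leaves sets of the same shape: the section has a smaller affine set in place of
  \<open>X\<close>, the sides have a smaller open convex set in place of \<open>U\<close>. The
  induction therefore keeps \<open>X\<close> and \<open>U\<close> arbitrary.\<close>

lemma euler_pieces:
  assumes "finite B" "B \<subseteq> A" "affine X" "open U" "convex U"
  shows "(\<Sum>c\<in>pieces B (X \<inter> U). euler c) = euler (X \<inter> U)"
  using assms
proof (induction B arbitrary: X U rule: finite_induct)
  case empty
  have "pieces {} (X \<inter> U) = (if X \<inter> U = {} then {} else {X \<inter> U})"
    by (auto simp: pieces_def)
  then show ?case by (auto simp: euler_def)
next
  case (insert H B)
  define P where "P s = {u \<in> X \<inter> U. sg H u = s}" for s
  have eq: "{u. sg H u = 0} = {u. nrm H \<bullet> u = off H}"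
    using insert.prems sg_eq_0_iff[of H] mem_hyperplane[of H] by auto
  have part: "(\<Sum>c\<in>pieces B (P s). euler c) = euler (P s)" if s: "s \<in> {0, 1, - 1}" for s
  proof (cases "s = 0")
    case True
    then have "P s = (X \<inter> {u. nrm H \<bullet> u = off H}) \<inter> U" using eq by (auto simp: P_def)
    then show ?thesis
      using insert.IH[of "X \<inter> {u. nrm H \<bullet> u = off H}" U] insert.prems
      by (simp add: affine_Int affine_hyperplane)
  next
    case False
    have "P s = X \<inter> (U \<inter> {u. sg H u = s})" by (auto simp: P_def)
    then show ?thesis
      using insert.IH[of X "U \<inter> {u. sg H u = s}"] insert.prems open_sg_eq[OF False] convex_sg_eq[of H s]
      by (simp add: open_Int convex_Int)
  qed
  have un: "pieces (insert H B) (X \<inter> U) = (\<Union>s\<in>{0, 1, - 1}. pieces B (P s))"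
  proof (intro equalityI subsetI)
    fix c assume "c \<in> pieces (insert H B) (X \<inter> U)"
    then obtain v where v: "v \<in> X \<inter> U" "c = {u \<in> X \<inter> U. \<forall>H\<in>insert H B. sg H u = sg H v}"
      by (auto simp: pieces_def)
    then have "c = {u \<in> P (sg H v). \<forall>H\<in>B. sg H u = sg H v}" "v \<in> P (sg H v)"
      by (auto simp: P_def)
    then have "c \<in> pieces B (P (sg H v))" unfolding pieces_def by blast
    then show "c \<in> (\<Union>s\<in>{0, 1, - 1}. pieces B (P s))" using sg_cases[of H v] by auto
  next
    fix c assume "c \<in> (\<Union>s\<in>{0, 1, - 1}. pieces B (P s))"
    then obtain s v where v: "v \<in> P s" "c = {u \<in> P s. \<forall>H\<in>B. sg H u = sg H v}"
      by (auto simp: pieces_def)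
    then have "c = {u \<in> X \<inter> U. \<forall>H\<in>insert H B. sg H u = sg H v}" "v \<in> X \<inter> U"
      by (auto simp: P_def)
    then show "c \<in> pieces (insert H B) (X \<inter> U)" unfolding pieces_def by blast
  qed
  have sub: "c \<noteq> {} \<and> c \<subseteq> P s" if "c \<in> pieces B (P s)" for c s
    using that by (auto simp: pieces_def)
  have disj: "pieces B (P s) \<inter> pieces B (P t) = {}" if "s \<noteq> t" for s t
  proof -
    have "P s \<inter> P t = {}" using that by (auto simp: P_def)
    then show ?thesis using sub by (metis Int_emptyI bot.extremum_uniqueI le_inf_iff)
  qed
  have "(\<Sum>c\<in>pieces (insert H B) (X \<inter> U). euler c) = (\<Sum>s\<in>{0, 1, - 1}. \<Sum>c\<in>pieces B (P s). euler c)"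
    unfolding un using disj by (intro sum.UNION_disjoint ballI finite_pieces insert.hyps) auto
  also have "\<dots> = (\<Sum>s\<in>{0, 1, - 1}. euler (P s))"
    by (intro sum.cong refl part)
  also have "\<dots> = euler (X \<inter> U)"
    unfolding P_def using insert.prems by (intro euler_split) auto
  finally show ?case .
qed

text \<open>The zero signs cut out the support, the nonzero ones an open set. Hence a cell has the
  dimension of its support.\<close>

lemma cell_eq_supp_Int_open:
  obtains W where "open W" "v \<in> W" "cell v = supp v \<inter> W"
proof
  let ?W = "\<Inter>H\<in>{H \<in> A. sg H v \<noteq> 0}. {u. sg H u = sg H v}"
  show "open ?W" using finite_A by (intro open_INT ballI open_sg_eq) auto
  show "v \<in> ?W" by simp
  have "supp v = {u. \<forall>H\<in>A. sg H v = 0 \<longrightarrow> sg H u = 0}"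
    by (auto simp: supp_def zeros_alt sg_eq_0_iff)
  then show "cell v = supp v \<inter> ?W" by (fastforce simp: cell_def)
qed

text \<open>The pieces of \<open>X \<inter> U\<close> are the intersections with \<open>U\<close> of
  the faces through its points. Each is relatively open in the support of its face, so the Euler
  relation becomes a sum over faces.\<close>

lemma euler_flat:
  assumes U: "open U" "convex U" and X: "X \<in> flats A" "X \<inter> U \<noteq> {}"
  shows "(\<Sum>F\<in>cell ` (X \<inter> U). (- 1) ^ flat_dim (face_support A F)) = (- 1 :: int) ^ flat_dim X"
proof -
  have *: "{u \<in> X \<inter> U. \<forall>H\<in>A. sg H u = sg H v} = cell v \<inter> U" if "v \<in> X \<inter> U" for v
    using that flat_mem_iff_cell[OF X(1), of v] by (auto simp: cell_def)
  have pieces: "pieces A (X \<inter> U) = (\<lambda>F. F \<inter> U) ` cell ` (X \<inter> U)"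
    unfolding pieces_def image_image using * by (intro image_cong) auto
  have inj: "inj_on (\<lambda>F. F \<inter> U) (cell ` (X \<inter> U))"
  proof (rule inj_onI)
    fix F G assume "F \<in> cell ` (X \<inter> U)" "G \<in> cell ` (X \<inter> U)" "F \<inter> U = G \<inter> U"
    then obtain u v where uv: "F = cell u" "u \<in> U" "G = cell v" by auto
    have "u \<in> G" using \<open>F \<inter> U = G \<inter> U\<close> mem_cell[of u] uv by auto
    then show "F = G" using mem_cell_iff uv by auto
  qed
  have eu: "euler (cell v \<inter> U) = (- 1) ^ flat_dim (face_support A (cell v))" if "v \<in> U" for v
  proof -
    obtain W where W: "open W" "v \<in> W" "cell v = supp v \<inter> W" using cell_eq_supp_Int_open by metis
    have "flat_dim (supp v \<inter> (W \<inter> U)) = flat_dim (supp v)"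
      using W U that mem_supp[of v] by (intro flat_dim_Int_open affine_flat supp_flat) auto
    moreover have "cell v \<inter> U \<noteq> {}" using that mem_cell by blast
    moreover have "cell v \<inter> U = supp v \<inter> (W \<inter> U)" using W(3) by auto
    ultimately show ?thesis by (simp add: euler_def face_support_cell)
  qed
  have "(\<Sum>F\<in>cell ` (X \<inter> U). (- 1) ^ flat_dim (face_support A F)) =
      (\<Sum>F\<in>cell ` (X \<inter> U). euler (F \<inter> U))"
    using eu by (intro sum.cong) auto
  also have "\<dots> = (\<Sum>c\<in>pieces A (X \<inter> U). euler c)"
    unfolding pieces by (simp add: sum.reindex[OF inj])
  also have "\<dots> = euler (X \<inter> U)"
    using euler_pieces[OF finite_A subset_refl affine_flat[OF X(1)] U] .
  also have "\<dots> = (- 1) ^ flat_dim X"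
    using flat_dim_Int_open[OF affine_flat[OF X(1)] U(1) X(2)] X(2) by (simp add: euler_def)
  finally show ?thesis .
qed

text \<open>The form in which Moebius values come out of the Euler relation. It is an integer of
  unknown sign until \<open>signed_moebius_eq_abs\<close>.\<close>

definition signed_moebius :: "'a set \<Rightarrow> int" where
  "signed_moebius X = (- 1) ^ (DIM('a) - flat_dim X) * moebius (flats A) UNIV X"

text \<open>Moebius inversion of the Euler relations of the sets \<open>X \<inter> U\<close>.  With \<open>U\<close> the whole space this
  counts all chambers; with \<open>U\<close> a small ball around a point of a face it counts the chambers fixed
  by that face.\<close>

lemma card_chambers_meeting:
  assumes U: "open U" "convex U" "U \<noteq> {}"
  shows "int (card {C \<in> chambers A. C \<inter> U \<noteq> {}}) = (\<Sum>X\<in>{X \<in> flats A. X \<inter> U \<noteq> {}}. signed_moebius X)"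
proof -
  define L where "L = {X \<in> flats A. X \<inter> U \<noteq> {}}"
  define \<mu> where "\<mu> X = moebius (flats A) UNIV X" for X
  have finL: "finite L" using finite_flats by (simp add: L_def)
  have fin: "finite (cell ` U)" using finite_faces unfolding faces_eq by (rule finite_subset[rotated]) auto
  \<comment> \<open>The faces meeting \<open>U\<close>, sorted by support. The Euler relation
    evaluates the sum of \<open>g\<close> over the flats inside \<open>X\<close>, and
    \<open>g UNIV\<close> is the wanted count up to sign.\<close>
  define g where "g Y = (\<Sum>F\<in>{F \<in> cell ` U. face_support A F = Y}. (- 1 :: int) ^ flat_dim (face_support A F))"
    for Y
  have g: "(\<Sum>Y\<in>{Y \<in> L. Y \<subseteq> X}. g Y) = (- 1) ^ flat_dim X" if X: "X \<in> L" for X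
  proof -
    have X': "X \<in> flats A" "X \<inter> U \<noteq> {}" using X by (auto simp: L_def)
    let ?S = "cell ` (X \<inter> U)"
    have "{F \<in> ?S. face_support A F = Y} = {F \<in> cell ` U. face_support A F = Y}" if "Y \<subseteq> X" for Y
      using that mem_supp by (auto simp: face_support_cell intro!: imageI)
    then have "(\<Sum>Y\<in>{Y \<in> L. Y \<subseteq> X}. g Y) =
        (\<Sum>Y\<in>{Y \<in> L. Y \<subseteq> X}. \<Sum>F\<in>{F \<in> ?S. face_support A F = Y}. (- 1) ^ flat_dim (face_support A F))"
      unfolding g_def by (intro sum.cong) auto
    also have "\<dots> = (\<Sum>F\<in>?S. (- 1) ^ flat_dim (face_support A F))"
    proof (rule sum.group)
      show "finite ?S" using fin by (rule finite_subset[rotated]) auto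
      show "finite {Y \<in> L. Y \<subseteq> X}" using finL by simp
      show "face_support A ` ?S \<subseteq> {Y \<in> L. Y \<subseteq> X}"
      proof safe
        fix v assume v: "v \<in> X" "v \<in> U"
        then show "face_support A (cell v) \<in> L"
          using supp_flat mem_supp unfolding L_def face_support_cell by blast
        show "\<And>x. x \<in> face_support A (cell v) \<Longrightarrow> x \<in> X"
          using v flat_mem_iff_supp[OF X'(1)] unfolding face_support_cell by blast
      qed
    qed
    also have "\<dots> = (- 1) ^ flat_dim X" using euler_flat[OF U(1,2) X'] .
    finally show ?thesis .
  qed
  have inner: "(\<Sum>X\<in>{X \<in> L. Y \<subseteq> X}. \<mu> X) = (if UNIV = Y then 1 else 0)" if "Y \<in> L" for Y
  proof -
    \<comment> \<open>A flat containing one that meets \<open>U\<close> meets \<open>U\<close> too,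
      so above \<open>Y\<close> the family \<open>L\<close> and the whole lattice coincide and the
      Moebius function of the whole lattice can be used.\<close>
    have "{X \<in> L. Y \<subseteq> X} = {Z \<in> flats A. Z \<subseteq> UNIV \<and> Y \<subseteq> Z}"
      using that by (auto simp: L_def)
    then show ?thesis
      using moebius_sum_left[OF finite_flats UNIV_flat, of Y] that by (simp add: \<mu>_def L_def)
  qed
  have UL: "UNIV \<in> L" using U UNIV_flat by (simp add: L_def)
  have "(\<Sum>X\<in>L. \<mu> X * (- 1) ^ flat_dim X) = (\<Sum>X\<in>L. \<Sum>Y\<in>{Y \<in> L. Y \<subseteq> X}. \<mu> X * g Y)"
    by (intro sum.cong) (simp_all add: sum_distrib_left[symmetric] g)
  also have "\<dots> = (\<Sum>Y\<in>L. \<Sum>X\<in>{X \<in> L. Y \<subseteq> X}. \<mu> X * g Y)"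
    using finL by (rule sum.swap_restrict[OF _ finL])
  also have "\<dots> = (\<Sum>Y\<in>L. if UNIV = Y then g Y else 0)"
    by (intro sum.cong) (simp_all add: sum_distrib_right[symmetric] inner)
  also have "\<dots> = g UNIV"
    using finL UL by simp
  also have "\<dots> = (- 1) ^ DIM('a) * int (card {F \<in> cell ` U. face_support A F = UNIV})"
    by (simp add: g_def flat_dim_def)
  also have "{F \<in> cell ` U. face_support A F = UNIV} = {C \<in> chambers A. C \<inter> U \<noteq> {}}"
  proof -
    have full: "supp v = UNIV \<longleftrightarrow> zeros v = {}" for v
    proof
      assume *: "supp v = UNIV"
      show "zeros v = {}"
      proof (rule ccontr)
        assume "zeros v \<noteq> {}"
        then obtain H where H: "H \<in> A" "H = UNIV" using * by (auto simp: supp_def zeros_def)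
        have "nrm H \<bullet> ((1 + off H) / (nrm H \<bullet> nrm H)) *\<^sub>R nrm H \<noteq> off H"
          using nrm_nonzero[OF H(1)] by simp
        then show False using mem_hyperplane[OF H(1)] H(2) by blast
      qed
    qed (simp add: supp_def)
    show ?thesis
    proof (intro equalityI subsetI)
      fix F assume "F \<in> {F \<in> cell ` U. face_support A F = UNIV}"
      then obtain v where "v \<in> U" "F = cell v" "zeros v = {}" by (auto simp: face_support_cell full)
      then show "F \<in> {C \<in> chambers A. C \<inter> U \<noteq> {}}" using mem_cell[of v] by (auto simp: chambers_eq)
    next
      fix F assume "F \<in> {C \<in> chambers A. C \<inter> U \<noteq> {}}"
      then obtain v u where v: "F = cell v" "zeros v = {}" "u \<in> cell v" "u \<in> U" by (auto simp: chambers_eq)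
      then have "F = cell u" using mem_cell_iff by simp
      then show "F \<in> {F \<in> cell ` U. face_support A F = UNIV}"
        using v full[of v] face_support_cell[of v] by auto
    qed
  qed
  finally have e: "(\<Sum>X\<in>L. \<mu> X * (- 1) ^ flat_dim X) =
      (- 1) ^ DIM('a) * int (card {C \<in> chambers A. C \<inter> U \<noteq> {}})" .
  have "signed_moebius X = (- 1) ^ DIM('a) * (\<mu> X * (- 1) ^ flat_dim X)" if "X \<in> L" for X
    using that flat_dim_le[of X]
    by (simp add: L_def signed_moebius_def \<mu>_def minus_one_power_iff even_diff_nat)
  then have "(\<Sum>X\<in>L. signed_moebius X) = (- 1) ^ DIM('a) * (\<Sum>X\<in>L. \<mu> X * (- 1) ^ flat_dim X)"
    by (simp add: sum_distrib_left)
  also have "\<dots> = int (card {C \<in> chambers A. C \<inter> U \<noteq> {}})"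
    unfolding e by (simp flip: mult.assoc power_add)
  finally show ?thesis by (simp add: L_def)
qed

lemma card_chambers: "int (card (chambers A)) = (\<Sum>X\<in>flats A. signed_moebius X)"
proof -
  have "{C \<in> chambers A. C \<inter> UNIV \<noteq> {}} = chambers A"
    using mem_cell by (auto simp: chambers_eq)
  moreover have "{X \<in> flats A. X \<inter> UNIV \<noteq> {}} = flats A"
    by (auto simp: flats_def)
  ultimately show ?thesis using card_chambers_meeting[of UNIV] by simp
qed

text \<open>A chamber is fixed by \<open>F\<close> iff it has the nonzero signs of \<open>p\<close>.
  All points of an isolating ball have them, and conversely \<open>ex_mult_near\<close> puts a point
  of a fixed chamber into the ball. A flat meets the ball only if it passes through
  \<open>p\<close>.\<close>

lemma card_chambers_fixed:
  assumes "F \<in> faces A"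
  shows "int (card {C \<in> chambers A. fmul F C = C}) = (\<Sum>X\<in>{X \<in> flats A. F \<subseteq> X}. signed_moebius X)"
proof -
  obtain p where p: "F = cell p" using assms by (auto simp: faces_eq)
  obtain r where r: "r > 0" "\<And>q H. q \<in> ball p r \<Longrightarrow> H \<in> A \<Longrightarrow> sg H p \<noteq> 0 \<Longrightarrow> sg H q = sg H p"
    using ex_isolating_radius[of p] by blast
  have 1: "fmul F C = C \<longleftrightarrow> C \<inter> ball p r \<noteq> {}" if C: "C \<in> chambers A" for C
  proof -
    obtain c where c: "C = cell c" using C by (auto simp: chambers_eq)
    show ?thesis
    proof
      assume "fmul F C = C"
      then have *: "\<forall>H\<in>A. sg H (pmult p c) = sg H c" by (simp add: p c fmul_cell cell_eq_iff)
      obtain q where "dist p q < r" "\<forall>H\<in>A. sg H q = (if sg H p = 0 then sg H c else sg H p)"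
        using ex_mult_near[OF r(1), of p c] by blast
      then have "q \<in> ball p r" "q \<in> cell c" using * by (auto simp: cell_def sg_mult split: if_splits)
      then show "C \<inter> ball p r \<noteq> {}" using c by blast
    next
      assume "C \<inter> ball p r \<noteq> {}"
      then obtain q where "q \<in> cell c" "q \<in> ball p r" using c by blast
      then have "\<forall>H\<in>A. sg H (pmult p c) = sg H c" using r(2)[of q] by (auto simp: cell_def sg_mult)
      then show "fmul F C = C" by (simp add: p c fmul_cell cell_eq_iff)
    qed
  qed
  have 2: "X \<inter> ball p r \<noteq> {} \<longleftrightarrow> F \<subseteq> X" if X: "X \<in> flats A" for X
  proof -
    obtain B where B: "B \<subseteq> A" "X = \<Inter>B" using X by (auto simp: flats_def)
    have "p \<in> X" if q: "q \<in> X" "q \<in> ball p r" for q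
    proof -
      have "sg H p = 0" if "H \<in> B" for H
        using r(2)[OF q(2), of H] that B q(1) sg_eq_0_iff[of H q] by auto
      then show ?thesis using B sg_eq_0_iff by auto
    qed
    moreover have "p \<in> ball p r" using r(1) by simp
    ultimately show ?thesis using flat_mem_iff_cell[OF X, of p] p by blast
  qed
  have "{C \<in> chambers A. fmul F C = C} = {C \<in> chambers A. C \<inter> ball p r \<noteq> {}}" using 1 by blast
  moreover have "{X \<in> flats A. F \<subseteq> X} = {X \<in> flats A. X \<inter> ball p r \<noteq> {}}" using 2 by blast
  ultimately show ?thesis
    using card_chambers_meeting[of "ball p r"] r(1) by (simp add: convex_ball)
qed

end

section \<open>Spectrum of the face walk\<close>

text \<open>Weights are arbitrary because several kinds are inserted: the shuffle weights, weights
  that separate the flats, and functions of the type of a face in a Coxeter arrangement.\<close>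

definition face_kernel :: "'a::euclidean_space set set \<Rightarrow> ('a set \<Rightarrow> real) \<Rightarrow> 'a set \<Rightarrow> 'a set \<Rightarrow> real" where
  "face_kernel A v C D = (\<Sum>F\<in>{F \<in> faces A. face_move A F C = D}. v F)"

context arrangement
begin

text \<open>The eigenvalue attached to the flat \<open>Y\<close>.\<close>

definition weight_below :: "('a set \<Rightarrow> real) \<Rightarrow> 'a set \<Rightarrow> real" where
  "weight_below v Y = (\<Sum>F\<in>{F \<in> faces A. F \<subseteq> Y}. v F)"

lemma face_kernel_fmul:
  assumes "C \<in> chambers A"
  shows "face_kernel A v C D = (\<Sum>F\<in>faces A. if fmul F C = D then v F else 0)"
proof -
  have "{F \<in> faces A. face_move A F C = D} = {F \<in> faces A. fmul F C = D}"
    using face_move_eq_fmul assms by auto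
  then show ?thesis
    by (simp add: face_kernel_def sum.inter_filter[OF finite_faces])
qed

text \<open>Associativity turns two moves into one move by a product, so the weights are convolved,
  and containment of products in a flat makes the total weights multiply. Only positive powers are
  treated: an affine arrangement may have no face in all hyperplanes that would act as the
  identity.\<close>

lemma kernel_power_face_kernel:
  "\<exists>w. (\<forall>C\<in>chambers A. \<forall>D. kernel_power (chambers A) (face_kernel A v) (Suc k) C D =
          (\<Sum>F\<in>faces A. if fmul F C = D then w F else 0)) \<and>
       (\<forall>Y\<in>flats A. weight_below w Y = weight_below v Y ^ Suc k)"
proof (induction k)
  case 0
  have "kernel_power (chambers A) (face_kernel A v) (Suc 0) C D = face_kernel A v C D"
    if "C \<in> chambers A" for C D
    using that finite_chambers sum.delta[OF finite_chambers, of C "\<lambda>k. face_kernel A v k D"]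
    by (simp add: if_distrib[of "\<lambda>a. a * _"] eq_commute[of C] cong: if_cong)
  then show ?case
    by (intro exI[of _ v]) (simp add: face_kernel_fmul del: kernel_power.simps)
next
  case (Suc k)
  then obtain w where w: "\<And>C D. C \<in> chambers A \<Longrightarrow>
        kernel_power (chambers A) (face_kernel A v) (Suc k) C D =
        (\<Sum>F\<in>faces A. if fmul F C = D then w F else 0)"
    and wY: "\<And>Y. Y \<in> flats A \<Longrightarrow> weight_below w Y = weight_below v Y ^ Suc k"
    by blast
  \<comment> \<open>The move by \<open>F\<close> comes earlier than that by \<open>G\<close>, hence
    the order \<open>fmul G F\<close>.\<close>
  define w' where "w' K = (\<Sum>(F, G)\<in>{(F, G) \<in> faces A \<times> faces A. fmul G F = K}. w F * v G)" for K
  have w'_sum: "(\<Sum>K\<in>{K \<in> faces A. Q K}. w' K) =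
      (\<Sum>F\<in>faces A. \<Sum>G\<in>faces A. if Q (fmul G F) then w F * v G else 0)" for Q
  proof -
    let ?S = "{FG \<in> faces A \<times> faces A. Q (fmul (snd FG) (fst FG))}"
    have "(\<Sum>K\<in>{K \<in> faces A. Q K}. w' K) =
        (\<Sum>K\<in>{K \<in> faces A. Q K}. \<Sum>FG\<in>{FG \<in> ?S. fmul (snd FG) (fst FG) = K}. w (fst FG) * v (snd FG))"
      unfolding w'_def by (intro sum.cong) (auto intro!: sum.cong)
    also have "\<dots> = (\<Sum>FG\<in>?S. w (fst FG) * v (snd FG))"
      using finite_faces by (intro sum.group) (auto intro: fmul_face)
    also have "\<dots> = (\<Sum>FG\<in>faces A \<times> faces A.
        if Q (fmul (snd FG) (fst FG)) then w (fst FG) * v (snd FG) else 0)"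
      using finite_faces by (simp add: sum.inter_filter)
    also have "\<dots> = (\<Sum>F\<in>faces A. \<Sum>G\<in>faces A. if Q (fmul G F) then w F * v G else 0)"
      by (simp add: sum.cartesian_product case_prod_beta)
    finally show ?thesis .
  qed
  have "kernel_power (chambers A) (face_kernel A v) (Suc (Suc k)) C D =
      (\<Sum>F\<in>faces A. if fmul F C = D then w' F else 0)" if C: "C \<in> chambers A" for C D
  proof -
    have "kernel_power (chambers A) (face_kernel A v) (Suc (Suc k)) C D =
        (\<Sum>E\<in>chambers A. (\<Sum>F\<in>faces A. if fmul F C = E then w F else 0) * face_kernel A v E D)"
      by (subst kernel_power.simps(2)) (simp only: w[OF C])
    also have "\<dots> = (\<Sum>E\<in>chambers A. \<Sum>F\<in>faces A. if fmul F C = E then w F * face_kernel A v E D else 0)"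
      by (intro sum.cong refl) (auto simp: sum_distrib_right intro!: sum.cong)
    also have "\<dots> = (\<Sum>F\<in>faces A. w F * face_kernel A v (fmul F C) D)"
      using fmul_chamber[OF _ C] finite_chambers by (subst sum.swap) simp
    also have "\<dots> = (\<Sum>F\<in>faces A. \<Sum>G\<in>faces A. if fmul (fmul G F) C = D then w F * v G else 0)"
      using fmul_chamber[OF _ C] C chambers_subset_faces
      by (intro sum.cong refl)
        (auto simp: face_kernel_fmul sum_distrib_left fmul_assoc subset_iff intro!: sum.cong)
    also have "\<dots> = (\<Sum>F\<in>faces A. if fmul F C = D then w' F else 0)"
      using w'_sum[of "\<lambda>K. fmul K C = D"] finite_faces by (simp add: sum.inter_filter)
    finally show ?thesis .
  qed
  moreover have "weight_below w' Y = weight_below v Y ^ Suc (Suc k)" if Y: "Y \<in> flats A" for Y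
  proof -
    have "weight_below w' Y = (\<Sum>F\<in>faces A. \<Sum>G\<in>faces A. if fmul G F \<subseteq> Y then w F * v G else 0)"
      unfolding weight_below_def by (rule w'_sum)
    also have "\<dots> = (\<Sum>F\<in>faces A. \<Sum>G\<in>faces A.
        (if F \<subseteq> Y then w F else 0) * (if G \<subseteq> Y then v G else 0))"
      using fmul_subset_flat_iff[OF _ _ Y] by (intro sum.cong) auto
    also have "\<dots> = weight_below w Y * weight_below v Y"
      by (simp add: sum_product[symmetric] weight_below_def sum.inter_filter[OF finite_faces])
    finally show ?thesis
      using wY[OF Y] by (simp add: mult.commute)
  qed
  ultimately show ?case by blast
qed

text \<open>A face contributes its weight times the number of chambers it fixes; writing that number
  as a sum over flats and exchanging the sums collects the total weights. The power 0 is the count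
  of all chambers.\<close>

lemma kernel_trace_face_kernel:
  "kernel_trace (chambers A) (kernel_power (chambers A) (face_kernel A v) k) =
    (\<Sum>Y\<in>flats A. of_int (signed_moebius Y) * weight_below v Y ^ k)"
proof (cases k)
  case 0
  have "kernel_trace (chambers A) (kernel_power (chambers A) (face_kernel A v) 0) =
      of_int (int (card (chambers A)))"
    by (simp add: kernel_trace_def)
  then show ?thesis
    unfolding card_chambers using 0 by simp
next
  case (Suc k')
  obtain w where w: "\<forall>C\<in>chambers A. \<forall>D. kernel_power (chambers A) (face_kernel A v) k C D =
          (\<Sum>F\<in>faces A. if fmul F C = D then w F else 0)"
    and wY: "\<forall>Y\<in>flats A. weight_below w Y = weight_below v Y ^ k"
    using kernel_power_face_kernel[of v k'] Suc by auto
  have "kernel_trace (chambers A) (kernel_power (chambers A) (face_kernel A v) k) =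
      (\<Sum>C\<in>chambers A. \<Sum>F\<in>faces A. if fmul F C = C then w F else 0)"
    unfolding kernel_trace_def using w by (intro sum.cong) auto
  also have "\<dots> = (\<Sum>F\<in>faces A. w F * of_int (int (card {C \<in> chambers A. fmul F C = C})))"
    using finite_chambers by (subst sum.swap) (simp add: sum.inter_filter[symmetric] mult.commute)
  also have "\<dots> = (\<Sum>F\<in>faces A. \<Sum>Y\<in>{Y \<in> flats A. F \<subseteq> Y}. w F * of_int (signed_moebius Y))"
    by (intro sum.cong refl) (simp only: card_chambers_fixed of_int_sum sum_distrib_left)
  also have "\<dots> = (\<Sum>Y\<in>flats A. \<Sum>F\<in>{F \<in> faces A. F \<subseteq> Y}. w F * of_int (signed_moebius Y))"
    by (rule sum.swap_restrict[OF finite_faces finite_flats])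
  also have "\<dots> = (\<Sum>Y\<in>flats A. of_int (signed_moebius Y) * weight_below v Y ^ k)"
    using wY by (intro sum.cong refl)
      (simp add: sum_distrib_right[symmetric] weight_below_def[symmetric] mult.commute)
  finally show ?thesis .
qed

text \<open>The weights for which the eigenvalue attached to a flat is prescribed by \<open>f\<close>, spread evenly
  over the faces with a given support.\<close>

definition spread_weight :: "('a set \<Rightarrow> real) \<Rightarrow> 'a set \<Rightarrow> real" where
  "spread_weight f F =
     (\<Sum>Z\<in>{Z \<in> flats A. Z \<subseteq> face_support A F}. of_int (moebius (flats A) (face_support A F) Z) * f Z) /
     of_nat (card {G \<in> faces A. face_support A G = face_support A F})"

text \<open>Grouping faces by support cancels the denominators, which are nonzero as every flat has
  a generic point, and leaves a sum to which Moebius inversion applies.\<close>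

lemma weight_below_spread_weight:
  assumes Y: "Y \<in> flats A"
  shows "weight_below (spread_weight f) Y = f Y"
proof -
  define h where "h Z = (\<Sum>Z'\<in>{Z' \<in> flats A. Z' \<subseteq> Z}. of_int (moebius (flats A) Z Z') * f Z')" for Z
  have fs: "face_support A F \<in> flats A \<and> (face_support A F \<subseteq> Y \<longleftrightarrow> F \<subseteq> Y)" if "F \<in> faces A" for F
  proof -
    obtain v where "F = cell v" using \<open>F \<in> faces A\<close> unfolding faces_eq by blast
    then show ?thesis
      using flat_mem_iff_cell[OF Y, of v] flat_mem_iff_supp[OF Y, of v] supp_flat[of v]
      by (simp add: face_support_cell)
  qed
  have "(\<Sum>F\<in>{F \<in> faces A. F \<subseteq> Y}. spread_weight f F) = (\<Sum>Z\<in>{Z \<in> flats A. Z \<subseteq> Y}.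
      \<Sum>F\<in>{F \<in> {F \<in> faces A. F \<subseteq> Y}. face_support A F = Z}. spread_weight f F)"
    using finite_faces finite_flats fs by (intro sum.group[symmetric]) auto
  also have "\<dots> = (\<Sum>Z\<in>{Z \<in> flats A. Z \<subseteq> Y}. h Z)"
  proof (intro sum.cong refl)
    fix Z assume Z: "Z \<in> {Z \<in> flats A. Z \<subseteq> Y}"
    let ?S = "{G \<in> faces A. face_support A G = Z}"
    have eq: "{F \<in> {F \<in> faces A. F \<subseteq> Y}. face_support A F = Z} = ?S"
      using Z fs by auto
    obtain p where "supp p = Z" using ex_generic_point Z by blast
    then have "cell p \<in> ?S" by (simp add: faces_eq face_support_cell)
    then have "card ?S \<noteq> 0" using finite_faces by auto
    moreover have "spread_weight f F = h Z / of_nat (card ?S)" if "F \<in> ?S" for F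
      using that by (simp add: spread_weight_def h_def)
    ultimately show "(\<Sum>F\<in>{F \<in> {F \<in> faces A. F \<subseteq> Y}. face_support A F = Z}. spread_weight f F) = h Z"
      unfolding eq by simp
  qed
  also have "\<dots> = f Y"
    unfolding h_def by (rule moebius_inversion[OF finite_flats Y])
  finally show ?thesis
    by (simp add: weight_below_def)
qed

text \<open>Being the multiplicity of an eigenvalue for weights that separate the flats, the signed Moebius
  value cannot be negative.\<close>

lemma signed_moebius_eq_abs:
  assumes "Y \<in> flats A"
  shows "signed_moebius Y = \<bar>moebius (flats A) UNIV Y\<bar>"
proof -
  \<comment> \<open>Any injective numbering of the flats can be prescribed as eigenvalues.\<close>
  obtain g :: "'a set \<Rightarrow> nat" where g: "inj_on g (flats A)"
    using finite_imp_inj_to_nat_seg[OF finite_flats] by blast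
  define v where "v = spread_weight (\<lambda>Y. real (g Y))"
  have "weight_below v Z = real (g Z)" if "Z \<in> flats A" for Z
    unfolding v_def by (rule weight_below_spread_weight[OF that])
  then have "inj_on (weight_below v) (flats A)"
    using g unfolding inj_on_def by simp
  from kernel_trace_multiplicity_nonneg[OF finite_chambers finite_flats this assms kernel_trace_face_kernel]
  have "signed_moebius Y \<ge> 0" .
  moreover have "\<bar>signed_moebius Y\<bar> = \<bar>moebius (flats A) UNIV Y\<bar>"
    by (simp add: signed_moebius_def abs_mult power_abs)
  ultimately show ?thesis by simp
qed

text \<open>An arbitrary index set in bijection with the chambers lets the result serve both the
  walk itself and left multiplication on a group algebra.\<close>

theorem kernel_char_poly_face_kernel:
  assumes f: "bij_betw f S (chambers A)"
    and P: "\<And>i j. i \<in> S \<Longrightarrow> j \<in> S \<Longrightarrow> P i j = face_kernel A v (f i) (f j)"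
  shows "kernel_char_poly S P =
    (\<Prod>Y\<in>flats A. [:- weight_below v Y, 1:] ^ nat \<bar>moebius (flats A) UNIV Y\<bar>)"
proof -
  have "finite S" using f finite_chambers bij_betw_finite by blast
  moreover have "kernel_trace S (kernel_power S P k) =
      (\<Sum>Y\<in>flats A. of_int \<bar>moebius (flats A) UNIV Y\<bar> * weight_below v Y ^ k)" for k
    using kernel_trace_reindex[of f S _ P "face_kernel A v", OF f P, of k] kernel_trace_face_kernel[of v k]
    by (simp add: signed_moebius_eq_abs cong: sum.cong)
  ultimately show ?thesis
    using finite_flats by (intro kernel_char_poly_eqI) auto
qed

lemma face_weight_eq_spread_weight:
  "face_weight A x F = spread_weight (\<lambda>Y. x ^ flat_dim Y / x ^ DIM('a)) F"
proof -
  have "flat_poly A (face_support A F) x / x ^ DIM('a) =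
      (\<Sum>Z\<in>{Z \<in> flats A. Z \<subseteq> face_support A F}.
        of_int (moebius (flats A) (face_support A F) Z) * (x ^ flat_dim Z / x ^ DIM('a)))"
    by (simp add: flat_poly_def sum_divide_distrib)
  then show ?thesis
    by (simp add: face_weight_def spread_weight_def flip: divide_divide_eq_left)
qed

lemma weight_below_face_weight:
  assumes "Y \<in> flats A" "x \<noteq> 0"
  shows "weight_below (face_weight A x) Y = 1 / x ^ (DIM('a) - flat_dim Y)"
proof -
  have "face_weight A x = spread_weight (\<lambda>Y. x ^ flat_dim Y / x ^ DIM('a))"
    using face_weight_eq_spread_weight by blast
  then show ?thesis
    using weight_below_spread_weight[OF assms(1)] flat_dim_le[OF assms(1)] assms(2)
    by (simp add: power_diff)
qed

text \<open>The eigenvalue of a flat depends on its codimension only, so the product over flats is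
  grouped by codimension; flats that are points supply the last factor.\<close>

lemma kernel_char_poly_shuffle_kernel:
  assumes "x \<noteq> 0"
  shows "kernel_char_poly (chambers A) (shuffle_kernel A x) =
    (\<Prod>i<DIM('a). [:- (1 / x ^ i), 1:] ^ shuffle_multiplicity A i) *
      [:- (1 / x ^ DIM('a)), 1:] ^ shuffle_multiplicity A (DIM('a))"
proof -
  define m where "m Y = \<bar>moebius (flats A) UNIV Y\<bar>" for Y
  let ?codim = "\<lambda>Y. DIM('a) - flat_dim Y"
  have "kernel_char_poly (chambers A) (shuffle_kernel A x) =
      (\<Prod>Y\<in>flats A. [:- weight_below (face_weight A x) Y, 1:] ^ nat (m Y))"
    unfolding m_def
    by (rule kernel_char_poly_face_kernel[OF bij_betw_id]) (simp add: shuffle_kernel_def face_kernel_def)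
  also have "\<dots> = (\<Prod>Y\<in>flats A. [:- (1 / x ^ ?codim Y), 1:] ^ nat (m Y))"
    by (intro prod.cong refl) (simp add: weight_below_face_weight assms)
  also have "\<dots> = (\<Prod>i\<in>{..DIM('a)}. \<Prod>Y\<in>{Y \<in> flats A. ?codim Y = i}. [:- (1 / x ^ ?codim Y), 1:] ^ nat (m Y))"
    using finite_flats by (intro prod.group[symmetric]) auto
  also have "\<dots> = (\<Prod>i\<in>{..DIM('a)}. [:- (1 / x ^ i), 1:] ^ shuffle_multiplicity A i)"
  proof (intro prod.cong refl)
    fix i assume i: "i \<in> {..DIM('a)}"
    \<comment> \<open>The subtraction is in the integers on the left and truncated on the right; the
      two agree since neither \<open>i\<close> nor a dimension exceeds
      \<open>DIM('a)\<close>.\<close>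
    have "int (flat_dim Y) = int DIM('a) - int i \<longleftrightarrow> ?codim Y = i" if "Y \<in> flats A" for Y
      using flat_dim_le[OF that] i by auto
    then have "{Y \<in> flats A. int (flat_dim Y) = int DIM('a) - int i} = {Y \<in> flats A. ?codim Y = i}"
      by auto
    then have "shuffle_multiplicity A i = nat (int (\<Sum>Y\<in>{Y \<in> flats A. ?codim Y = i}. nat (m Y)))"
      by (simp add: shuffle_multiplicity_def m_def)
    then have "shuffle_multiplicity A i = (\<Sum>Y\<in>{Y \<in> flats A. ?codim Y = i}. nat (m Y))"
      by (simp only: nat_int)
    then show "(\<Prod>Y\<in>{Y \<in> flats A. ?codim Y = i}. [:- (1 / x ^ ?codim Y), 1:] ^ nat (m Y)) =
        [:- (1 / x ^ i), 1:] ^ shuffle_multiplicity A i"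
      by (simp add: power_sum)
  qed
  also have "{..DIM('a)} = insert DIM('a) {..<DIM('a)}"
    by auto
  finally show ?thesis
    by (simp add: mult.commute)
qed

end

lemma hyperplane_arrangement_imp_arrangement:
  assumes "hyperplane_arrangement A"
  obtains nrm off where "arrangement A nrm off"
proof -
  have "\<forall>H\<in>A. \<exists>a b. a \<noteq> 0 \<and> H = {v. a \<bullet> v = b}" and "finite A"
    using assms by (auto simp: hyperplane_arrangement_def)
  then obtain nrm off where "\<forall>H\<in>A. nrm H \<noteq> 0 \<and> H = {v. nrm H \<bullet> v = off H}"
    by metis
  then have "arrangement A nrm off"
    using \<open>finite A\<close> by unfold_locales blast+
  then show thesis by (rule that)
qed

section \<open>Reflection groups\<close>

lemma reflection_inner: "reflection \<alpha> u \<bullet> reflection \<alpha> v = u \<bullet> v"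
proof (cases "\<alpha> = 0")
  case False
  then show ?thesis
    by (simp add: reflection_def inner_diff_left inner_diff_right inner_commute field_simps)
qed (simp add: reflection_def)

lemma linear_reflection: "linear (reflection \<alpha>)"
  by (rule linearI) (simp_all add: reflection_def inner_add_left scaleR_add_left scaleR_diff_right
      distrib_left add_divide_distrib)

lemma orthogonal_transformation_reflection: "orthogonal_transformation (reflection \<alpha>)"
  by (simp add: orthogonal_transformation_def linear_reflection reflection_inner)

lemma reflection_reflection [simp]: "reflection \<alpha> (reflection \<alpha> v) = v"
  by (cases "\<alpha> = 0") (simp_all add: reflection_def inner_diff_left field_simps)

lemma reflection_self: "reflection \<alpha> \<alpha> = - \<alpha>"
  by (cases "\<alpha> = 0") (simp_all add: reflection_def scaleR_2)

lemma reflection_uminus: "reflection (- \<alpha>) = reflection \<alpha>"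
  by (simp add: reflection_def fun_eq_iff)

lemma reflection_fixes_iff: "\<alpha> \<noteq> 0 \<Longrightarrow> reflection \<alpha> v = v \<longleftrightarrow> \<alpha> \<bullet> v = 0"
  by (simp add: reflection_def inner_commute)

lemma orthogonal_transformation_conj_reflection:
  assumes "orthogonal_transformation w"
  shows "w (reflection \<alpha> v) = reflection (w \<alpha>) (w v)"
  using assms
  by (simp add: reflection_def orthogonal_transformation_def linear_diff linear_cmul)

text \<open>Group elements as words in roots: length arguments and membership in
  \<open>reflection_subgroup K\<close> become statements about lists.\<close>

primrec rprod :: "'a::euclidean_space list \<Rightarrow> 'a \<Rightarrow> 'a" where
  "rprod [] = id"
| "rprod (\<alpha> # as) = reflection \<alpha> \<circ> rprod as"

lemma rprod_append: "rprod (as @ bs) = rprod as \<circ> rprod bs"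
  by (induction as) (simp_all add: comp_assoc)

lemma orthogonal_transformation_rprod: "orthogonal_transformation (rprod as)"
proof (induction as)
  case Nil
  then show ?case using orthogonal_transformation_id by (simp add: id_def)
next
  case (Cons \<alpha> as)
  then show ?case
    unfolding rprod.simps
    by (intro orthogonal_transformation_compose orthogonal_transformation_reflection)
qed

lemma rprod_rev: "rprod (rev as) \<circ> rprod as = id"
  by (induction as) (simp_all add: rprod_append fun_eq_iff)

lemma rprod_map:
  assumes "orthogonal_transformation w"
  shows "w (rprod as v) = rprod (map w as) (w v)"
  by (induction as) (simp_all add: orthogonal_transformation_conj_reflection[OF assms])

lemma reflection_in_BijGroup: "reflection \<alpha> \<in> carrier (BijGroup UNIV)"
  using orthogonal_transformation_bij[OF orthogonal_transformation_reflection]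
  by (simp add: BijGroup_def Bij_def)

lemma BijGroup_mult:
  "u \<in> carrier (BijGroup UNIV) \<Longrightarrow> v \<in> carrier (BijGroup UNIV) \<Longrightarrow> u \<otimes>\<^bsub>BijGroup UNIV\<^esub> v = u \<circ> v"
  by (simp add: BijGroup_def compose_def fun_eq_iff)

lemma BijGroup_one: "\<one>\<^bsub>BijGroup UNIV\<^esub> = id"
  by (simp add: BijGroup_def fun_eq_iff)

lemma inv_reflection: "inv\<^bsub>BijGroup UNIV\<^esub> reflection \<alpha> = reflection \<alpha>"
proof -
  interpret group "BijGroup (UNIV :: 'a set)" by (rule group_BijGroup)
  show ?thesis
    by (rule inv_equality) (simp_all add: reflection_in_BijGroup BijGroup_mult BijGroup_one fun_eq_iff)
qed

lemma rprod_in_BijGroup: "rprod as \<in> carrier (BijGroup UNIV)"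
  using orthogonal_transformation_bij[OF orthogonal_transformation_rprod]
  by (simp add: BijGroup_def Bij_def)

text \<open>Reflections are involutions, so inverses of generators are words already.\<close>

lemma reflection_subgroup_eq: "reflection_subgroup K = {rprod as | as. set as \<subseteq> K}"
proof (intro equalityI subsetI)
  fix w assume "w \<in> reflection_subgroup K"
  then show "w \<in> {rprod as | as. set as \<subseteq> K}"
    unfolding reflection_subgroup_def
  proof (induction rule: generate.induct)
    case one
    show ?case by (intro CollectI exI[of _ "[]"]) (simp add: BijGroup_one)
  next
    case (incl h)
    then obtain \<alpha> where "\<alpha> \<in> K" "h = reflection \<alpha>" by auto
    then show ?case by (intro CollectI exI[of _ "[\<alpha>]"]) simp
  next
    case (inv h)
    then obtain \<alpha> where "\<alpha> \<in> K" "h = reflection \<alpha>" by auto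
    then show ?case by (intro CollectI exI[of _ "[\<alpha>]"]) (simp add: inv_reflection)
  next
    case (eng h1 h2)
    then obtain as bs where "h1 = rprod as" "set as \<subseteq> K" "h2 = rprod bs" "set bs \<subseteq> K" by auto
    then show ?case
      by (intro CollectI exI[of _ "as @ bs"]) (simp add: rprod_append BijGroup_mult rprod_in_BijGroup)
  qed
next
  fix w assume "w \<in> {rprod as | as. set as \<subseteq> K}"
  then obtain as where "w = rprod as" "set as \<subseteq> K" by auto
  then show "w \<in> reflection_subgroup K"
  proof (induction as arbitrary: w)
    case Nil
    then show ?case using generate.one[of "BijGroup UNIV" "reflection ` K"]
      by (simp add: reflection_subgroup_def BijGroup_one id_def)
  next
    case (Cons \<alpha> as)
    have "reflection \<alpha> \<otimes>\<^bsub>BijGroup UNIV\<^esub> rprod as \<in> reflection_subgroup K"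
      using Cons unfolding reflection_subgroup_def
      by (intro generate.eng[OF generate.incl]) auto
    then show ?case
      using Cons by (simp add: BijGroup_mult reflection_in_BijGroup rprod_in_BijGroup o_def)
  qed
qed

lemma rprod_in: "set as \<subseteq> K \<Longrightarrow> rprod as \<in> reflection_subgroup K"
  by (auto simp: reflection_subgroup_eq)

lemma id_in_subgroup: "id \<in> reflection_subgroup K"
  using rprod_in[of "[]" K] by simp

lemma reflection_in_subgroup: "\<alpha> \<in> K \<Longrightarrow> reflection \<alpha> \<in> reflection_subgroup K"
  using rprod_in[of "[\<alpha>]" K] by simp

lemma comp_in_subgroup:
  "u \<in> reflection_subgroup K \<Longrightarrow> v \<in> reflection_subgroup K \<Longrightarrow> u \<circ> v \<in> reflection_subgroup K"
  unfolding reflection_subgroup_eq by (auto simp flip: rprod_append) (metis le_sup_iff rprod_append set_append)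

lemma subgroup_orthogonal: "w \<in> reflection_subgroup K \<Longrightarrow> orthogonal_transformation w"
  using orthogonal_transformation_rprod by (auto simp: reflection_subgroup_eq)

lemma subgroup_mono: "J \<subseteq> K \<Longrightarrow> reflection_subgroup J \<subseteq> reflection_subgroup K"
  by (auto simp: reflection_subgroup_eq)

text \<open>The inverse as a plain function, free of group structure;
  \<open>inv_coxeter_group\<close> identifies it with the group inverse.\<close>

abbreviation finv :: "('a \<Rightarrow> 'a) \<Rightarrow> 'a \<Rightarrow> 'a" where
  "finv w \<equiv> inv_into UNIV w"

lemma
  assumes "w \<in> reflection_subgroup K"
  shows subgroup_inv: "finv w \<in> reflection_subgroup K"
    and inv_left [simp]: "finv w (w v) = v"
    and inv_right [simp]: "w (finv w v) = v"
proof -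
  obtain as where as: "w = rprod as" "set as \<subseteq> K" using assms by (auto simp: reflection_subgroup_eq)
  have l: "rprod (rev as) (w v) = v" for v
    using rprod_rev[of as] by (simp add: as fun_eq_iff)
  have b: "bij w" using orthogonal_transformation_bij[OF subgroup_orthogonal[OF assms]] .
  show 1: "finv w (w v) = v" for v
    using b by (simp add: bij_is_inj)
  show "w (finv w v) = v"
    using b by (simp add: bij_is_surj surj_f_inv_f)
  have "finv w = rprod (rev as)"
    using b l 1 by (intro ext) (metis bij_pointE)
  then show "finv w \<in> reflection_subgroup K"
    using as by (simp add: rprod_in)
qed

lemma finv_finv:
  assumes "w \<in> reflection_subgroup K"
  shows "finv (finv w) = w"
proof
  fix v
  show "finv (finv w) v = w v"
    using inv_left[OF subgroup_inv[OF assms], of "w v"] inv_left[OF assms, of v] by simp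
qed

lemma inner_adjoint:
  assumes "w \<in> reflection_subgroup K"
  shows "u \<bullet> w v = finv w u \<bullet> v"
proof -
  have "w (finv w u) \<bullet> w v = finv w u \<bullet> v"
    using subgroup_orthogonal[OF assms] by (simp add: orthogonal_transformation_def)
  then show ?thesis using assms by simp
qed

lemma subgroup_inner: "w \<in> reflection_subgroup K \<Longrightarrow> w u \<bullet> w v = u \<bullet> v"
  using subgroup_orthogonal by (auto simp: orthogonal_transformation_def)

lemma subgroup_linear: "w \<in> reflection_subgroup K \<Longrightarrow> linear w"
  using subgroup_orthogonal by (auto simp: orthogonal_transformation_def)

lemma subgroup_inj: "w \<in> reflection_subgroup K \<Longrightarrow> inj w"
  by (rule orthogonal_transformation_inj[OF subgroup_orthogonal])

section \<open>Root systems with a base\<close>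

locale based_root_system =
  fixes \<Phi> \<Delta> :: "'a::euclidean_space set"
  assumes root_system: "root_system \<Phi>" and root_base: "root_base \<Phi> \<Delta>"
begin

abbreviation W :: "('a \<Rightarrow> 'a) set" where "W \<equiv> reflection_subgroup \<Phi>"

abbreviation R :: "'a set set" where "R \<equiv> root_arrangement \<Phi>"

abbreviation CG :: "('a \<Rightarrow> 'a) monoid" where "CG \<equiv> coxeter_group \<Phi>"

abbreviation reps :: "'a set \<Rightarrow> ('a \<Rightarrow> 'a) set" where "reps \<equiv> X_set \<Phi> \<Delta>"

abbreviation cls :: "'a set \<Rightarrow> 'a set set" where "cls \<equiv> subset_class \<Phi> \<Delta>"

abbreviation mu :: "'a set \<Rightarrow> 'a set \<Rightarrow> real" where "mu \<equiv> mu_coeff \<Phi> \<Delta>"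

abbreviation beta :: "'a set \<Rightarrow> 'a set \<Rightarrow> real" where "beta \<equiv> beta_coeff \<Phi> \<Delta>"

abbreviation pos :: "'a \<Rightarrow> bool" where "pos \<equiv> nonneg_combination \<Delta>"

lemma finite_roots: "finite \<Phi>" and zero_notin: "0 \<notin> \<Phi>" and span_roots: "span \<Phi> = UNIV"
  using root_system by (auto simp: root_system_def)

lemma root_multiple: "\<alpha> \<in> \<Phi> \<Longrightarrow> c *\<^sub>R \<alpha> \<in> \<Phi> \<Longrightarrow> c *\<^sub>R \<alpha> = \<alpha> \<or> c *\<^sub>R \<alpha> = - \<alpha>"
  using root_system unfolding root_system_def by (metis Int_iff insertE singletonD span_base span_scale singletonI)

lemma reflection_root: "\<alpha> \<in> \<Phi> \<Longrightarrow> \<beta> \<in> \<Phi> \<Longrightarrow> reflection \<alpha> \<beta> \<in> \<Phi>"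
  using root_system unfolding root_system_def by blast

lemma uminus_root: "\<alpha> \<in> \<Phi> \<Longrightarrow> - \<alpha> \<in> \<Phi>"
  using reflection_root[of \<alpha> \<alpha>] by (simp add: reflection_self)

lemma base_subset: "\<Delta> \<subseteq> \<Phi>" and base_independent: "independent \<Delta>"
  and pos_or_neg: "\<beta> \<in> \<Phi> \<Longrightarrow> pos \<beta> \<or> pos (- \<beta>)"
  using root_base by (auto simp: root_base_def)

lemma finite_base: "finite \<Delta>"
  using base_subset finite_roots finite_subset by blast

lemma W_root: "w \<in> W \<Longrightarrow> \<beta> \<in> \<Phi> \<Longrightarrow> w \<beta> \<in> \<Phi>"
proof -
  assume "w \<in> W" and b: "\<beta> \<in> \<Phi>"
  then obtain as where "w = rprod as" "set as \<subseteq> \<Phi>" by (auto simp: reflection_subgroup_eq)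
  then show ?thesis
    by (induction as arbitrary: w) (auto simp: b reflection_root)
qed

text \<open>The roots span the space, so an element is determined by how it permutes these finitely
  many vectors.\<close>

lemma finite_W: "finite W"
proof -
  have "inj_on (\<lambda>w. restrict w \<Phi>) W"
  proof (rule inj_onI)
    fix u w assume uw: "u \<in> W" "w \<in> W" and eq: "restrict u \<Phi> = restrict w \<Phi>"
    have eq': "u \<beta> = w \<beta>" if "\<beta> \<in> \<Phi>" for \<beta> using eq that by (metis restrict_apply')
    show "u = w"
    proof
      fix v
      show "u v = w v"
        using linear_eq_on_span[OF subgroup_linear[OF uw(1)] subgroup_linear[OF uw(2)], of \<Phi> v] eq' span_roots
        by auto
    qed
  qed
  moreover have "(\<lambda>w. restrict w \<Phi>) ` W \<subseteq> \<Phi> \<rightarrow>\<^sub>E \<Phi>"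
    using W_root by auto
  moreover have "finite (\<Phi> \<rightarrow>\<^sub>E \<Phi>)" using finite_roots by (intro finite_PiE) auto
  ultimately show ?thesis by (metis finite_imageD finite_subset)
qed

text \<open>A point of the face of the fundamental chamber on which exactly the simple roots in \<open>J\<close>
  vanish; \<open>\<delta>\<close> is a point of the fundamental chamber itself.\<close>

definition pt :: "'a set \<Rightarrow> 'a" where
  "pt J = (SOME q. \<forall>\<alpha>\<in>\<Delta>. \<alpha> \<bullet> q = (if \<alpha> \<in> J then 0 else 1))"

text \<open>Independence lets arbitrary values on the simple roots extend to a linear functional,
  which is the inner product with some vector.\<close>

lemma inner_pt: "\<alpha> \<in> \<Delta> \<Longrightarrow> \<alpha> \<bullet> pt J = (if \<alpha> \<in> J then 0 else 1)"
proof -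
  obtain f :: "'a \<Rightarrow> real" where f: "linear f" "\<forall>\<alpha>\<in>\<Delta>. f \<alpha> = (if \<alpha> \<in> J then 0 else 1)"
    using linear_independent_extend[OF base_independent, of "\<lambda>\<alpha>. if \<alpha> \<in> J then 0 else 1"] by blast
  have "v \<bullet> (\<Sum>b\<in>Basis. f b *\<^sub>R b) = f v" for v
  proof -
    have "f v = f (\<Sum>b\<in>Basis. (v \<bullet> b) *\<^sub>R b)" by (simp add: euclidean_representation)
    then show ?thesis
      by (simp add: linear_sum[OF f(1)] linear_cmul[OF f(1)] inner_sum_right mult.commute)
  qed
  then have "\<exists>q. \<forall>\<alpha>\<in>\<Delta>. \<alpha> \<bullet> q = (if \<alpha> \<in> J then 0 else 1)"
    using f(2) by (intro exI[of _ "\<Sum>b\<in>Basis. f b *\<^sub>R b"]) auto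
  from someI_ex[OF this, folded pt_def] show "\<alpha> \<in> \<Delta> \<Longrightarrow> \<alpha> \<bullet> pt J = (if \<alpha> \<in> J then 0 else 1)"
    by (rule bspec)
qed

abbreviation \<delta> :: 'a where "\<delta> \<equiv> pt {}"

definition dominant :: "'a \<Rightarrow> bool" where
  "dominant v \<longleftrightarrow> (\<forall>\<alpha>\<in>\<Delta>. \<alpha> \<bullet> v \<ge> 0)"

lemma dominant_pt: "dominant (pt J)"
  by (simp add: dominant_def inner_pt)

lemma pos_inner_dominant: "pos \<beta> \<Longrightarrow> dominant v \<Longrightarrow> \<beta> \<bullet> v \<ge> 0"
  by (auto simp: nonneg_combination_def dominant_def inner_sum_left intro!: sum_nonneg)

text \<open>A vanishing sum of nonnegative terms vanishes termwise, so only simple roots orthogonal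
  to \<open>v\<close> can occur in \<open>\<beta>\<close>.\<close>

lemma pos_inner_eq_0:
  assumes "pos \<beta>" "dominant v" "\<beta> \<bullet> v = 0"
  obtains c where "\<And>\<alpha>. \<alpha> \<in> \<Delta> \<Longrightarrow> 0 \<le> c \<alpha>" "\<beta> = (\<Sum>\<alpha>\<in>{\<alpha> \<in> \<Delta>. \<alpha> \<bullet> v = 0}. c \<alpha> *\<^sub>R \<alpha>)"
proof -
  obtain c where c: "\<forall>\<alpha>\<in>\<Delta>. 0 \<le> c \<alpha>" "\<beta> = (\<Sum>\<alpha>\<in>\<Delta>. c \<alpha> *\<^sub>R \<alpha>)"
    using assms(1) by (auto simp: nonneg_combination_def)
  have "(\<Sum>\<alpha>\<in>\<Delta>. c \<alpha> * (\<alpha> \<bullet> v)) = 0"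
    using assms(3) by (simp add: c(2) inner_sum_left)
  then have "\<forall>\<alpha>\<in>\<Delta>. c \<alpha> * (\<alpha> \<bullet> v) = 0"
    using c(1) assms(2) finite_base by (subst (asm) sum_nonneg_eq_0_iff) (auto simp: dominant_def)
  then have "\<beta> = (\<Sum>\<alpha>\<in>{\<alpha> \<in> \<Delta>. \<alpha> \<bullet> v = 0}. c \<alpha> *\<^sub>R \<alpha>)"
    unfolding c(2) using finite_base by (intro sum.mono_neutral_right) auto
  then show thesis using that c(1) by blast
qed

lemma inner_delta_pos: "\<alpha> \<in> \<Delta> \<Longrightarrow> \<alpha> \<bullet> \<delta> = 1"
  by (simp add: inner_pt)

lemma pos_inner_delta:
  assumes "pos \<beta>" "\<beta> \<noteq> 0"
  shows "\<beta> \<bullet> \<delta> > 0"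
proof -
  have "\<beta> \<bullet> \<delta> \<noteq> 0"
  proof
    assume "\<beta> \<bullet> \<delta> = 0"
    then obtain c where "\<beta> = (\<Sum>\<alpha>\<in>{\<alpha> \<in> \<Delta>. \<alpha> \<bullet> \<delta> = 0}. c \<alpha> *\<^sub>R \<alpha>)"
      using pos_inner_eq_0[OF assms(1) dominant_pt] by blast
    also have "{\<alpha> \<in> \<Delta>. \<alpha> \<bullet> \<delta> = 0} = {}" using inner_delta_pos by auto
    finally show False using assms(2) by simp
  qed
  then show ?thesis using pos_inner_dominant[OF assms(1) dominant_pt] by (simp add: less_le)
qed

text \<open>Positivity of a root becomes the sign of a single inner product, which is easier to
  follow through group elements.\<close>

lemma root_pos_iff: "\<beta> \<in> \<Phi> \<Longrightarrow> pos \<beta> \<longleftrightarrow> \<beta> \<bullet> \<delta> > 0"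
  using pos_or_neg[of \<beta>] pos_inner_delta[of \<beta>] pos_inner_delta[of "- \<beta>"] zero_notin by fastforce

lemma root_neg_iff: "\<beta> \<in> \<Phi> \<Longrightarrow> \<not> pos \<beta> \<longleftrightarrow> pos (- \<beta>)"
  using root_pos_iff[of \<beta>] root_pos_iff[of "- \<beta>"] uminus_root[of \<beta>] pos_or_neg[of \<beta>] by fastforce

section \<open>Simple reflections, exchange and the fundamental domain\<close>

lemma pos_base: "\<alpha> \<in> \<Delta> \<Longrightarrow> pos \<alpha>"
  using root_pos_iff[of \<alpha>] inner_delta_pos[of \<alpha>] base_subset by auto

text \<open>Only \<open>\<alpha>\<close> among the simple roots is orthogonal to
  \<open>pt {\<alpha>}\<close>, so \<open>\<beta>\<close> is a multiple of it; reducedness and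
  positivity leave \<open>\<alpha>\<close> itself.\<close>

lemma pos_root_eq_simple:
  assumes "\<beta> \<in> \<Phi>" "pos \<beta>" "\<alpha> \<in> \<Delta>" "\<beta> \<bullet> pt {\<alpha>} = 0"
  shows "\<beta> = \<alpha>"
proof -
  obtain c where c: "\<And>\<alpha>. \<alpha> \<in> \<Delta> \<Longrightarrow> 0 \<le> c \<alpha>"
      "\<beta> = (\<Sum>\<gamma>\<in>{\<gamma> \<in> \<Delta>. \<gamma> \<bullet> pt {\<alpha>} = 0}. c \<gamma> *\<^sub>R \<gamma>)"
    using pos_inner_eq_0[OF assms(2) dominant_pt assms(4)] by blast
  have "{\<gamma> \<in> \<Delta>. \<gamma> \<bullet> pt {\<alpha>} = 0} = {\<alpha>}"
    using assms(3) by (auto simp: inner_pt split: if_splits)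
  then have b: "\<beta> = c \<alpha> *\<^sub>R \<alpha>" using c(2) by simp
  have aR: "\<alpha> \<in> \<Phi>" using assms(3) base_subset by auto
  have "\<beta> = \<alpha> \<or> \<beta> = - \<alpha>" using root_multiple[OF aR, of "c \<alpha>"] assms(1) b by simp
  moreover have "\<beta> \<noteq> - \<alpha>"
    using assms(2) pos_base[OF assms(3)] root_neg_iff[OF aR] by auto
  ultimately show ?thesis by simp
qed

text \<open>The reflection changes only the coefficient of \<open>\<alpha>\<close>, which the inner
  product with \<open>pt {\<alpha>}\<close> does not see. A negative image would force that product
  to be zero.\<close>

lemma simple_reflection_pos:
  assumes "\<beta> \<in> \<Phi>" "pos \<beta>" "\<alpha> \<in> \<Delta>" "\<beta> \<noteq> \<alpha>"
  shows "pos (reflection \<alpha> \<beta>)"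
proof (rule ccontr)
  assume n: "\<not> pos (reflection \<alpha> \<beta>)"
  have "reflection \<alpha> \<beta> \<in> \<Phi>" using assms base_subset reflection_root by auto
  then have "pos (- reflection \<alpha> \<beta>)" using n root_neg_iff by auto
  then have "(- reflection \<alpha> \<beta>) \<bullet> pt {\<alpha>} \<ge> 0" by (rule pos_inner_dominant[OF _ dominant_pt])
  then have "\<beta> \<bullet> pt {\<alpha>} \<le> 0"
    using assms(3) by (simp add: reflection_def inner_diff_left inner_pt)
  then have "\<beta> \<bullet> pt {\<alpha>} = 0"
    using pos_inner_dominant[OF assms(2) dominant_pt[of "{\<alpha>}"]] by simp
  then show False using pos_root_eq_simple assms by blast
qed

text \<open>Applying the word letter by letter, the image of \<open>\<alpha>\<close> turns negative
  at some letter \<open>\<beta>\<close>. Just before, it equals \<open>\<beta>\<close>, since a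
  simple reflection makes no other positive root negative; conjugating
  \<open>reflection \<alpha>\<close> through the rest of the word cancels that letter.\<close>

lemma exchange:
  assumes "set as \<subseteq> \<Delta>" "\<alpha> \<in> \<Delta>" "\<not> pos (rprod as \<alpha>)"
  shows "\<exists>bs. set bs \<subseteq> \<Delta> \<and> length as = Suc (length bs) \<and> rprod as \<circ> reflection \<alpha> = rprod bs"
  using assms
proof (induction as)
  case Nil
  then show ?case using pos_base by simp
next
  case (Cons \<beta> as)
  show ?case
  proof (cases "pos (rprod as \<alpha>)")
    case False
    moreover have "set as \<subseteq> \<Delta>" using Cons.prems(1) by simp
    ultimately obtain bs where bs: "set bs \<subseteq> \<Delta>" "length as = Suc (length bs)"
        "rprod as \<circ> reflection \<alpha> = rprod bs"
      using Cons.IH Cons.prems(2) by blast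
    then show ?thesis
      using Cons.prems(1) fun_cong[OF bs(3)] by (intro exI[of _ "\<beta> # bs"]) (simp add: fun_eq_iff)
  next
    case True
    have "rprod as \<in> W"
      using Cons.prems(1) base_subset by (intro rprod_in) auto
    then have "rprod as \<alpha> \<in> \<Phi>" using W_root Cons.prems(2) base_subset by auto
    then have b: "rprod as \<alpha> = \<beta>"
      using simple_reflection_pos[OF _ True, of \<beta>] Cons.prems by auto
    have "rprod (\<beta> # as) \<circ> reflection \<alpha> = rprod as"
    proof
      fix v
      show "(rprod (\<beta> # as) \<circ> reflection \<alpha>) v = rprod as v"
        using orthogonal_transformation_conj_reflection[OF orthogonal_transformation_rprod, of as \<alpha> v]
        by (simp add: b)
    qed
    then show ?thesis using Cons.prems by (intro exI[of _ as]) (auto simp: o_def)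
  qed
qed

text \<open>The last letter of a shortest word is such a root: if the remaining word already made it
  negative, the exchange would yield a shorter word.\<close>

lemma ex_negative_simple:
  assumes "w \<in> reflection_subgroup \<Delta>" "w \<noteq> id"
  shows "\<exists>\<alpha>\<in>\<Delta>. \<not> pos (w \<alpha>)"
proof -
  have "\<exists>as. set as \<subseteq> \<Delta> \<and> w = rprod as" using assms(1) by (auto simp: reflection_subgroup_eq)
  then obtain as where as: "set as \<subseteq> \<Delta>" "w = rprod as"
    and least: "\<And>bs. set bs \<subseteq> \<Delta> \<and> w = rprod bs \<Longrightarrow> length as \<le> length bs"
    using ex_has_least_nat[of "\<lambda>as. set as \<subseteq> \<Delta> \<and> w = rprod as" _ length] by blast
  have "as \<noteq> []" using as assms(2) by auto
  then obtain bs \<alpha> where b: "as = bs @ [\<alpha>]" by (metis rev_exhaust)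
  have a: "\<alpha> \<in> \<Delta>" using as b by auto
  have aR: "\<alpha> \<in> \<Phi>" using a base_subset by auto
  have w: "w = rprod bs \<circ> reflection \<alpha>" using as b by (simp add: rprod_append)
  have "pos (rprod bs \<alpha>)"
  proof (rule ccontr)
    assume "\<not> ?thesis"
    then obtain cs where "set cs \<subseteq> \<Delta>" "length bs = Suc (length cs)" "w = rprod cs"
      using exchange[of bs \<alpha>] a as b w by auto
    then show False using least[of cs] b by simp
  qed
  moreover have "w \<alpha> = - rprod bs \<alpha>"
    using linear_neg[OF orthogonal_transformation_linear[OF orthogonal_transformation_rprod]]
    by (simp add: w reflection_self)
  moreover have "rprod bs \<alpha> \<in> \<Phi>"
    using as b base_subset by (intro W_root[OF rprod_in aR]) auto
  ultimately have "\<not> pos (w \<alpha>)" using root_neg_iff by auto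
  then show ?thesis using a by blast
qed

text \<open>A simple root made negative must be orthogonal to \<open>p\<close>, because
  \<open>p\<close> and its image are both dominant. Its reflection fixes \<open>p\<close> and is
  split off, which shortens the word. Thus the closed fundamental chamber is a strict fundamental
  domain with parabolic stabilisers.\<close>

lemma dominant_conjugate:
  assumes "set as \<subseteq> \<Delta>" "dominant p" "dominant (rprod as p)"
  shows "rprod as p = p \<and> rprod as \<in> reflection_subgroup {\<alpha> \<in> \<Delta>. \<alpha> \<bullet> p = 0}"
  using assms
proof (induction "length as" arbitrary: as rule: less_induct)
  case less
  show ?case
  proof (cases "rprod as = id")
    case True
    then show ?thesis by (simp add: id_in_subgroup)
  next
    case False
    let ?w = "rprod as"
    have w: "?w \<in> reflection_subgroup \<Delta>" using less.prems(1) by (rule rprod_in)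
    then have wW: "?w \<in> W" using subgroup_mono[OF base_subset] by auto
    obtain \<alpha> where a: "\<alpha> \<in> \<Delta>" "\<not> pos (?w \<alpha>)" using ex_negative_simple[OF w False] by auto
    then have "pos (- ?w \<alpha>)" using root_neg_iff W_root[OF wW] base_subset by auto
    then have "(- ?w \<alpha>) \<bullet> ?w p \<ge> 0" using less.prems(3) by (rule pos_inner_dominant)
    then have "\<alpha> \<bullet> p \<le> 0" using subgroup_inner[OF w] by simp
    then have ap: "\<alpha> \<bullet> p = 0" using less.prems(2) a(1) by (force simp: dominant_def)
    then have rp: "reflection \<alpha> p = p" by (simp add: reflection_def inner_commute)
    obtain bs where bs: "set bs \<subseteq> \<Delta>" "length as = Suc (length bs)" "?w \<circ> reflection \<alpha> = rprod bs"
      using exchange[OF less.prems(1) a] by blast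
    have bp: "rprod bs p = ?w p" using rp fun_cong[OF bs(3), of p] by simp
    have IH: "rprod bs p = p \<and> rprod bs \<in> reflection_subgroup {\<alpha> \<in> \<Delta>. \<alpha> \<bullet> p = 0}"
      using less.hyps[OF _ bs(1) less.prems(2)] bs(2) bp less.prems(3) by simp
    have "?w = rprod bs \<circ> reflection \<alpha>" by (simp add: bs(3)[symmetric] fun_eq_iff)
    moreover have "reflection \<alpha> \<in> reflection_subgroup {\<alpha> \<in> \<Delta>. \<alpha> \<bullet> p = 0}"
      using a ap by (intro reflection_in_subgroup) auto
    ultimately show ?thesis using IH bp comp_in_subgroup by metis
  qed
qed

text \<open>Take a positive conjugate \<open>\<gamma>\<close> of least height, measured by the
  product with \<open>\<delta>\<close>. As \<open>\<gamma> \<bullet> \<gamma> > 0\<close>, some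
  simple \<open>\<alpha>\<close> has positive product with it; were \<open>\<gamma>\<close> not this
  \<open>\<alpha>\<close>, its reflection would be positive and lower.\<close>

lemma root_conjugate_simple:
  assumes "\<beta> \<in> \<Phi>" "pos \<beta>"
  shows "\<exists>w\<in>reflection_subgroup \<Delta>. w \<beta> \<in> \<Delta>"
proof -
  define S where "S = {\<gamma>. pos \<gamma> \<and> (\<exists>w\<in>reflection_subgroup \<Delta>. \<gamma> = w \<beta>)}"
  have SR: "S \<subseteq> \<Phi>" using W_root[OF _ assms(1)] subgroup_mono[OF base_subset] by (auto simp: S_def)
  then have "finite S" using finite_roots finite_subset by blast
  moreover have "\<beta> \<in> S" using assms id_in_subgroup[of \<Delta>] unfolding S_def by (auto intro!: bexI[of _ id])
  ultimately have "arg_min_on (\<lambda>\<gamma>. \<gamma> \<bullet> \<delta>) S \<in> S \<and>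
      (\<forall>\<gamma>'\<in>S. arg_min_on (\<lambda>\<gamma>. \<gamma> \<bullet> \<delta>) S \<bullet> \<delta> \<le> \<gamma>' \<bullet> \<delta>)"
    using arg_min_if_finite(1)[of S "\<lambda>\<gamma>. \<gamma> \<bullet> \<delta>"] arg_min_least[of S _ "\<lambda>\<gamma>. \<gamma> \<bullet> \<delta>"]
    by (metis empty_iff)
  then obtain \<gamma> where g: "\<gamma> \<in> S" and least: "\<And>\<gamma>'. \<gamma>' \<in> S \<Longrightarrow> \<gamma> \<bullet> \<delta> \<le> \<gamma>' \<bullet> \<delta>"
    by blast
  obtain w where w: "w \<in> reflection_subgroup \<Delta>" "\<gamma> = w \<beta>" "pos \<gamma>" using g by (auto simp: S_def)
  have gR: "\<gamma> \<in> \<Phi>" using g SR by auto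
  obtain c where c: "\<forall>\<alpha>\<in>\<Delta>. 0 \<le> c \<alpha>" "\<gamma> = (\<Sum>\<alpha>\<in>\<Delta>. c \<alpha> *\<^sub>R \<alpha>)"
    using w(3) by (auto simp: nonneg_combination_def)
  have "\<exists>\<alpha>\<in>\<Delta>. \<gamma> \<bullet> \<alpha> > 0"
  proof (rule ccontr)
    assume "\<not> ?thesis"
    then have "\<forall>\<alpha>\<in>\<Delta>. c \<alpha> * (\<gamma> \<bullet> \<alpha>) \<le> 0" using c(1) by (auto simp: mult_le_0_iff not_less)
    then have "\<gamma> \<bullet> \<gamma> \<le> 0" by (subst (2) c(2)) (auto simp: inner_sum_right intro!: sum_nonpos)
    then show False using gR zero_notin by (metis inner_gt_zero_iff not_le)
  qed
  then obtain \<alpha> where a: "\<alpha> \<in> \<Delta>" "\<gamma> \<bullet> \<alpha> > 0" by blast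
  have "\<gamma> = \<alpha>"
  proof (rule ccontr)
    assume "\<gamma> \<noteq> \<alpha>"
    then have "pos (reflection \<alpha> \<gamma>)" using simple_reflection_pos gR w(3) a(1) by blast
    moreover have "reflection \<alpha> \<circ> w \<in> reflection_subgroup \<Delta>"
      using w(1) a(1) by (intro comp_in_subgroup reflection_in_subgroup)
    moreover have "reflection \<alpha> \<gamma> = (reflection \<alpha> \<circ> w) \<beta>" using w(2) by simp
    ultimately have "reflection \<alpha> \<gamma> \<in> S" unfolding S_def by blast
    then have "\<gamma> \<bullet> \<delta> \<le> reflection \<alpha> \<gamma> \<bullet> \<delta>" by (rule least)
    then have "2 * (\<gamma> \<bullet> \<alpha>) / (\<alpha> \<bullet> \<alpha>) \<le> 0"
      using a(1) by (simp add: reflection_def inner_diff_left inner_delta_pos)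
    moreover have "\<alpha> \<bullet> \<alpha> > 0" using a(2) by (metis inner_gt_zero_iff inner_zero_right less_irrefl)
    ultimately show False using a(2) by (simp add: divide_le_0_iff)
  qed
  then show ?thesis using w a by auto
qed

text \<open>Up to sign every root is conjugate to a simple one by simple reflections, so its
  reflection is a conjugate of a simple reflection.\<close>

lemma W_eq: "W = reflection_subgroup \<Delta>"
proof
  show "reflection_subgroup \<Delta> \<subseteq> W" using subgroup_mono base_subset by auto
  have refl: "reflection \<beta> \<in> reflection_subgroup \<Delta>" if b: "\<beta> \<in> \<Phi>" for \<beta>
  proof -
    obtain \<beta>' where b': "\<beta>' \<in> \<Phi>" "pos \<beta>'" "reflection \<beta>' = reflection \<beta>"
      using pos_or_neg[OF b] b uminus_root[OF b] reflection_uminus[of \<beta>] by metis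
    obtain w where w: "w \<in> reflection_subgroup \<Delta>" "w \<beta>' \<in> \<Delta>" using root_conjugate_simple[OF b'(1,2)] by blast
    have "finv w \<circ> (reflection (w \<beta>') \<circ> w) \<in> reflection_subgroup \<Delta>"
      using w by (intro comp_in_subgroup subgroup_inv reflection_in_subgroup)
    moreover have "finv w \<circ> (reflection (w \<beta>') \<circ> w) = reflection \<beta>'"
      using w(1) by (auto simp: fun_eq_iff simp flip: orthogonal_transformation_conj_reflection[OF subgroup_orthogonal[OF w(1)]])
    ultimately show ?thesis using b' by simp
  qed
  show "W \<subseteq> reflection_subgroup \<Delta>"
  proof
    fix w assume "w \<in> W"
    then obtain as where "w = rprod as" "set as \<subseteq> \<Phi>" by (auto simp: reflection_subgroup_eq)
    then show "w \<in> reflection_subgroup \<Delta>"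
      by (induction as arbitrary: w) (auto simp: id_in_subgroup intro!: comp_in_subgroup refl)
  qed
qed

lemma W_dominant_conjugate:
  assumes "w \<in> W" "dominant p" "dominant (w p)"
  shows "w p = p" "w \<in> reflection_subgroup {\<alpha> \<in> \<Delta>. \<alpha> \<bullet> p = 0}"
proof -
  obtain as where "set as \<subseteq> \<Delta>" "w = rprod as"
    using assms(1) unfolding W_eq by (auto simp: reflection_subgroup_eq)
  then show "w p = p" "w \<in> reflection_subgroup {\<alpha> \<in> \<Delta>. \<alpha> \<bullet> p = 0}"
    using dominant_conjugate[of as p] assms(2,3) by simp_all
qed

text \<open>An image of \<open>v\<close> with greatest product with \<open>\<delta>\<close> is
  dominant, since otherwise a simple reflection would increase that product.\<close>

lemma ex_dominant: "\<exists>w\<in>W. dominant (w v)"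
proof -
  have "W \<noteq> {}" using id_in_subgroup by blast
  then obtain w where w: "w \<in> W" and "\<And>u. u \<in> W \<Longrightarrow> - (w v \<bullet> \<delta>) \<le> - (u v \<bullet> \<delta>)"
    using arg_min_if_finite(1)[OF finite_W, of "\<lambda>w. - (w v \<bullet> \<delta>)"]
      arg_min_least[OF finite_W, of _ "\<lambda>w. - (w v \<bullet> \<delta>)"] by blast
  then have greatest: "\<And>u. u \<in> W \<Longrightarrow> u v \<bullet> \<delta> \<le> w v \<bullet> \<delta>" by simp
  have "\<alpha> \<bullet> w v \<ge> 0" if a: "\<alpha> \<in> \<Delta>" for \<alpha>
  proof -
    have aR: "\<alpha> \<in> \<Phi>" using a base_subset by auto
    then have pos: "\<alpha> \<bullet> \<alpha> > 0" using zero_notin by (metis inner_gt_zero_iff)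
    have "reflection \<alpha> \<circ> w \<in> W" using w aR by (intro comp_in_subgroup reflection_in_subgroup)
    from greatest[OF this] have "2 * (w v \<bullet> \<alpha>) / (\<alpha> \<bullet> \<alpha>) \<ge> 0"
      using a by (simp add: reflection_def inner_diff_left inner_delta_pos)
    then show ?thesis using pos by (simp add: zero_le_divide_iff inner_commute)
  qed
  then show ?thesis using w by (auto simp: dominant_def)
qed

section \<open>The arrangement of a reflection group\<close>

text \<open>Opposite roots share a hyperplane, so one of them has to be chosen as its
  normal.\<close>

definition root_nrm :: "'a set \<Rightarrow> 'a" where
  "root_nrm H = (SOME \<alpha>. \<alpha> \<in> \<Phi> \<and> H = {v. \<alpha> \<bullet> v = 0})"

lemma root_nrm:
  assumes "H \<in> R"
  shows "root_nrm H \<in> \<Phi> \<and> H = {v. root_nrm H \<bullet> v = 0}"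
proof -
  have "\<exists>\<alpha>. \<alpha> \<in> \<Phi> \<and> H = {v. \<alpha> \<bullet> v = 0}"
    using assms unfolding root_arrangement_def by blast
  from someI_ex[OF this] show ?thesis
    unfolding root_nrm_def .
qed

end

sublocale based_root_system \<subseteq> arrangement "root_arrangement \<Phi>" root_nrm "\<lambda>_. 0"
proof
  show "finite R"
    using finite_roots by (simp add: root_arrangement_def)
  show "\<And>H. H \<in> R \<Longrightarrow> root_nrm H \<noteq> 0"
    using root_nrm zero_notin by metis
  show "\<And>H. H \<in> R \<Longrightarrow> H = {v. root_nrm H \<bullet> v = 0}"
    using root_nrm by blast
qed

context based_root_system
begin

lemma root_proportional:
  assumes "\<beta> \<in> \<Phi>"
  obtains H c where "H \<in> R" "c \<noteq> 0" "\<beta> = c *\<^sub>R root_nrm H"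
proof -
  let ?H = "{v. \<beta> \<bullet> v = 0}"
  have H: "?H \<in> R" using assms by (auto simp: root_arrangement_def)
  have "root_nrm ?H \<noteq> 0" "\<beta> \<noteq> 0" using nrm_nonzero[OF H] assms zero_notin by auto
  moreover have "{v. root_nrm ?H \<bullet> v = 0} = {v. \<beta> \<bullet> v = 0}" using hyperplane[OF H] by (rule sym)
  ultimately obtain c where "c \<noteq> 0" "\<beta> = c *\<^sub>R root_nrm ?H"
    by (rule hyperplane_eq_imp_proportional)
  then show thesis using that H by blast
qed

text \<open>Every root is a nonzero multiple of a chosen normal. Testing signs on all roots removes
  the choice and is compatible with the action of \<open>W\<close>.\<close>

lemma cell_eq_roots: "cell u = cell v \<longleftrightarrow> (\<forall>\<beta>\<in>\<Phi>. sgn (\<beta> \<bullet> u) = sgn (\<beta> \<bullet> v))"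
proof
  assume c: "cell u = cell v"
  show "\<forall>\<beta>\<in>\<Phi>. sgn (\<beta> \<bullet> u) = sgn (\<beta> \<bullet> v)"
  proof
    fix \<beta> assume "\<beta> \<in> \<Phi>"
    then obtain H c where H: "H \<in> R" "\<beta> = c *\<^sub>R root_nrm H"
      by (rule root_proportional)
    then have "sgn (root_nrm H \<bullet> u) = sgn (root_nrm H \<bullet> v)"
      using c unfolding cell_eq_iff sg_def by simp
    then show "sgn (\<beta> \<bullet> u) = sgn (\<beta> \<bullet> v)" by (simp add: H(2) sgn_mult)
  qed
next
  assume "\<forall>\<beta>\<in>\<Phi>. sgn (\<beta> \<bullet> u) = sgn (\<beta> \<bullet> v)"
  then show "cell u = cell v" unfolding cell_eq_iff sg_def using root_nrm by simp
qed

lemma sgn_pmult: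
  assumes "\<beta> \<in> \<Phi>"
  shows "sgn (\<beta> \<bullet> pmult u v) = (if \<beta> \<bullet> u = 0 then sgn (\<beta> \<bullet> v) else sgn (\<beta> \<bullet> u))"
proof -
  obtain H c where H: "H \<in> R" "c \<noteq> 0" "\<beta> = c *\<^sub>R root_nrm H"
    using root_proportional[OF assms] .
  have "sgn (root_nrm H \<bullet> pmult u v) =
      (if root_nrm H \<bullet> u = 0 then sgn (root_nrm H \<bullet> v) else sgn (root_nrm H \<bullet> u))"
    using sg_mult[OF H(1), of u v] by (simp add: sg_def sgn_zero_iff)
  then show ?thesis using H(2) by (simp add: H(3) sgn_mult)
qed

lemma zeros_empty_iff: "zeros v = {} \<longleftrightarrow> (\<forall>\<beta>\<in>\<Phi>. \<beta> \<bullet> v \<noteq> 0)"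
  unfolding zeros_def by (auto simp: root_arrangement_def)

lemma mem_supp_iff: "q \<in> supp p \<longleftrightarrow> (\<forall>\<beta>\<in>\<Phi>. \<beta> \<bullet> p = 0 \<longrightarrow> \<beta> \<bullet> q = 0)"
  unfolding supp_def zeros_def by (auto simp: root_arrangement_def)

lemma supp_cell: "cell u = cell v \<Longrightarrow> supp u = supp v"
  using face_support_cell by metis

lemma finv_root: "w \<in> W \<Longrightarrow> \<beta> \<in> \<Phi> \<Longrightarrow> finv w \<beta> \<in> \<Phi>"
  using W_root subgroup_inv by blast

lemma all_roots_W:
  assumes "w \<in> W"
  shows "(\<forall>\<beta>\<in>\<Phi>. Q (finv w \<beta>)) \<longleftrightarrow> (\<forall>\<beta>\<in>\<Phi>. Q \<beta>)"
  using assms finv_root W_root inv_left by metis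

lemma cell_W_iff: "w \<in> W \<Longrightarrow> cell (w u) = cell (w v) \<longleftrightarrow> cell u = cell v"
  using all_roots_W[of w "\<lambda>\<beta>. sgn (\<beta> \<bullet> u) = sgn (\<beta> \<bullet> v)"]
  by (simp add: cell_eq_roots inner_adjoint)

lemma image_cell:
  assumes "w \<in> W"
  shows "w ` cell v = cell (w v)"
proof (intro equalityI subsetI)
  fix y assume "y \<in> cell (w v)"
  then have "finv w y \<in> cell v"
    using cell_W_iff[OF assms, of "finv w y" v] assms by (simp add: mem_cell_iff)
  then show "y \<in> w ` cell v"
    using inv_right[OF assms, of y] by (intro image_eqI[of y w "finv w y"]) auto
qed (use cell_W_iff[OF assms] mem_cell_iff in auto)

lemma cell_pmult_W: "w \<in> W \<Longrightarrow> cell (pmult (w u) (w v)) = cell (w (pmult u v))"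
  by (simp add: cell_eq_roots sgn_pmult inner_adjoint finv_root)

lemma image_supp:
  assumes "w \<in> W"
  shows "w ` supp p = supp (w p)"
proof -
  have *: "w q \<in> supp (w p) \<longleftrightarrow> q \<in> supp p" for q
    using all_roots_W[OF assms, of "\<lambda>\<beta>. \<beta> \<bullet> p = 0 \<longrightarrow> \<beta> \<bullet> q = 0"]
    by (simp add: mem_supp_iff inner_adjoint[OF assms])
  then have "w ` supp p \<subseteq> supp (w p)" by blast
  moreover have "y \<in> w ` supp p" if "y \<in> supp (w p)" for y
    using that *[of "finv w y"] inv_right[OF assms, of y]
    by (intro image_eqI[of y w "finv w y"]) auto
  ultimately show ?thesis by blast
qed

text \<open>Opposite roots carry opposite signs, so the images under \<open>w\<close> of the
  positive roots suffice.\<close>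

lemma cell_eq_pos:
  assumes "w \<in> W"
  shows "cell u = cell v \<longleftrightarrow> (\<forall>\<gamma>\<in>\<Phi>. pos \<gamma> \<longrightarrow> sgn (w \<gamma> \<bullet> u) = sgn (w \<gamma> \<bullet> v))"
proof
  assume "cell u = cell v"
  then show "\<forall>\<gamma>\<in>\<Phi>. pos \<gamma> \<longrightarrow> sgn (w \<gamma> \<bullet> u) = sgn (w \<gamma> \<bullet> v)"
    using W_root[OF assms] by (simp add: cell_eq_roots)
next
  assume *: "\<forall>\<gamma>\<in>\<Phi>. pos \<gamma> \<longrightarrow> sgn (w \<gamma> \<bullet> u) = sgn (w \<gamma> \<bullet> v)"
  show "cell u = cell v"
    unfolding cell_eq_roots
  proof
    fix \<beta> assume b: "\<beta> \<in> \<Phi>"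
    let ?\<gamma> = "finv w \<beta>"
    have g: "?\<gamma> \<in> \<Phi>" using finv_root[OF assms b] .
    show "sgn (\<beta> \<bullet> u) = sgn (\<beta> \<bullet> v)"
    proof (cases "pos ?\<gamma>")
      case True
      then show ?thesis using * g assms by fastforce
    next
      case False
      then have "pos (- ?\<gamma>)" "- ?\<gamma> \<in> \<Phi>" using root_neg_iff[OF g] uminus_root[OF g] by auto
      then have "sgn (w (- ?\<gamma>) \<bullet> u) = sgn (w (- ?\<gamma>) \<bullet> v)" using * by blast
      then show ?thesis
        using assms by (simp add: linear_neg[OF subgroup_linear[OF assms]] sgn_minus)
    qed
  qed
qed

section \<open>Faces as translates of faces of the fundamental chamber\<close>

lemma zeros_pt: "K \<subseteq> \<Delta> \<Longrightarrow> {\<alpha> \<in> \<Delta>. \<alpha> \<bullet> pt K = 0} = K"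
  by (auto simp: inner_pt split: if_splits)

lemma carrier_coxeter_group [simp]: "carrier (CG) = W"
  by (simp add: coxeter_group_def)

lemma mem_X_set_iff:
  assumes "K \<subseteq> \<Delta>"
  shows "w \<in> reps K \<longleftrightarrow> w \<in> W \<and> (\<forall>\<alpha>\<in>K. pos (w \<alpha>))"
proof -
  have "w \<in> W \<Longrightarrow> \<alpha> \<in> K \<Longrightarrow> pos (- w \<alpha>) \<longleftrightarrow> \<not> pos (w \<alpha>)" for \<alpha>
    using root_neg_iff[OF W_root, of w \<alpha>] assms base_subset by auto
  then show ?thesis
    using assms by (auto simp: X_set_def descents_def)
qed

lemma X_set_subset_W: "reps K \<subseteq> W"
  by (auto simp: X_set_def)

text \<open>On dominant points a positive root is nonnegative, and whether it vanishes depends only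
  on which simple roots vanish. So subsets of the base index the faces of the closed fundamental
  chamber.\<close>

lemma cell_dominant:
  assumes "dominant q"
  shows "cell q = cell (pt {\<alpha> \<in> \<Delta>. \<alpha> \<bullet> q = 0})"
proof -
  let ?K = "{\<alpha> \<in> \<Delta>. \<alpha> \<bullet> q = 0}"
  have z: "{\<alpha> \<in> \<Delta>. \<alpha> \<bullet> pt ?K = 0} = ?K" by (rule zeros_pt) auto
  have transfer: "\<gamma> \<bullet> q2 = 0" if hyp: "pos \<gamma>" "dominant q1" "\<gamma> \<bullet> q1 = 0"
    "{\<alpha> \<in> \<Delta>. \<alpha> \<bullet> q1 = 0} = {\<alpha> \<in> \<Delta>. \<alpha> \<bullet> q2 = 0}" for \<gamma> q1 q2
  proof -
    obtain c where "\<gamma> = (\<Sum>\<alpha>\<in>{\<alpha> \<in> \<Delta>. \<alpha> \<bullet> q1 = 0}. c \<alpha> *\<^sub>R \<alpha>)"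
      using pos_inner_eq_0[OF hyp(1-3)] by blast
    then show ?thesis unfolding hyp(4) by (simp add: inner_sum_left)
  qed
  have "sgn (\<gamma> \<bullet> q) = sgn (\<gamma> \<bullet> pt ?K)" if "pos \<gamma>" for \<gamma>
  proof (cases "\<gamma> \<bullet> q = 0")
    case True
    then show ?thesis using transfer[OF that assms] z by simp
  next
    case False
    then have "\<gamma> \<bullet> pt ?K \<noteq> 0" using transfer[OF that dominant_pt, of ?K q] z by auto
    then show ?thesis
      using False pos_inner_dominant[OF that assms] pos_inner_dominant[OF that dominant_pt, of ?K]
      by (simp add: sgn_if)
  qed
  then show ?thesis using cell_eq_pos[OF id_in_subgroup] by simp
qed

text \<open>A face is thus written uniquely as \<open>w F\<^sub>K\<close> with \<open>w \<in> X\<^sub>K\<close>, and \<open>w\<close> is found by letting the face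
  move the fundamental chamber.\<close>

lemma cell_mult_delta_iff:
  assumes w: "w \<in> W"
  shows "cell (pmult p \<delta>) = cell (w \<delta>) \<longleftrightarrow>
    (\<exists>K\<subseteq>\<Delta>. w \<in> reps K \<and> cell p = cell (w (pt K)))"
proof
  assume "cell (pmult p \<delta>) = cell (w \<delta>)"
  then have eq: "sgn (w \<gamma> \<bullet> pmult p \<delta>) = 1" if "\<gamma> \<in> \<Phi>" "pos \<gamma>" for \<gamma>
    using that cell_eq_pos[OF w] root_pos_iff[OF that(1)] subgroup_inner[OF w] by simp
  define q where "q = finv w p"
  have p: "p = w q" using w by (simp add: q_def)
  \<comment> \<open>The product is on the positive side of \<open>w \<gamma>\<close>: either
    \<open>p\<close> is there already, or \<open>p\<close> lies on the wall and
    \<open>\<delta>\<close> decides.\<close>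
  have alt: "(\<gamma> \<bullet> q = 0 \<and> w \<gamma> \<bullet> \<delta> > 0) \<or> \<gamma> \<bullet> q > 0" if "\<gamma> \<in> \<Phi>" "pos \<gamma>" for \<gamma>
    using eq[OF that] sgn_pmult[OF W_root[OF w that(1)], of p \<delta>]
    by (auto simp: p subgroup_inner[OF w] sgn_if split: if_splits)
  define K where "K = {\<alpha> \<in> \<Delta>. \<alpha> \<bullet> q = 0}"
  have K: "K \<subseteq> \<Delta>" by (auto simp: K_def)
  have "dominant q"
    unfolding dominant_def
  proof
    fix \<alpha> assume a: "\<alpha> \<in> \<Delta>"
    then have "\<alpha> \<in> \<Phi>" using base_subset by auto
    from alt[OF this pos_base[OF a]] show "0 \<le> \<alpha> \<bullet> q" by auto
  qed
  from cell_dominant[OF this] have "cell q = cell (pt K)" by (simp add: K_def)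
  then have "cell p = cell (w (pt K))" using cell_W_iff[OF w] p by simp
  moreover have "pos (w \<alpha>)" if "\<alpha> \<in> K" for \<alpha>
  proof -
    have a: "\<alpha> \<in> \<Delta>" "\<alpha> \<in> \<Phi>" "\<alpha> \<bullet> q = 0" using that base_subset by (auto simp: K_def)
    then show ?thesis using alt[OF a(2) pos_base[OF a(1)]] root_pos_iff[OF W_root[OF w a(2)]] by simp
  qed
  then have "w \<in> reps K" unfolding mem_X_set_iff[OF K] using w by simp
  ultimately show "\<exists>K\<subseteq>\<Delta>. w \<in> reps K \<and> cell p = cell (w (pt K))"
    using K by (intro exI[of _ K] conjI)
next
  assume "\<exists>K\<subseteq>\<Delta>. w \<in> reps K \<and> cell p = cell (w (pt K))"
  then obtain K where K: "K \<subseteq> \<Delta>" "w \<in> reps K" "cell p = cell (w (pt K))" by blast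
  have "sgn (w \<gamma> \<bullet> pmult p \<delta>) = sgn (w \<gamma> \<bullet> w \<delta>)" if g: "\<gamma> \<in> \<Phi>" "pos \<gamma>" for \<gamma>
  proof -
    have wg: "w \<gamma> \<in> \<Phi>" using W_root[OF w g(1)] .
    have d: "sgn (w \<gamma> \<bullet> w \<delta>) = 1" using g root_pos_iff by (simp add: subgroup_inner[OF w])
    have sp: "sgn (w \<gamma> \<bullet> p) = sgn (\<gamma> \<bullet> pt K)"
      using K(3) wg by (simp add: cell_eq_roots subgroup_inner[OF w])
    show ?thesis
    proof (cases "\<gamma> \<bullet> pt K = 0")
      case False
      then have "\<gamma> \<bullet> pt K > 0" using pos_inner_dominant[OF g(2) dominant_pt, of K] by simp
      then have "sgn (w \<gamma> \<bullet> p) = 1" using sp by simp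
      then show ?thesis using d sgn_pmult[OF wg, of p \<delta>] by auto
    next
      case True
      \<comment> \<open>On such a wall \<open>\<gamma>\<close> is a nonnegative combination of
        \<open>K\<close>, which \<open>w\<close> keeps positive, so \<open>w \<gamma>\<close> cannot
        be negative at \<open>\<delta>\<close>.\<close>
      obtain c where c: "\<And>\<alpha>. \<alpha> \<in> \<Delta> \<Longrightarrow> 0 \<le> c \<alpha>" "\<gamma> = (\<Sum>\<alpha>\<in>{\<alpha> \<in> \<Delta>. \<alpha> \<bullet> pt K = 0}. c \<alpha> *\<^sub>R \<alpha>)"
        using pos_inner_eq_0[OF g(2) dominant_pt True] by blast
      have g': "\<gamma> = (\<Sum>\<alpha>\<in>K. c \<alpha> *\<^sub>R \<alpha>)" using c(2) zeros_pt[OF K(1)] by simp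
      have "w \<gamma> = (\<Sum>\<alpha>\<in>K. c \<alpha> *\<^sub>R w \<alpha>)"
        unfolding g' using subgroup_linear[OF w] by (simp add: linear_sum linear_cmul)
      moreover have "c \<alpha> * (w \<alpha> \<bullet> \<delta>) \<ge> 0" if "\<alpha> \<in> K" for \<alpha>
        using that K c(1) mem_X_set_iff[OF K(1)] pos_inner_dominant[OF _ dominant_pt] by auto
      ultimately have "w \<gamma> \<bullet> \<delta> \<ge> 0" by (simp add: inner_sum_left sum_nonneg)
      moreover have "w \<gamma> \<bullet> \<delta> \<noteq> 0"
        using root_pos_iff[OF wg] root_pos_iff[OF uminus_root[OF wg]] pos_or_neg[OF wg] by auto
      moreover have "w \<gamma> \<bullet> p = 0" using sp True by (simp add: sgn_zero_iff)
      ultimately show ?thesis using d sgn_pmult[OF wg, of p \<delta>] by simp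
    qed
  qed
  then show "cell (pmult p \<delta>) = cell (w \<delta>)" using cell_eq_pos[OF w] by blast
qed

text \<open>The element \<open>finv w' \<circ> w\<close> takes \<open>pt K\<close> to a point with
  the signs of \<open>pt K'\<close>, which is again dominant; strictness of the fundamental domain
  makes it fix \<open>pt K\<close>.\<close>

lemma face_type_unique:
  assumes w: "w \<in> W" "w' \<in> W" and K: "K \<subseteq> \<Delta>" "K' \<subseteq> \<Delta>"
    and eq: "cell (w (pt K)) = cell (w' (pt K'))"
  shows "K = K'" "finv w' \<circ> w \<in> reflection_subgroup K" "finv w' (w (pt K)) = pt K"
proof -
  let ?u = "finv w' \<circ> w"
  have u: "?u \<in> W" using w by (intro comp_in_subgroup subgroup_inv)
  have c: "cell (?u (pt K)) = cell (pt K')"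
    using cell_W_iff[OF w(2), of "?u (pt K)" "pt K'"] eq w(2) by simp
  have "dominant (?u (pt K))"
    unfolding dominant_def
  proof
    fix \<alpha> assume a: "\<alpha> \<in> \<Delta>"
    then have "sgn (\<alpha> \<bullet> ?u (pt K)) = sgn (\<alpha> \<bullet> pt K')"
      using c base_subset by (auto simp: cell_eq_roots)
    then show "\<alpha> \<bullet> ?u (pt K) \<ge> 0"
      using dominant_pt[of K'] a unfolding dominant_def by (metis sgn_less not_le)
  qed
  from W_dominant_conjugate[OF u dominant_pt this, unfolded zeros_pt[OF K(1)]]
  have fix_pt: "?u (pt K) = pt K" and mem: "?u \<in> reflection_subgroup K" .
  show "finv w' \<circ> w \<in> reflection_subgroup K" by (rule mem)
  show "finv w' (w (pt K)) = pt K" using fix_pt by simp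
  have "\<alpha> \<bullet> pt K = 0 \<longleftrightarrow> \<alpha> \<bullet> pt K' = 0" if "\<alpha> \<in> \<Delta>" for \<alpha>
    using c that base_subset unfolding fix_pt cell_eq_roots by (metis sgn_zero_iff subsetD)
  then show "K = K'" using zeros_pt[OF K(1)] zeros_pt[OF K(2)] by blast
qed

text \<open>The case of empty type: the stabiliser of \<open>\<delta>\<close> is generated by no
  reflections.\<close>

lemma chamber_W_inj:
  assumes "w \<in> W" "w' \<in> W" "cell (w \<delta>) = cell (w' \<delta>)"
  shows "w = w'"
proof -
  have "finv w' \<circ> w \<in> reflection_subgroup {}"
    using face_type_unique(2)[OF assms(1,2) _ _ assms(3)] by simp
  then have "finv w' \<circ> w = id" by (simp add: reflection_subgroup_eq)
  then show ?thesis using assms(2) by (metis (no_types) comp_apply ext id_apply inv_right)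
qed

lemma ex_face_type: "\<exists>w\<in>W. \<exists>K\<subseteq>\<Delta>. cell v = cell (w (pt K))"
proof -
  obtain w where w: "w \<in> W" "dominant (w v)" using ex_dominant by blast
  let ?K = "{\<alpha> \<in> \<Delta>. \<alpha> \<bullet> w v = 0}"
  have "cell (w v) = cell (w (finv w (pt ?K)))" using cell_dominant[OF w(2)] w(1) by simp
  then have "cell v = cell (finv w (pt ?K))" using cell_W_iff[OF w(1)] by blast
  then show ?thesis using subgroup_inv[OF w(1)] by (intro bexI[of _ "finv w"] exI[of _ ?K]) auto
qed

lemma root_inner_delta: "\<beta> \<in> \<Phi> \<Longrightarrow> \<beta> \<bullet> \<delta> \<noteq> 0"
  using root_pos_iff[of \<beta>] root_pos_iff[of "- \<beta>"] pos_or_neg[of \<beta>] uminus_root[of \<beta>] by auto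

lemma zeros_W_delta: "w \<in> W \<Longrightarrow> zeros (w \<delta>) = {}"
  by (simp add: zeros_empty_iff inner_adjoint root_inner_delta finv_root)

lemma chambers_eq_W: "chambers R = (\<lambda>w. cell (w \<delta>)) ` W"
proof (intro equalityI subsetI)
  fix C assume "C \<in> chambers R"
  then obtain v where v: "C = cell v" "zeros v = {}" by (auto simp: chambers_eq)
  obtain w K where w: "w \<in> W" "K \<subseteq> \<Delta>" "cell v = cell (w (pt K))" using ex_face_type by blast
  have "K = {}"
  proof (rule ccontr)
    assume "K \<noteq> {}"
    then obtain \<alpha> where a: "\<alpha> \<in> K" by blast
    then have "w \<alpha> \<bullet> w (pt K) = 0" "w \<alpha> \<in> \<Phi>"
      using w base_subset W_root by (auto simp: subgroup_inner[OF w(1)] inner_pt subset_iff)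
    then have "w \<alpha> \<bullet> v = 0" "w \<alpha> \<in> \<Phi>" using w(3) unfolding cell_eq_roots by (auto simp: sgn_zero_iff)
    then show False using v(2) zeros_empty_iff by blast
  qed
  then show "C \<in> (\<lambda>w. cell (w \<delta>)) ` W" using v w by blast
qed (auto simp: chambers_eq zeros_W_delta)

lemma bij_betw_chambers: "bij_betw (\<lambda>w. cell (finv w \<delta>)) W (chambers R)"
  unfolding bij_betw_def
proof
  show "inj_on (\<lambda>w. cell (finv w \<delta>)) W"
    by (rule inj_onI) (metis chamber_W_inj finv_finv subgroup_inv)
  have "finv ` W = W"
    using subgroup_inv finv_finv by (metis image_eqI image_subsetI subset_antisym subsetI)
  then have "(\<lambda>w. cell (w \<delta>)) ` (finv ` W) = (\<lambda>w. cell (w \<delta>)) ` W" by simp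
  then show "(\<lambda>w. cell (finv w \<delta>)) ` W = chambers R"
    unfolding chambers_eq_W image_image .
qed

lemma cell_mult_delta: "K \<subseteq> \<Delta> \<Longrightarrow> w \<in> reps K \<Longrightarrow> cell (pmult (w (pt K)) \<delta>) = cell (w \<delta>)"
  using cell_mult_delta_iff X_set_subset_W by blast

lemma bij_betw_faces:
  "bij_betw (\<lambda>(K, w). cell (w (pt K))) (SIGMA K:Pow \<Delta>. reps K) (faces R)"
  unfolding bij_betw_def
proof
  show "inj_on (\<lambda>(K, w). cell (w (pt K))) (SIGMA K:Pow \<Delta>. reps K)"
  proof (rule inj_onI, clarify)
    fix K w K' w'
    assume a: "K \<subseteq> \<Delta>" "w \<in> reps K" "K' \<subseteq> \<Delta>" "w' \<in> reps K'"
      and eq: "cell (w (pt K)) = cell (w' (pt K'))"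
    have W: "w \<in> W" "w' \<in> W" using a X_set_subset_W by auto
    have "cell (pmult (w (pt K)) \<delta>) = cell (w' \<delta>)"
      using cell_mult_delta_iff[OF W(2)] a eq by blast
    then have "w = w'" using cell_mult_delta[OF a(1,2)] chamber_W_inj[OF W] by simp
    then show "K = K' \<and> w = w'" using face_type_unique(1)[OF W a(1,3) eq] by simp
  qed
  show "(\<lambda>(K, w). cell (w (pt K))) ` (SIGMA K:Pow \<Delta>. reps K) = faces R"
  proof (intro equalityI subsetI)
    fix F assume "F \<in> faces R"
    then obtain p where p: "F = cell p" by (auto simp: faces_eq)
    have "zeros (pmult p \<delta>) = {}"
      using zeros_W_delta[OF id_in_subgroup] by (auto simp: zeros_alt sg_mult)
    then have "cell (pmult p \<delta>) \<in> chambers R" by (auto simp: chambers_eq)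
    then obtain w where w: "w \<in> W" "cell (pmult p \<delta>) = cell (w \<delta>)" by (auto simp: chambers_eq_W)
    from iffD1[OF cell_mult_delta_iff[OF w(1)] w(2)]
    obtain K where "K \<subseteq> \<Delta>" "w \<in> reps K" "cell p = cell (w (pt K))" by (elim exE conjE)
    then show "F \<in> (\<lambda>(K, w). cell (w (pt K))) ` (SIGMA K:Pow \<Delta>. reps K)"
      unfolding p by (intro image_eqI[of _ _ "(K, w)"]) auto
  qed (auto simp: faces_eq)
qed

section \<open>The type of a face and the face walk on the group\<close>

definition face_type :: "'a set \<Rightarrow> 'a set" where
  "face_type F = (SOME K. K \<subseteq> \<Delta> \<and> (\<exists>w\<in>W. F = cell (w (pt K))))"

lemma face_type_cell:
  assumes "w \<in> W" "K \<subseteq> \<Delta>"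
  shows "face_type (cell (w (pt K))) = K"
proof -
  have "\<exists>K'. K' \<subseteq> \<Delta> \<and> (\<exists>w'\<in>W. cell (w (pt K)) = cell (w' (pt K')))" using assms by blast
  from someI_ex[OF this, folded face_type_def] obtain w' where w': "w' \<in> W"
    "face_type (cell (w (pt K))) \<subseteq> \<Delta>" "cell (w (pt K)) = cell (w' (pt (face_type (cell (w (pt K))))))"
    by blast
  from face_type_unique(1)[OF assms(1) w'(1) assms(2) w'(2,3)] show ?thesis by (rule sym)
qed

lemma bij_betw_image_faces:
  assumes "u \<in> W"
  shows "bij_betw ((`) u) (faces R) (faces R)"
  unfolding bij_betw_def
proof
  show "inj_on ((`) u) (faces R)"
    using inj_on_image[OF inj_on_subset[OF subgroup_inj[OF assms] subset_UNIV]] .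
  have "cell v \<in> (`) u ` range cell" for v
    using image_cell[OF assms, of "finv u v"] inv_right[OF assms, of v]
    by (intro image_eqI[of _ _ "cell (finv u v)"]) auto
  then show "(`) u ` faces R = faces R"
    unfolding faces_eq using image_cell[OF assms] by auto
qed

text \<open>The group element \<open>u\<close> stands for the chamber \<open>u\<inverse> C\<^sub>0\<close>; with this choice, left multiplication
  becomes the face walk.\<close>

lemma descent_element_face_kernel:
  assumes u: "u \<in> W" and u': "u' \<in> W"
  shows "face_kernel R (\<lambda>F. a (face_type F)) (cell (finv u \<delta>)) (cell (finv u' \<delta>)) =
    (\<Sum>K\<in>Pow \<Delta>. if u \<circ> finv u' \<in> reps K then a K else 0)"
proof -
  let ?S = "SIGMA K:Pow \<Delta>. reps K"
  let ?w = "u \<circ> finv u'" and ?f = "\<lambda>(K, w). cell (finv u (w (pt K)))"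
  have fu: "finv u \<in> W" using subgroup_inv[OF u] .
  have w: "?w \<in> W" using u u' by (intro comp_in_subgroup subgroup_inv)
  have finX: "finite (reps K)" for K using finite_subset[OF X_set_subset_W finite_W] .
  \<comment> \<open>Enumerating the faces as translates by \<open>finv u\<close> reduces the action
    on the chamber of \<open>u\<close> to the action on the fundamental chamber.\<close>
  have "bij_betw ((`) (finv u) \<circ> (\<lambda>(K, w). cell (w (pt K)))) ?S (faces R)"
    using bij_betw_trans[OF bij_betw_faces bij_betw_image_faces[OF fu]] .
  moreover have "(`) (finv u) \<circ> (\<lambda>(K, w). cell (w (pt K))) = ?f"
    by (auto simp: image_cell[OF fu])
  ultimately have bij: "bij_betw ?f ?S (faces R)" by simp
  have summand: "(if fmul (cell (finv u (w (pt K)))) (cell (finv u \<delta>)) = cell (finv u' \<delta>)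
        then a (face_type (cell (finv u (w (pt K))))) else 0) = (if w = ?w then a K else 0)"
    if K: "K \<subseteq> \<Delta>" and wX: "w \<in> reps K" for K w
  proof -
    have wW: "w \<in> W" using wX X_set_subset_W by auto
    have "fmul (cell (finv u (w (pt K)))) (cell (finv u \<delta>)) = cell (finv u (pmult (w (pt K)) \<delta>))"
      by (simp add: fmul_cell cell_pmult_W[OF fu])
    also have "\<dots> = cell (finv u (w \<delta>))"
      using cell_mult_delta[OF K wX] cell_W_iff[OF fu] by simp
    finally have "fmul (cell (finv u (w (pt K)))) (cell (finv u \<delta>)) = cell (finv u' \<delta>) \<longleftrightarrow>
        cell (finv u (w \<delta>)) = cell (finv u' \<delta>)" by simp
    also have "\<dots> \<longleftrightarrow> cell (w \<delta>) = cell (?w \<delta>)"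
      using cell_W_iff[OF u, of "finv u (w \<delta>)" "finv u' \<delta>"] u by simp
    also have "\<dots> \<longleftrightarrow> w = ?w" using chamber_W_inj[OF wW w] by blast
    finally have "fmul (cell (finv u (w (pt K)))) (cell (finv u \<delta>)) = cell (finv u' \<delta>) \<longleftrightarrow> w = ?w" .
    moreover have "face_type (cell (finv u (w (pt K)))) = K"
      using face_type_cell[OF comp_in_subgroup[OF fu wW] K] by simp
    ultimately show ?thesis by (simp only:)
  qed
  have "face_kernel R (\<lambda>F. a (face_type F)) (cell (finv u \<delta>)) (cell (finv u' \<delta>)) =
      (\<Sum>F\<in>faces R. if fmul F (cell (finv u \<delta>)) = cell (finv u' \<delta>) then a (face_type F) else 0)"
    using fu by (intro face_kernel_fmul) (auto simp: chambers_eq_W)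
  also have "\<dots> = (\<Sum>(K, w)\<in>?S. if w = ?w then a K else 0)"
    by (subst sum.reindex_bij_betw[OF bij, symmetric]) (auto simp: summand split: prod.splits intro!: sum.cong)
  also have "\<dots> = (\<Sum>K\<in>Pow \<Delta>. \<Sum>w\<in>reps K. if w = ?w then a K else 0)"
    using finite_base finX by (intro sum.Sigma[symmetric]) auto
  also have "\<dots> = (\<Sum>K\<in>Pow \<Delta>. if ?w \<in> reps K then a K else 0)"
    using finX by (intro sum.cong refl) (simp add: sum.delta)
  finally show ?thesis .
qed

end

text \<open>Elimination along inclusion produces a left inverse whose rows are supported on subsets.
  It is also a right inverse, and this makes the description in \<open>kernel_inverse\<close>
  unique.\<close>

lemma triangular_kernel_inverse:
  fixes M :: "'b set \<Rightarrow> 'b set \<Rightarrow> real"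
  assumes S: "finite S" and diag: "\<And>J. J \<in> S \<Longrightarrow> M J J \<noteq> 0" and fin: "\<And>J. J \<in> S \<Longrightarrow> finite J"
    and tri: "\<And>J K. J \<in> S \<Longrightarrow> K \<in> S \<Longrightarrow> \<not> K \<subseteq> J \<Longrightarrow> M J K = 0"
  shows "\<And>i j. i \<in> S \<Longrightarrow> j \<in> S \<Longrightarrow>
      (\<Sum>k\<in>S. kernel_inverse S M i k * M k j) = (if i = j then 1 else 0)"
    and "\<And>i j. i \<in> S \<Longrightarrow> \<not> j \<subseteq> i \<Longrightarrow> kernel_inverse S M i j = 0"
proof -
  have "\<exists>r. (\<forall>K\<in>S. (\<Sum>I\<in>S. r I * M I K) = (if J = K then 1 else 0)) \<and>
      (\<forall>I. \<not> (I \<in> S \<and> I \<subseteq> J) \<longrightarrow> r I = 0)" if "J \<in> S" for J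
    using fin[OF that] that
  proof (induction J rule: finite_psubset_induct)
    case (psubset J)
    define B where "B = {I \<in> S. I \<subset> J}"
    have finB: "finite B" using S by (simp add: B_def)
    have "\<forall>I\<in>B. \<exists>r. (\<forall>K\<in>S. (\<Sum>L\<in>S. r L * M L K) = (if I = K then 1 else 0)) \<and>
        (\<forall>L. \<not> (L \<in> S \<and> L \<subseteq> I) \<longrightarrow> r L = 0)"
      using psubset.IH by (simp add: B_def)
    then obtain r where r: "\<forall>I\<in>B. (\<forall>K\<in>S. (\<Sum>L\<in>S. r I L * M L K) = (if I = K then 1 else 0)) \<and>
        (\<forall>L. \<not> (L \<in> S \<and> L \<subseteq> I) \<longrightarrow> r I L = 0)"
      by metis
    \<comment> \<open>From row \<open>J\<close> of the matrix the unit rows of the proper subsets,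
      already expressed by rows, are subtracted; division by the diagonal entry leaves the unit row
      of \<open>J\<close>.\<close>
    define q where "q L = ((if L = J then 1 else 0) - (\<Sum>I\<in>B. M J I * r I L)) / M J J" for L
    have "(\<Sum>L\<in>S. q L * M L K) = (if J = K then 1 else 0)" if K: "K \<in> S" for K
    proof -
      have "(\<Sum>L\<in>S. q L * M L K) * M J J =
          (\<Sum>L\<in>S. (if L = J then 1 else 0) * M L K - (\<Sum>I\<in>B. M J I * (r I L * M L K)))"
        using diag[OF psubset.prems]
        by (simp add: q_def sum_distrib_right left_diff_distrib mult.assoc divide_inverse
            mult.commute[of "inverse _"] cong: sum.cong)
      also have "\<dots> = M J K - (\<Sum>I\<in>B. M J I * (\<Sum>L\<in>S. r I L * M L K))"
      proof -
        have "(\<Sum>L\<in>S. (if L = J then 1 else 0) * M L K) = M J K"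
          using S psubset.prems sum.delta[OF S, of J "\<lambda>L. M L K"]
          by (simp add: if_distrib[of "\<lambda>a. a * _"] cong: if_cong)
        then show ?thesis
          by (simp add: sum_subtractf sum_distrib_left sum.swap[of _ B S])
      qed
      also have "(\<Sum>I\<in>B. M J I * (\<Sum>L\<in>S. r I L * M L K)) = (\<Sum>I\<in>B. if I = K then M J I else 0)"
        using r K by (intro sum.cong) auto
      also have "\<dots> = (if K \<in> B then M J K else 0)"
        using finB by simp
      also have "M J K - \<dots> = (if J = K then M J J else 0)"
        using tri[OF psubset.prems K] K by (auto simp: B_def)
      finally show ?thesis
        using diag[OF psubset.prems] by (auto split: if_splits)
    qed
    moreover have "q L = 0" if "\<not> (L \<in> S \<and> L \<subseteq> J)" for L
    proof -
      have "r I L = 0" if I: "I \<in> B" for I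
      proof -
        have "\<not> (L \<in> S \<and> L \<subseteq> I)" using I \<open>\<not> (L \<in> S \<and> L \<subseteq> J)\<close> unfolding B_def by blast
        then show ?thesis using r I by simp
      qed
      then show ?thesis using that psubset.prems by (auto simp: q_def)
    qed
    ultimately show ?case by blast
  qed
  then have "\<forall>J\<in>S. \<exists>r. (\<forall>K\<in>S. (\<Sum>I\<in>S. r I * M I K) = (if J = K then 1 else 0)) \<and>
      (\<forall>I. \<not> (I \<in> S \<and> I \<subseteq> J) \<longrightarrow> r I = 0)"
    by blast
  then obtain N0 where N0: "\<And>J K. J \<in> S \<Longrightarrow> K \<in> S \<Longrightarrow> (\<Sum>I\<in>S. N0 J I * M I K) = (if J = K then 1 else 0)"
    "\<And>J I. J \<in> S \<Longrightarrow> \<not> (I \<in> S \<and> I \<subseteq> J) \<Longrightarrow> N0 J I = 0"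
    by metis
  define N where "N J I = (if J \<in> S then N0 J I else 0)" for J I
  have left: "(\<Sum>k\<in>S. N i k * M k j) = (if i = j then 1 else 0)" if "i \<in> S" "j \<in> S" for i j
    using N0(1)[OF that] that by (simp add: N_def)
  have right: "(\<Sum>k\<in>S. M i k * N k j) = (if i = j then 1 else 0)" if "i \<in> S" "j \<in> S" for i j
    using kernel_left_inverse_imp_right_inverse[OF S left that] .
  have zero: "N i j = 0" if "\<not> (i \<in> S \<and> j \<in> S)" for i j
    using N0(2) that by (auto simp: N_def)
  have "kernel_inverse S M = N"
    unfolding kernel_inverse_def
  proof (rule the_equality)
    show "(\<forall>i j. \<not> (i \<in> S \<and> j \<in> S) \<longrightarrow> N i j = 0) \<and>
     (\<forall>i\<in>S. \<forall>j\<in>S. (\<Sum>k\<in>S. M i k * N k j) = (if i = j then 1 else 0)) \<and>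
     (\<forall>i\<in>S. \<forall>j\<in>S. (\<Sum>k\<in>S. N i k * M k j) = (if i = j then 1 else 0))"
      using left right zero by blast
  next
    fix N' assume N': "(\<forall>i j. \<not> (i \<in> S \<and> j \<in> S) \<longrightarrow> N' i j = 0) \<and>
     (\<forall>i\<in>S. \<forall>j\<in>S. (\<Sum>k\<in>S. M i k * N' k j) = (if i = j then 1 else 0)) \<and>
     (\<forall>i\<in>S. \<forall>j\<in>S. (\<Sum>k\<in>S. N' i k * M k j) = (if i = j then 1 else 0))"
    show "N' = N"
    proof (intro ext)
      fix i j
      show "N' i j = N i j"
      proof (cases "i \<in> S \<and> j \<in> S")
        case True
        \<comment> \<open>The usual comparison of a left with a right inverse:
          \<open>N' = (N M) N' = N (M N') = N\<close>.\<close>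
        have "N' i j = (\<Sum>k\<in>S. (if i = k then 1 else 0) * N' k j)"
          using S True sum.delta[OF S, of i "\<lambda>k. N' k j"]
          by (simp add: if_distrib[of "\<lambda>a. a * _"] eq_commute[of i] cong: if_cong)
        also have "\<dots> = (\<Sum>k\<in>S. (\<Sum>l\<in>S. N i l * M l k) * N' k j)"
          using left True by (intro sum.cong) auto
        also have "\<dots> = (\<Sum>l\<in>S. N i l * (\<Sum>k\<in>S. M l k * N' k j))"
          by (simp add: sum_distrib_left sum_distrib_right mult.assoc) (rule sum.swap)
        also have "\<dots> = (\<Sum>l\<in>S. N i l * (if l = j then 1 else 0))"
          using N' True by (intro sum.cong) auto
        also have "\<dots> = N i j"
          using S True by (simp add: if_distrib cong: if_cong)
        finally show ?thesis .
      qed (use N' zero in auto)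
    qed
  qed
  then show "\<And>i j. i \<in> S \<Longrightarrow> j \<in> S \<Longrightarrow>
      (\<Sum>k\<in>S. kernel_inverse S M i k * M k j) = (if i = j then 1 else 0)"
    and "\<And>i j. i \<in> S \<Longrightarrow> \<not> j \<subseteq> i \<Longrightarrow> kernel_inverse S M i j = 0"
    using left N0(2) by (auto simp: N_def)
qed

section \<open>Elements of the descent algebra\<close>

context based_root_system
begin

text \<open>A root vanishing at \<open>pt J\<close> is up to sign a combination of \<open>J\<close>,
  so the hyperplanes of \<open>J\<close> alone cut out the flat.\<close>

lemma mem_supp_pt:
  assumes "J \<subseteq> \<Delta>"
  shows "q \<in> supp (pt J) \<longleftrightarrow> (\<forall>\<alpha>\<in>J. \<alpha> \<bullet> q = 0)"
proof
  assume "q \<in> supp (pt J)"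
  then show "\<forall>\<alpha>\<in>J. \<alpha> \<bullet> q = 0"
    using assms base_subset by (auto simp: mem_supp_iff inner_pt subset_iff)
next
  assume q: "\<forall>\<alpha>\<in>J. \<alpha> \<bullet> q = 0"
  have pos_case: "\<beta> \<bullet> q = 0" if \<beta>: "pos \<beta>" "\<beta> \<bullet> pt J = 0" for \<beta>
  proof -
    obtain c where "\<beta> = (\<Sum>\<alpha>\<in>{\<alpha> \<in> \<Delta>. \<alpha> \<bullet> pt J = 0}. c \<alpha> *\<^sub>R \<alpha>)"
      using pos_inner_eq_0[OF \<beta>(1) dominant_pt \<beta>(2)] by blast
    then show ?thesis unfolding zeros_pt[OF assms] using q by (simp add: inner_sum_left)
  qed
  have "\<beta> \<bullet> q = 0" if "\<beta> \<in> \<Phi>" "\<beta> \<bullet> pt J = 0" for \<beta>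
    using pos_or_neg[OF that(1)] pos_case[of \<beta>] pos_case[of "- \<beta>"] that(2) by auto
  then show "q \<in> supp (pt J)" by (simp add: mem_supp_iff)
qed

text \<open>If \<open>finv w \<alpha>\<close> vanishes at \<open>pt K\<close>, it is up to sign a
  nonnegative combination of \<open>K\<close>, and positive because \<open>w\<close> keeps
  \<open>K\<close> positive. Applying \<open>w\<close> writes the simple root
  \<open>\<alpha>\<close> as a nonnegative combination of positive roots; testing on
  \<open>pt {\<alpha>}\<close>, one of these must be \<open>\<alpha>\<close> itself.\<close>

lemma inner_X_set_pt_eq_0_iff:
  assumes K: "K \<subseteq> \<Delta>" and w: "w \<in> reps K" and a: "\<alpha> \<in> \<Delta>"
  shows "\<alpha> \<bullet> w (pt K) = 0 \<longleftrightarrow> finv w \<alpha> \<in> K"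
proof
  have wW: "w \<in> W" and wpos: "\<And>\<kappa>. \<kappa> \<in> K \<Longrightarrow> pos (w \<kappa>)"
    using w mem_X_set_iff[OF K] by auto
  let ?\<gamma> = "finv w \<alpha>"
  have g: "?\<gamma> \<in> \<Phi>" using finv_root[OF wW] a base_subset by auto
  have adj: "\<alpha> \<bullet> w (pt K) = ?\<gamma> \<bullet> pt K" by (rule inner_adjoint[OF wW])
  show "\<alpha> \<bullet> w (pt K) = 0" if "?\<gamma> \<in> K"
    unfolding adj using that K inner_pt[of ?\<gamma> K] by auto
  assume "\<alpha> \<bullet> w (pt K) = 0"
  then have g0: "?\<gamma> \<bullet> pt K = 0" by (simp add: adj)
  have expand: "\<exists>c. (\<forall>\<kappa>\<in>K. 0 \<le> c \<kappa>) \<and> w \<gamma> = (\<Sum>\<kappa>\<in>K. c \<kappa> *\<^sub>R w \<kappa>) \<and> \<gamma> = (\<Sum>\<kappa>\<in>K. c \<kappa> *\<^sub>R \<kappa>)"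
    if \<gamma>: "pos \<gamma>" "\<gamma> \<bullet> pt K = 0" for \<gamma>
  proof -
    obtain c where c: "\<And>\<alpha>. \<alpha> \<in> \<Delta> \<Longrightarrow> 0 \<le> c \<alpha>" "\<gamma> = (\<Sum>\<alpha>\<in>{\<alpha> \<in> \<Delta>. \<alpha> \<bullet> pt K = 0}. c \<alpha> *\<^sub>R \<alpha>)"
      using pos_inner_eq_0[OF \<gamma>(1) dominant_pt \<gamma>(2)] by blast
    then have g': "\<gamma> = (\<Sum>\<kappa>\<in>K. c \<kappa> *\<^sub>R \<kappa>)" unfolding zeros_pt[OF K] by simp
    then have "w \<gamma> = (\<Sum>\<kappa>\<in>K. c \<kappa> *\<^sub>R w \<kappa>)"
      using subgroup_linear[OF wW] by (simp add: linear_sum linear_cmul)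
    then show ?thesis using g' c(1) K by (intro exI[of _ c]) auto
  qed
  have "pos ?\<gamma>"
  proof (rule ccontr)
    assume "\<not> pos ?\<gamma>"
    then have "pos (- ?\<gamma>)" using root_neg_iff[OF g] by simp
    then obtain c where c: "\<forall>\<kappa>\<in>K. 0 \<le> c \<kappa>" "w (- ?\<gamma>) = (\<Sum>\<kappa>\<in>K. c \<kappa> *\<^sub>R w \<kappa>)"
      using expand[of "- ?\<gamma>"] g0 by auto
    have "w (- ?\<gamma>) \<bullet> \<delta> \<ge> 0"
      unfolding c(2) inner_sum_left
      using c(1) wpos pos_inner_dominant[OF _ dominant_pt] by (intro sum_nonneg) simp
    moreover have "w (- ?\<gamma>) = - \<alpha>"
      using linear_neg[OF subgroup_linear[OF wW]] wW by simp
    ultimately show False using inner_delta_pos[OF a] by simp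
  qed
  then obtain c where c: "\<forall>\<kappa>\<in>K. 0 \<le> c \<kappa>" "w ?\<gamma> = (\<Sum>\<kappa>\<in>K. c \<kappa> *\<^sub>R w \<kappa>)" "?\<gamma> = (\<Sum>\<kappa>\<in>K. c \<kappa> *\<^sub>R \<kappa>)"
    using expand g0 by blast
  have wa: "w ?\<gamma> = \<alpha>" using wW by simp
  have finK: "finite K" using K finite_base finite_subset by blast
  have nn: "c \<kappa> * (w \<kappa> \<bullet> pt {\<alpha>}) \<ge> 0" if "\<kappa> \<in> K" for \<kappa>
    using c(1) wpos[OF that] pos_inner_dominant[OF _ dominant_pt] that by auto
  have "(\<Sum>\<kappa>\<in>K. c \<kappa> * (w \<kappa> \<bullet> pt {\<alpha>})) = w ?\<gamma> \<bullet> pt {\<alpha>}"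
    unfolding c(2) by (simp add: inner_sum_left)
  then have "(\<Sum>\<kappa>\<in>K. c \<kappa> * (w \<kappa> \<bullet> pt {\<alpha>})) = 0"
    using inner_pt[OF a, of "{\<alpha>}"] by (simp add: wa)
  then have z: "\<forall>\<kappa>\<in>K. c \<kappa> * (w \<kappa> \<bullet> pt {\<alpha>}) = 0"
    using sum_nonneg_eq_0_iff[OF finK, of "\<lambda>\<kappa>. c \<kappa> * (w \<kappa> \<bullet> pt {\<alpha>})"] nn by simp
  have "\<exists>\<kappa>\<in>K. c \<kappa> \<noteq> 0"
  proof (rule ccontr)
    assume "\<not> ?thesis"
    then have "?\<gamma> = 0" by (subst c(3)) simp
    then show False using g zero_notin by simp
  qed
  then obtain \<kappa> where k: "\<kappa> \<in> K" "c \<kappa> \<noteq> 0" by blast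
  then have "w \<kappa> \<bullet> pt {\<alpha>} = 0" using z by auto
  moreover have "w \<kappa> \<in> \<Phi>" using W_root[OF wW] k(1) K base_subset by auto
  ultimately have "w \<kappa> = \<alpha>" using pos_root_eq_simple[OF _ wpos[OF k(1)] a] by blast
  then have "?\<gamma> = \<kappa>" using inv_left[OF wW, of \<kappa>] by simp
  then show "?\<gamma> \<in> K" using k(1) by simp
qed

lemma flat_dim_image:
  assumes "w \<in> W"
  shows "flat_dim (w ` X) = flat_dim X"
  using subgroup_linear[OF assms] subgroup_inj[OF assms] by (simp add: flat_dim_def)

lemma flat_dim_supp_pt:
  assumes J: "J \<subseteq> \<Delta>"
  shows "flat_dim (supp (pt J)) + card J = DIM('a)"
proof -
  have ind: "independent J" using base_independent J independent_mono by blast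
  have "supp (pt J) = {y \<in> UNIV. \<forall>x\<in>span J. orthogonal x y}"
  proof (intro equalityI subsetI)
    fix y assume "y \<in> supp (pt J)"
    then have "\<forall>\<alpha>\<in>J. orthogonal y \<alpha>" by (simp add: mem_supp_pt[OF J] real_inner_class.orthogonal_def inner_commute)
    then show "y \<in> {y \<in> UNIV. \<forall>x\<in>span J. orthogonal x y}"
      using orthogonal_to_span[of _ J y] by (auto simp: orthogonal_commute)
  qed (auto simp: mem_supp_pt[OF J] real_inner_class.orthogonal_def span_base)
  moreover have "dim {y \<in> UNIV. \<forall>x\<in>span J. orthogonal x y} + dim (span J) = dim (UNIV :: 'a set)"
    by (rule dim_subspace_orthogonal_to_vectors) auto
  ultimately show ?thesis
    using ind subspace_orthogonal_to_vectors[of "span J"] by (simp add: flat_dim_def aff_dim_subspace dim_eq_card_independent)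
qed

lemma flat_representation:
  assumes "Y \<in> flats R"
  obtains u J where "u \<in> W" "J \<subseteq> \<Delta>" "Y = supp (u (pt J))"
proof -
  obtain p where p: "supp p = Y" using ex_generic_point[OF assms] by blast
  obtain u J where "u \<in> W" "J \<subseteq> \<Delta>" "cell p = cell (u (pt J))" using ex_face_type[of p] by blast
  then show thesis using that p supp_cell by blast
qed

lemma flat_dim_supp_W:
  assumes "u \<in> W" "J \<subseteq> \<Delta>"
  shows "DIM('a) - flat_dim (supp (u (pt J))) = card J"
  using flat_dim_supp_pt[OF assms(2)] flat_dim_image[OF assms(1), of "supp (pt J)"]
  by (simp add: image_supp[OF assms(1)])

lemma cell_subset_supp_iff:
  assumes "u \<in> W"
  shows "cell p \<subseteq> supp (u q) \<longleftrightarrow> finv u p \<in> supp q"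
proof -
  have "cell p \<subseteq> supp (u q) \<longleftrightarrow> p \<in> u ` supp q"
    using flat_mem_iff_cell[OF supp_flat] image_supp[OF assms] by simp
  also have "\<dots> \<longleftrightarrow> finv u p \<in> supp q"
    using inv_left[OF assms] inv_right[OF assms, of p] by (auto intro: image_eqI[of p u "finv u p"])
  finally show ?thesis .
qed

text \<open>Translation by \<open>finv u\<close> moves the flat to \<open>supp (pt J)\<close>
  without changing types. The face of \<open>w (pt K)\<close> lies there iff all roots of
  \<open>J\<close> vanish on it.\<close>

lemma card_faces_of_type_below:
  assumes u: "u \<in> W" and K: "K \<subseteq> \<Delta>" and J: "J \<subseteq> \<Delta>"
  shows "card {F \<in> faces R. face_type F = K \<and> F \<subseteq> supp (u (pt J))} =
    card {w \<in> reps K. finv w ` J \<subseteq> K}"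
proof -
  let ?f = "\<lambda>w. cell (u (w (pt K)))"
  have below: "w (pt K) \<in> supp (pt J) \<longleftrightarrow> finv w ` J \<subseteq> K" if "w \<in> reps K" for w
    using inner_X_set_pt_eq_0_iff[OF K that] J by (auto simp: mem_supp_pt[OF J])
  have sub: "?f w \<subseteq> supp (u (pt J)) \<longleftrightarrow> w (pt K) \<in> supp (pt J)" for w
    using cell_subset_supp_iff[OF u, of "u (w (pt K))" "pt J"] u by simp
  have "{F \<in> faces R. face_type F = K \<and> F \<subseteq> supp (u (pt J))} =
      ?f ` {w \<in> reps K. finv w ` J \<subseteq> K}"
  proof (intro equalityI subsetI)
    fix F assume F: "F \<in> {F \<in> faces R. face_type F = K \<and> F \<subseteq> supp (u (pt J))}"
    have "finv u ` F \<in> faces R"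
      using F bij_betw_image_faces[OF subgroup_inv[OF u]] by (auto simp: bij_betw_def)
    then have "finv u ` F \<in> (\<lambda>(K, w). cell (w (pt K))) ` (SIGMA K:Pow \<Delta>. reps K)"
      using bij_betw_imp_surj_on[OF bij_betw_faces] by simp
    then obtain K' w where w: "K' \<subseteq> \<Delta>" "w \<in> reps K'" "finv u ` F = cell (w (pt K'))"
      by auto
    have "F = u ` (finv u ` F)" using u by (simp add: image_image)
    then have Fc: "F = cell (u (w (pt K')))" using w(3) image_cell[OF u] by simp
    have "u \<circ> w \<in> W" using u w(2) X_set_subset_W by (intro comp_in_subgroup) auto
    from face_type_cell[OF this w(1)] have "K' = K" using F Fc by simp
    then have "w \<in> {w \<in> reps K. finv w ` J \<subseteq> K}"
      using w F Fc sub below by auto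
    then show "F \<in> ?f ` {w \<in> reps K. finv w ` J \<subseteq> K}"
      using Fc \<open>K' = K\<close> by blast
  next
    fix F assume "F \<in> ?f ` {w \<in> reps K. finv w ` J \<subseteq> K}"
    then obtain w where w: "w \<in> reps K" "finv w ` J \<subseteq> K" "F = ?f w" by auto
    have "u \<circ> w \<in> W" using u w X_set_subset_W by (intro comp_in_subgroup) auto
    from face_type_cell[OF this K] have "face_type F = K" using w by simp
    then show "F \<in> {F \<in> faces R. face_type F = K \<and> F \<subseteq> supp (u (pt J))}"
      using w sub below by (auto simp: faces_eq)
  qed
  moreover have "inj_on ?f {w \<in> reps K. finv w ` J \<subseteq> K}"
  proof (rule inj_onI)
    fix w w' assume w: "w \<in> {w \<in> reps K. finv w ` J \<subseteq> K}" "w' \<in> {w \<in> reps K. finv w ` J \<subseteq> K}"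
      and "?f w = ?f w'"
    then have "cell (w (pt K)) = cell (w' (pt K))" using cell_W_iff[OF u] by blast
    then have "(K, w) = (K, w')"
      using inj_onD[OF bij_betw_imp_inj_on[OF bij_betw_faces], of "(K, w)" "(K, w')"] w K by simp
    then show "w = w'" by simp
  qed
  ultimately show ?thesis by (simp add: card_image)
qed

lemma weight_below_face_type:
  "weight_below (\<lambda>F. a (face_type F)) Y =
    (\<Sum>K\<in>Pow \<Delta>. a K * real (card {F \<in> faces R. face_type F = K \<and> F \<subseteq> Y}))"
proof -
  let ?S = "{F \<in> faces R. F \<subseteq> Y}"
  have type_sub: "face_type F \<subseteq> \<Delta>" if F: "F \<in> faces R" for F
  proof -
    obtain v where "F = cell v" using F by (auto simp: faces_eq)
    moreover obtain w K where "w \<in> W" "K \<subseteq> \<Delta>" "cell v = cell (w (pt K))" using ex_face_type by blast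
    ultimately show ?thesis using face_type_cell by simp
  qed
  have "weight_below (\<lambda>F. a (face_type F)) Y = (\<Sum>K\<in>Pow \<Delta>. \<Sum>F\<in>{F \<in> ?S. face_type F = K}. a (face_type F))"
    unfolding weight_below_def using finite_faces finite_base type_sub by (intro sum.group[symmetric]) auto
  also have "\<dots> = (\<Sum>K\<in>Pow \<Delta>. a K * real (card {F \<in> ?S. face_type F = K}))"
    by (intro sum.cong) (auto simp: mult.commute)
  finally show ?thesis by (simp add: conj_ac cong: conj_cong)
qed

section \<open>Left multiplication on the group algebra\<close>

lemma mult_coxeter_group: "u \<in> W \<Longrightarrow> v \<in> W \<Longrightarrow> u \<otimes>\<^bsub>CG\<^esub> v = u \<circ> v"
proof -
  have "W \<subseteq> carrier (BijGroup UNIV)" using rprod_in_BijGroup by (auto simp: reflection_subgroup_eq)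
  then show "u \<in> W \<Longrightarrow> v \<in> W \<Longrightarrow> ?thesis"
    using BijGroup_mult[of u v] by (auto simp: coxeter_group_def)
qed

lemma group_coxeter_group: "group (CG)"
proof -
  interpret G: group "BijGroup (UNIV :: 'a set)" by (rule group_BijGroup)
  have "subgroup W (BijGroup UNIV)"
    unfolding reflection_subgroup_def
    using reflection_in_BijGroup by (intro G.generate_is_subgroup) auto
  from subgroup.subgroup_is_group[OF this G.is_group] show ?thesis
    by (simp add: coxeter_group_def)
qed

lemma one_coxeter_group: "\<one>\<^bsub>CG\<^esub> = id"
  by (simp add: coxeter_group_def BijGroup_one)

lemma inv_coxeter_group:
  assumes "w \<in> W"
  shows "inv\<^bsub>CG\<^esub> w = finv w"
proof (rule group.inv_equality[OF group_coxeter_group])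
  show "finv w \<otimes>\<^bsub>CG\<^esub> w = \<one>\<^bsub>CG\<^esub>"
    using assms by (simp add: mult_coxeter_group subgroup_inv one_coxeter_group fun_eq_iff)
qed (use assms subgroup_inv in auto)

lemma left_mult_kernel_coxeter:
  "u \<in> W \<Longrightarrow> v \<in> W \<Longrightarrow> left_mult_kernel (CG) a u v = a (u \<circ> finv v)"
  by (simp add: left_mult_kernel_def inv_coxeter_group mult_coxeter_group subgroup_inv)

text \<open>Only total weights on flats survive in the result, so two combinations of the
  \<open>x_elt\<close> with equal totals have equal spectra.\<close>

theorem kernel_char_poly_descent_element:
  assumes a: "\<And>w. w \<in> W \<Longrightarrow> a w = (\<Sum>K\<in>Pow \<Delta>. if w \<in> reps K then c K else 0)"
    and wt: "\<And>Y. Y \<in> flats R \<Longrightarrow> weight_below (\<lambda>F. c (face_type F)) Y = l Y"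
  shows "kernel_char_poly W (left_mult_kernel (CG) a) =
    (\<Prod>Y\<in>flats R. [:- l Y, 1:] ^ nat \<bar>moebius (flats R) UNIV Y\<bar>)"
proof -
  have "left_mult_kernel (CG) a u v =
      face_kernel R (\<lambda>F. c (face_type F)) (cell (finv u \<delta>)) (cell (finv v \<delta>))"
    if "u \<in> W" "v \<in> W" for u v
    using that a[of "u \<circ> finv v"] descent_element_face_kernel[OF that, of c]
    by (simp only: left_mult_kernel_coxeter comp_in_subgroup subgroup_inv)
  from kernel_char_poly_face_kernel[OF bij_betw_chambers this]
  show ?thesis using wt by (simp cong: prod.cong)
qed

section \<open>Classes of subsets of the base\<close>

lemma mem_subset_class_iff: "J' \<in> cls J \<longleftrightarrow> J' \<subseteq> \<Delta> \<and> (\<exists>w\<in>W. w ` J = J')"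
  by (simp add: subset_class_def)

lemma subset_class_subset: "J' \<in> cls J \<Longrightarrow> J' \<subseteq> \<Delta>"
  by (simp add: mem_subset_class_iff)

lemma finite_subset_class: "finite (cls J)"
  using finite_base by (auto simp: subset_class_def intro: finite_subset[of _ "Pow \<Delta>"])

lemma self_in_subset_class: "J \<subseteq> \<Delta> \<Longrightarrow> J \<in> cls J"
  using id_in_subgroup[of \<Phi>] by (auto simp: mem_subset_class_iff intro!: bexI[of _ id])

lemma subset_class_trans:
  assumes "J' \<in> cls J" "J'' \<in> cls J'"
  shows "J'' \<in> cls J"
proof -
  obtain u v where "u \<in> W" "u ` J = J'" "v \<in> W" "v ` J' = J''" "J'' \<subseteq> \<Delta>"
    using assms by (auto simp: mem_subset_class_iff)
  then show ?thesis
    unfolding mem_subset_class_iff by (intro conjI bexI[of _ "v \<circ> u"] comp_in_subgroup) (auto simp: image_comp)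
qed

lemma subset_class_sym:
  assumes "J' \<in> cls J" "J \<subseteq> \<Delta>"
  shows "J \<in> cls J'"
proof -
  obtain u where u: "u \<in> W" "u ` J = J'" using assms by (auto simp: mem_subset_class_iff)
  then have "finv u ` J' = J" using inv_left[OF u(1)] by (force simp: image_iff)
  then show ?thesis
    unfolding mem_subset_class_iff using assms(2) subgroup_inv[OF u(1)] by blast
qed

lemma subset_class_eq:
  assumes "J' \<in> cls J" "J \<subseteq> \<Delta>"
  shows "cls J' = cls J"
  using subset_class_trans subset_class_sym assms by blast

lemma card_subset_class_member:
  assumes "J' \<in> cls J"
  shows "card J' = card J"
proof -
  obtain w where "w \<in> W" "w ` J = J'" using assms by (auto simp: mem_subset_class_iff)
  then show ?thesis using card_image[OF inj_on_subset[OF subgroup_inj subset_UNIV], of w \<Phi> J] by simp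
qed

lemma card_subset_class_pos: "J \<subseteq> \<Delta> \<Longrightarrow> card (cls J) > 0"
  using self_in_subset_class finite_subset_class card_gt_0_iff by blast

lemma sum_subset_classes:
  "(\<Sum>\<Lambda>\<in>subset_classes \<Phi> \<Delta>. \<Sum>J\<in>\<Lambda>. g J) = (\<Sum>J\<in>Pow \<Delta>. g J)"
proof -
  have "\<Lambda> = {J \<in> Pow \<Delta>. cls J = \<Lambda>}" if L: "\<Lambda> \<in> subset_classes \<Phi> \<Delta>" for \<Lambda>
  proof -
    obtain I where I: "I \<subseteq> \<Delta>" "\<Lambda> = cls I" using L by (auto simp: subset_classes_def)
    show ?thesis
    proof (intro equalityI subsetI)
      fix J assume "J \<in> \<Lambda>"
      then show "J \<in> {J \<in> Pow \<Delta>. cls J = \<Lambda>}"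
        using subset_class_eq[OF _ I(1), of J] subset_class_subset[of J I] by (simp add: I(2))
    qed (use self_in_subset_class in auto)
  qed
  then have "(\<Sum>\<Lambda>\<in>subset_classes \<Phi> \<Delta>. \<Sum>J\<in>\<Lambda>. g J) =
      (\<Sum>\<Lambda>\<in>subset_classes \<Phi> \<Delta>. \<Sum>J\<in>{J \<in> Pow \<Delta>. cls J = \<Lambda>}. g J)"
    by (intro sum.cong) auto
  also have "\<dots> = (\<Sum>J\<in>Pow \<Delta>. g J)"
    using finite_base by (intro sum.group) (auto simp: subset_classes_def)
  finally show ?thesis .
qed

lemma class_rank_subset_class:
  assumes "J \<subseteq> \<Delta>"
  shows "class_rank (cls J) = card J"
  unfolding class_rank_def
  using someI[of "\<lambda>J'. J' \<in> cls J", OF self_in_subset_class[OF assms]]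
  by (rule card_subset_class_member)

text \<open>Both flats are cut out by the roots \<open>u \<alpha>\<close> with
  \<open>\<alpha> \<in> J\<close>.\<close>

lemma supp_pt_image:
  assumes "u \<in> W" "J \<subseteq> \<Delta>" "u ` J \<subseteq> \<Delta>"
  shows "supp (pt (u ` J)) = supp (u (pt J))"
proof -
  have "q \<in> supp (pt (u ` J)) \<longleftrightarrow> q \<in> u ` supp (pt J)" for q
  proof -
    have "q \<in> u ` supp (pt J) \<longleftrightarrow> finv u q \<in> supp (pt J)"
      using inv_left[OF assms(1)] inv_right[OF assms(1), of q] by (auto intro: image_eqI[of q u "finv u q"])
    also have "\<dots> \<longleftrightarrow> (\<forall>\<alpha>\<in>J. u \<alpha> \<bullet> q = 0)"
      unfolding mem_supp_pt[OF assms(2)]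
      using subgroup_inner[OF assms(1), of _ "finv u q"] inv_right[OF assms(1), of q] by simp
    finally show ?thesis by (simp add: mem_supp_pt[OF assms(3)])
  qed
  then show ?thesis unfolding image_supp[OF assms(1), symmetric] by blast
qed

text \<open>Double counting of the pairs \<open>(w, J')\<close> with \<open>w \<in> X\<^sub>K\<close>, \<open>J' \<sim> J\<close>, \<open>J' \<subseteq> K\<close> and
  \<open>w J' \<subseteq> \<Delta>\<close>, by \<open>J'\<close> and by \<open>w J'\<close>.\<close>

lemma sum_mu_coeff:
  assumes K: "K \<subseteq> \<Delta>" and J: "J \<subseteq> \<Delta>"
  shows "(\<Sum>J'\<in>cls J. mu K J') =
    real (card {w \<in> reps K. finv w ` J \<subseteq> K})"
proof -
  let ?cl = "cls J"
  define P where "P J' = {w \<in> reps K. finv w ` J' \<subseteq> K}" for J'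
  define Q where "Q J' = {w \<in> reps K. w ` J' \<subseteq> \<Delta>}" for J'
  have fX: "finite (reps K)" using finite_subset[OF X_set_subset_W finite_W] .
  \<comment> \<open>The faces of type \<open>K\<close> in one flat are counted twice, writing the
    flat as \<open>supp (pt J')\<close> and as \<open>supp (u (pt J))\<close>.\<close>
  have P_const: "card (P J') = card (P J)" if "J' \<in> ?cl" for J'
  proof -
    obtain u where u: "u \<in> W" "u ` J = J'" "J' \<subseteq> \<Delta>" using \<open>J' \<in> ?cl\<close> by (auto simp: mem_subset_class_iff)
    then have "supp (id (pt J')) = supp (u (pt J))" using supp_pt_image[OF u(1) J] by simp
    then show ?thesis
      using card_faces_of_type_below[OF id_in_subgroup K u(3)] card_faces_of_type_below[OF u(1) K J]
      by (simp only: P_def)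
  qed
  have ii: "w ` finv w ` I = I" "finv w ` w ` I = I" if "w \<in> W" for w I
    using inv_left[OF that] inv_right[OF that] by (simp_all add: image_image)
  have X: "w \<in> W" if "w \<in> reps K" for w using that X_set_subset_W by blast
  have cl_image: "w ` J' \<in> ?cl" if "w \<in> W" "J' \<in> ?cl" "w ` J' \<subseteq> \<Delta>" for w J'
    using subset_class_trans[OF that(2)] that by (auto simp: mem_subset_class_iff)
  have "(\<Sum>J'\<in>?cl. mu K J') =
      (\<Sum>J'\<in>?cl. if J' \<subseteq> K then real (card (Q J')) / real (card ?cl) else 0)"
    using subset_class_eq[OF _ J] by (intro sum.cong) (auto simp: mu_coeff_def Q_def)
  also have "\<dots> = (\<Sum>J'\<in>{J' \<in> ?cl. J' \<subseteq> K}. real (card (Q J')) / real (card ?cl))"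
    by (simp add: sum.inter_filter[OF finite_subset_class])
  also have "\<dots> = real (\<Sum>J'\<in>{J' \<in> ?cl. J' \<subseteq> K}. card (Q J')) / real (card ?cl)"
    by (simp add: sum_divide_distrib)
  also have "(\<Sum>J'\<in>{J' \<in> ?cl. J' \<subseteq> K}. card (Q J')) = card (SIGMA J':{J' \<in> ?cl. J' \<subseteq> K}. Q J')"
    using fX finite_subset_class by (subst card_SigmaI) (auto simp: Q_def)
  also have "\<dots> = card (SIGMA J':?cl. P J')"
  proof (rule bij_betw_same_card[of "\<lambda>(J', w). (w ` J', w)"],
      rule bij_betw_byWitness[where f' = "\<lambda>(J', w). (finv w ` J', w)"])
    show "\<forall>a\<in>SIGMA J':{J' \<in> ?cl. J' \<subseteq> K}. Q J'. (\<lambda>(J', w). (finv w ` J', w)) ((\<lambda>(J', w). (w ` J', w)) a) = a"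
      using ii X by (auto simp: Q_def)
    show "\<forall>a\<in>SIGMA J':?cl. P J'. (\<lambda>(J', w). (w ` J', w)) ((\<lambda>(J', w). (finv w ` J', w)) a) = a"
      using ii X by (auto simp: P_def)
    show "(\<lambda>(J', w). (w ` J', w)) ` (SIGMA J':{J' \<in> ?cl. J' \<subseteq> K}. Q J') \<subseteq> (SIGMA J':?cl. P J')"
    proof (rule image_subsetI)
      fix a assume "a \<in> (SIGMA J':{J' \<in> ?cl. J' \<subseteq> K}. Q J')"
      then obtain J' w where a: "a = (J', w)" "J' \<in> ?cl" "J' \<subseteq> K" "w \<in> Q J'" by blast
      then show "(case a of (J', w) \<Rightarrow> (w ` J', w)) \<in> (SIGMA J':?cl. P J')"
        using cl_image[OF X, of w J'] ii(2)[OF X, of w J'] by (simp add: P_def Q_def)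
    qed
    show "(\<lambda>(J', w). (finv w ` J', w)) ` (SIGMA J':?cl. P J') \<subseteq> (SIGMA J':{J' \<in> ?cl. J' \<subseteq> K}. Q J')"
    proof (rule image_subsetI)
      fix a assume "a \<in> (SIGMA J':?cl. P J')"
      then obtain J' w where a: "a = (J', w)" and *: "J' \<in> ?cl" "w \<in> P J'" by blast
      then have w: "w \<in> reps K" "finv w ` J' \<subseteq> K" by (auto simp: P_def)
      have "finv w ` J' \<in> ?cl" using cl_image[OF subgroup_inv[OF X[OF w(1)]] *(1)] w(2) K by blast
      moreover have "w ` finv w ` J' \<subseteq> \<Delta>" using ii(1)[OF X[OF w(1)]] *(1) by (simp add: mem_subset_class_iff)
      ultimately show "(case a of (J', w) \<Rightarrow> (finv w ` J', w)) \<in> (SIGMA J':{J' \<in> ?cl. J' \<subseteq> K}. Q J')"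
        using w by (simp add: Q_def a)
    qed
  qed
  also have "\<dots> = (\<Sum>J'\<in>?cl. card (P J'))"
    using fX finite_subset_class by (subst card_SigmaI) (auto simp: P_def)
  also have "\<dots> = card ?cl * card (P J)"
    using P_const by simp
  finally show ?thesis
    using card_subset_class_pos[OF J] by (simp add: P_def)
qed

section \<open>The inverse matrix and the element \<open>M_elt\<close>\<close>

lemma id_in_X_set: "K \<subseteq> \<Delta> \<Longrightarrow> id \<in> reps K"
  using mem_X_set_iff[of K id] id_in_subgroup[of \<Phi>] pos_base by auto

lemma
  assumes "J \<subseteq> \<Delta>"
  shows beta_mu: "I \<subseteq> \<Delta> \<Longrightarrow> (\<Sum>K\<in>Pow \<Delta>. beta J K * mu K I) = (if J = I then 1 else 0)"
    and beta_triangular: "\<not> K \<subseteq> J \<Longrightarrow> beta J K = 0"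
proof -
  \<comment> \<open>The identity is always among the elements counted on the diagonal.\<close>
  have diag: "mu J J \<noteq> 0" if "J \<in> Pow \<Delta>" for J
  proof -
    have J: "J \<subseteq> \<Delta>" using \<open>J \<in> Pow \<Delta>\<close> by simp
    have "id \<in> {w \<in> reps J. w ` J \<subseteq> \<Delta>}" using id_in_X_set[OF J] J by simp
    moreover have "finite {w \<in> reps J. w ` J \<subseteq> \<Delta>}"
      using finite_subset[OF X_set_subset_W finite_W] by simp
    ultimately have "card {w \<in> reps J. w ` J \<subseteq> \<Delta>} \<noteq> 0" by (metis card_eq_0_iff empty_iff)
    then show ?thesis using card_subset_class_pos[OF J] by (simp add: mu_coeff_def)
  qed
  have fin: "finite J" if "J \<in> Pow \<Delta>" for J using that finite_base finite_subset by blast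
  have tri: "mu J K = 0" if "J \<in> Pow \<Delta>" "K \<in> Pow \<Delta>" "\<not> K \<subseteq> J" for J K
    using that(3) by (simp add: mu_coeff_def)
  have finP: "finite (Pow \<Delta>)" using finite_base by simp
  show "I \<subseteq> \<Delta> \<Longrightarrow> (\<Sum>K\<in>Pow \<Delta>. beta J K * mu K I) = (if J = I then 1 else 0)"
    unfolding beta_coeff_def by (rule triangular_kernel_inverse(1)[OF finP]) (use diag fin tri assms in auto)
  show "\<not> K \<subseteq> J \<Longrightarrow> beta J K = 0"
    unfolding beta_coeff_def by (rule triangular_kernel_inverse(2)[OF finP]) (use diag fin tri assms in auto)
qed

text \<open>The coefficient of \<open>x_elt\<close> at \<open>K\<close> once all
  \<open>e_elt\<close> are expanded; the sum over classes has become one over subsets, each weighted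
  by the inverse size of its class.\<close>

definition M_coeff :: "real \<Rightarrow> 'a set \<Rightarrow> real" where
  "M_coeff x K = (\<Sum>J\<in>Pow \<Delta>. beta J K / (real (card (cls J)) * x ^ card J))"

lemma M_elt_eq:
  assumes w: "w \<in> W"
  shows "M_elt \<Phi> \<Delta> x w = (\<Sum>K\<in>Pow \<Delta>. if w \<in> reps K then M_coeff x K else 0)"
proof -
  define g where "g J = (\<Sum>K\<in>Pow J. beta J K * x_elt \<Phi> \<Delta> K w) /
      (real (card (cls J)) * x ^ card J)" for J
  have "e_elt \<Phi> \<Delta> \<Lambda> w / x ^ class_rank \<Lambda> = (\<Sum>J\<in>\<Lambda>. g J)" if L: "\<Lambda> \<in> subset_classes \<Phi> \<Delta>" for \<Lambda>
  proof -
    obtain I where I: "I \<subseteq> \<Delta>" "\<Lambda> = cls I" using L by (auto simp: subset_classes_def)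
    have "g J = (\<Sum>K\<in>Pow J. beta J K * x_elt \<Phi> \<Delta> K w) / (real (card \<Lambda>) * x ^ class_rank \<Lambda>)"
      if "J \<in> \<Lambda>" for J
      using that subset_class_eq[of J I] card_subset_class_member[of J I] I
      by (simp add: g_def class_rank_subset_class)
    then have "(\<Sum>J\<in>\<Lambda>. g J) =
        (\<Sum>J\<in>\<Lambda>. \<Sum>K\<in>Pow J. beta J K * x_elt \<Phi> \<Delta> K w) / (real (card \<Lambda>) * x ^ class_rank \<Lambda>)"
      by (simp add: sum_divide_distrib)
    then show ?thesis by (simp add: e_elt_def)
  qed
  then have "M_elt \<Phi> \<Delta> x w = (\<Sum>J\<in>Pow \<Delta>. g J)"
    unfolding M_elt_def by (simp add: sum_subset_classes)
  also have "\<dots> = (\<Sum>J\<in>Pow \<Delta>. \<Sum>K\<in>Pow \<Delta>. beta J K * x_elt \<Phi> \<Delta> K w /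
      (real (card (cls J)) * x ^ card J))"
  proof (intro sum.cong refl)
    fix J assume J: "J \<in> Pow \<Delta>"
    \<comment> \<open>Triangularity of \<open>beta\<close> lets \<open>K\<close> range over all
      subsets of the base, so that the sums can be exchanged.\<close>
    have "(\<Sum>K\<in>Pow J. beta J K * x_elt \<Phi> \<Delta> K w) =
        (\<Sum>K\<in>Pow \<Delta>. beta J K * x_elt \<Phi> \<Delta> K w)"
      using J finite_base beta_triangular by (intro sum.mono_neutral_left) auto
    then show "g J = (\<Sum>K\<in>Pow \<Delta>. beta J K * x_elt \<Phi> \<Delta> K w /
      (real (card (cls J)) * x ^ card J))"
      by (simp add: g_def sum_divide_distrib)
  qed
  also have "\<dots> = (\<Sum>K\<in>Pow \<Delta>. x_elt \<Phi> \<Delta> K w * M_coeff x K)"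
    by (subst sum.swap) (simp add: M_coeff_def sum_distrib_left mult.commute)
  also have "\<dots> = (\<Sum>K\<in>Pow \<Delta>. if w \<in> reps K then M_coeff x K else 0)"
    by (intro sum.cong) (auto simp: x_elt_def)
  finally show ?thesis .
qed

text \<open>The number of faces of type \<open>K\<close> in the flat is a sum of entries
  \<open>mu K J'\<close> over the class of \<open>J\<close>. Multiplying by \<open>beta\<close>
  isolates the index \<open>J'\<close>, and the equal contributions of the class cancel its
  size.\<close>

lemma weight_below_M_coeff:
  assumes "Y \<in> flats R"
  shows "weight_below (\<lambda>F. M_coeff x (face_type F)) Y = 1 / x ^ (DIM('a) - flat_dim Y)"
proof -
  obtain u J where uJ: "u \<in> W" "J \<subseteq> \<Delta>" "Y = supp (u (pt J))" using flat_representation[OF assms] .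
  let ?cl = "cls J"
  have "weight_below (\<lambda>F. M_coeff x (face_type F)) Y =
      (\<Sum>K\<in>Pow \<Delta>. M_coeff x K * (\<Sum>J'\<in>?cl. mu K J'))"
    unfolding weight_below_face_type uJ(3)
    by (intro sum.cong refl) (simp add: card_faces_of_type_below[OF uJ(1) _ uJ(2)] sum_mu_coeff[OF _ uJ(2)])
  also have "\<dots> = (\<Sum>J'\<in>?cl. \<Sum>K\<in>Pow \<Delta>. M_coeff x K * mu K J')"
    by (subst sum.swap) (simp add: sum_distrib_left)
  also have "\<dots> = (\<Sum>J'\<in>?cl. 1 / (real (card ?cl) * x ^ card J))"
  proof (intro sum.cong refl)
    fix J' assume J': "J' \<in> ?cl"
    have J'D: "J' \<subseteq> \<Delta>" using J' by (simp add: mem_subset_class_iff)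
    define d where "d I = real (card (cls I)) * x ^ card I" for I
    have "(\<Sum>K\<in>Pow \<Delta>. M_coeff x K * mu K J') =
        (\<Sum>K\<in>Pow \<Delta>. \<Sum>I\<in>Pow \<Delta>. beta I K * mu K J' / d I)"
      by (simp add: M_coeff_def d_def sum_distrib_right)
    also have "\<dots> = (\<Sum>I\<in>Pow \<Delta>. (\<Sum>K\<in>Pow \<Delta>. beta I K * mu K J') / d I)"
      by (subst sum.swap) (simp add: sum_divide_distrib)
    also have "\<dots> = (\<Sum>I\<in>Pow \<Delta>. if I = J' then 1 / d I else 0)"
      using J'D by (intro sum.cong) (auto simp: beta_mu)
    also have "\<dots> = 1 / d J'"
      using J'D finite_base by simp
    also have "d J' = real (card ?cl) * x ^ card J"
      using subset_class_eq[OF J' uJ(2)] card_subset_class_member[OF J'] by (simp add: d_def)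
    finally show "(\<Sum>K\<in>Pow \<Delta>. M_coeff x K * mu K J') = 1 / (real (card ?cl) * x ^ card J)" .
  qed
  also have "\<dots> = 1 / x ^ card J"
    using card_subset_class_pos[OF uJ(2)] by simp
  finally show ?thesis
    using flat_dim_supp_W[OF uJ(1,2)] uJ(3) by simp
qed

section \<open>Fixed spaces, normalizers and the element \<open>H_elt\<close>\<close>

lemma fixed_space_eq:
  assumes K: "K \<subseteq> \<Delta>"
  shows "fixed_space (reflection_subgroup K) = supp (pt K)"
proof (intro equalityI subsetI)
  fix v assume v: "v \<in> fixed_space (reflection_subgroup K)"
  have "\<alpha> \<bullet> v = 0" if "\<alpha> \<in> K" for \<alpha>
  proof -
    have "reflection \<alpha> v = v" using v reflection_in_subgroup[OF that] by (auto simp: fixed_space_def)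
    moreover have "\<alpha> \<noteq> 0" using that K base_subset zero_notin by auto
    ultimately show ?thesis by (simp add: reflection_fixes_iff)
  qed
  then show "v \<in> supp (pt K)" by (simp add: mem_supp_pt[OF K])
next
  fix v assume "v \<in> supp (pt K)"
  then have v: "\<And>\<alpha>. \<alpha> \<in> K \<Longrightarrow> reflection \<alpha> v = v"
    by (simp add: mem_supp_pt[OF K] reflection_def inner_commute)
  have "rprod as v = v" if "set as \<subseteq> K" for as
    using that v by (induction as) auto
  then show "v \<in> fixed_space (reflection_subgroup K)"
    by (auto simp: fixed_space_def reflection_subgroup_eq)
qed

lemma mem_normalizer_iff:
  assumes K: "K \<subseteq> \<Delta>"
  shows "n \<in> normalizer (CG) (reflection_subgroup K) \<longleftrightarrow>
    n \<in> W \<and> (\<lambda>t. n \<circ> t \<circ> finv n) ` reflection_subgroup K = reflection_subgroup K"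
proof -
  have sub: "reflection_subgroup K \<subseteq> W" using K base_subset by (intro subgroup_mono) auto
  have "n <#\<^bsub>CG\<^esub> reflection_subgroup K #>\<^bsub>CG\<^esub> (inv\<^bsub>CG\<^esub> n) =
      (\<lambda>t. n \<circ> t \<circ> finv n) ` reflection_subgroup K" if n: "n \<in> W"
  proof -
    have "n \<otimes>\<^bsub>CG\<^esub> t \<otimes>\<^bsub>CG\<^esub> inv\<^bsub>CG\<^esub> n = n \<circ> t \<circ> finv n"
      if "t \<in> reflection_subgroup K" for t
      using that n sub by (simp add: mult_coxeter_group inv_coxeter_group comp_in_subgroup subgroup_inv subset_iff)
    then show ?thesis by (auto simp: l_coset_def r_coset_def)
  qed
  then show ?thesis
    using sub by (auto simp: normalizer_def stabilizer_def)
qed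

text \<open>Each element of the normalizer factors uniquely as \<open>u \<circ> t\<close> with
  \<open>u\<close> permuting \<open>K\<close> and \<open>t\<close> in the parabolic subgroup. The
  factor \<open>u\<close> is read off from the face of \<open>n (pt K)\<close>, which lies in the
  fixed space because \<open>n\<close> normalizes the subgroup.\<close>

lemma card_normalizer:
  assumes K: "K \<subseteq> \<Delta>"
  shows "card (normalizer (CG) (reflection_subgroup K)) =
    card {u \<in> W. u ` K = K} * card (reflection_subgroup K)"
proof -
  let ?G = "reflection_subgroup K" and ?U = "{u \<in> W. u ` K = K}"
  let ?N = "normalizer (CG) ?G"
  have GW: "?G \<subseteq> W" using K base_subset by (intro subgroup_mono) auto
  have pt_fixed: "t (pt K) = pt K" if "t \<in> ?G" for t
    using fixed_space_eq[OF K] mem_supp[of "pt K"] that by (auto simp: fixed_space_def)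
  have UX: "u \<in> reps K" if "u \<in> ?U" for u
    using that K pos_base by (auto simp: mem_X_set_iff[OF K])
  have inj: "inj_on (\<lambda>(u, t). u \<circ> t) (?U \<times> ?G)"
  proof (rule inj_onI, clarify)
    fix u t u' t' assume u: "u \<in> W" "u ` K = K" "u' \<in> W" "u' ` K = K" and t: "t \<in> ?G" "t' \<in> ?G"
      and eq: "u \<circ> t = u' \<circ> t'"
    \<comment> \<open>The parabolic factor fixes \<open>pt K\<close>, and elements permuting
      \<open>K\<close> belong to \<open>reps K\<close>, hence are determined by the face they
      produce.\<close>
    have "u (pt K) = u' (pt K)" using fun_cong[OF eq, of "pt K"] pt_fixed[OF t(1)] pt_fixed[OF t(2)] by simp
    then have "(K, u) = (K, u')"
      using inj_onD[OF bij_betw_imp_inj_on[OF bij_betw_faces], of "(K, u)" "(K, u')"] UX u K by simp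
    then have "u = u'" by simp
    moreover have "t v = t' v" for v
      using fun_cong[OF eq, of v] inv_left[OF u(1)] \<open>u = u'\<close> by (metis comp_apply)
    ultimately show "u = u' \<and> t = t'" by auto
  qed
  have image: "(\<lambda>(u, t). u \<circ> t) ` (?U \<times> ?G) = ?N"
  proof (intro equalityI subsetI)
    fix n assume "n \<in> (\<lambda>(u, t). u \<circ> t) ` (?U \<times> ?G)"
    then obtain u t where u: "u \<in> W" "u ` K = K" and t: "t \<in> ?G" and n: "n = u \<circ> t" by auto
    have conj_in: "v \<circ> s \<circ> finv v \<in> ?G" if v: "v \<in> W" "v ` K \<subseteq> K" and s: "s \<in> ?G" for v s
    proof -
      obtain as where as: "set as \<subseteq> K" "s = rprod as" using s by (auto simp: reflection_subgroup_eq)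
      have "v \<circ> s \<circ> finv v = rprod (map v as)"
        using rprod_map[OF subgroup_orthogonal[OF v(1)]] inv_right[OF v(1)] as by (simp add: fun_eq_iff)
      then show ?thesis using as v(2) by (auto intro!: rprod_in simp: image_subset_iff subset_iff)
    qed
    have tW: "t \<in> W" using t GW by auto
    have nW: "n \<in> W" using u t GW unfolding n by (intro comp_in_subgroup) auto
    have fn: "finv n v = finv t (finv u v)" for v
      using inv_left[OF nW, of "finv t (finv u v)"] inv_right[OF tW] inv_right[OF u(1)] by (simp add: n)
    have fuK: "finv u ` K = K"
      using arg_cong[OF u(2), of "(`) (finv u)"] inv_left[OF u(1)] by (simp add: image_image)
    have "n \<circ> s \<circ> finv n \<in> ?G" if s: "s \<in> ?G" for s
    proof -
      have "n \<circ> s \<circ> finv n = u \<circ> (t \<circ> s \<circ> finv t) \<circ> finv u"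
        by (simp add: fun_eq_iff fn) (simp add: n)
      moreover have "t \<circ> s \<circ> finv t \<in> ?G" using t s by (intro comp_in_subgroup subgroup_inv)
      ultimately show ?thesis using conj_in[OF u(1)] u(2) by simp
    qed
    moreover have "s \<in> (\<lambda>s. n \<circ> s \<circ> finv n) ` ?G" if s: "s \<in> ?G" for s
    proof -
      let ?s = "finv t \<circ> (finv u \<circ> s \<circ> u) \<circ> t"
      have "finv u \<circ> s \<circ> u \<in> ?G"
        using conj_in[OF subgroup_inv[OF u(1)] _ s] fuK by (simp add: finv_finv[OF u(1)])
      then have sG: "?s \<in> ?G" using comp_in_subgroup[OF comp_in_subgroup[OF subgroup_inv[OF t]] t] by blast
      have "n (finv t (finv u y)) = y" for y
        using inv_right[OF tW] inv_right[OF u(1)] by (simp add: n)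
      moreover have "u (t (finv n y)) = y" for y
        using inv_right[OF tW] inv_right[OF u(1)] by (simp add: fn)
      ultimately have "s = n \<circ> ?s \<circ> finv n"
        by (simp add: fun_eq_iff)
      from image_eqI[where f = "\<lambda>s. n \<circ> s \<circ> finv n", OF this sG] show ?thesis .
    qed
    ultimately show "n \<in> ?N" using nW unfolding mem_normalizer_iff[OF K] by blast
  next
    fix n assume "n \<in> ?N"
    then have n: "n \<in> W" "(\<lambda>t. n \<circ> t \<circ> finv n) ` ?G = ?G" using mem_normalizer_iff[OF K] by auto
    have "n (pt K) \<in> supp (pt K)"
      unfolding fixed_space_eq[OF K, symmetric] fixed_space_def
    proof safe
      fix t assume "t \<in> ?G"
      then obtain t' where t': "t' \<in> ?G" "t = n \<circ> t' \<circ> finv n" using n(2) by blast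
      then show "t (n (pt K)) = n (pt K)" using inv_left[OF n(1)] pt_fixed[OF t'(1)] by simp
    qed
    moreover have "cell (n (pt K)) \<in> (\<lambda>(K, w). cell (w (pt K))) ` (SIGMA K:Pow \<Delta>. reps K)"
      using bij_betw_imp_surj_on[OF bij_betw_faces] by (simp add: faces_eq)
    then obtain K' u where u: "K' \<subseteq> \<Delta>" "u \<in> reps K'" "cell (n (pt K)) = cell (u (pt K'))"
      by auto
    have uW: "u \<in> W" using u(2) X_set_subset_W by auto
    have KK: "K = K'" and G: "finv u \<circ> n \<in> ?G"
      using face_type_unique[OF n(1) uW K u(1,3)] by auto
    ultimately have "u (pt K) \<in> supp (pt K)"
      using u(3) flat_mem_iff_cell[OF supp_flat] by metis
    then have "\<forall>\<alpha>\<in>K. \<alpha> \<bullet> u (pt K) = 0" by (simp only: mem_supp_pt[OF K])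
    moreover have "u \<in> reps K" using u(2) by (simp only: KK)
    \<comment> \<open>All roots of \<open>K\<close> vanish on the face of \<open>u (pt K)\<close>,
      so their preimages under \<open>u\<close> lie in \<open>K\<close>; counting makes this an
      equality.\<close>
    ultimately have sub: "finv u ` K \<subseteq> K"
      using inner_X_set_pt_eq_0_iff[OF K, of u] K by auto
    have "finite K" using K finite_base finite_subset by blast
    from card_subset_eq[OF this sub] have "finv u ` K = K"
      using card_image[OF inj_on_subset[OF subgroup_inj[OF subgroup_inv[OF uW]] subset_UNIV]] by blast
    from arg_cong[OF this, of "(`) u"] have "u ` K = K"
      using inv_right[OF uW] by (simp add: image_image)
    moreover have "n = u \<circ> (finv u \<circ> n)" using inv_right[OF uW] by (simp add: fun_eq_iff)
    ultimately show "n \<in> (\<lambda>(u, t). u \<circ> t) ` (?U \<times> ?G)"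
      using uW G by (intro image_eqI[of _ _ "(u, finv u \<circ> n)"]) auto
  qed
  have "card ?N = card (?U \<times> ?G)" using card_image[OF inj] unfolding image .
  then show ?thesis by (simp add: card_cartesian_product)
qed

text \<open>The face of \<open>w (pt J)\<close> lies in the flat iff \<open>finv w\<close> maps
  \<open>K\<close> into \<open>J\<close>, and equal dimension turns this into
  \<open>w J = K\<close>. So \<open>J\<close> runs through the class of \<open>K\<close>, and for
  each \<open>J\<close> the possible \<open>w\<close> form a coset of the elements permuting
  \<open>K\<close>.\<close>

lemma card_faces_with_support:
  assumes K: "K \<subseteq> \<Delta>"
  shows "card {G \<in> faces R. face_support R G = supp (pt K)} =
    card (cls K) * card {u \<in> W. u ` K = K}"
proof -
  let ?cl = "cls K"
  define P where "P J = {w \<in> W. w ` J = K}" for J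
  have X: "w \<in> reps J" if "J \<subseteq> \<Delta>" "w \<in> P J" for w J
    using that K pos_base by (auto simp: P_def mem_X_set_iff[OF that(1)])
  have finJ: "finite J" if "J \<subseteq> \<Delta>" for J using that finite_base finite_subset by blast
  have supp_iff: "supp (w (pt J)) = supp (pt K) \<longleftrightarrow> w ` J = K" if J: "J \<subseteq> \<Delta>" and w: "w \<in> reps J" for w J
  proof
    have wW: "w \<in> W" using w X_set_subset_W by auto
    show "supp (w (pt J)) = supp (pt K)" if "w ` J = K"
      using supp_pt_image[OF wW J] that K by simp
    assume eq: "supp (w (pt J)) = supp (pt K)"
    have "w (pt J) \<in> supp (pt K)" using eq mem_supp by blast
    then have sub: "finv w ` K \<subseteq> J"
      using inner_X_set_pt_eq_0_iff[OF J w] K unfolding mem_supp_pt[OF K] by auto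
    have "card J = card K" using flat_dim_supp_W[OF wW J] flat_dim_supp_W[OF id_in_subgroup K] eq by simp
    then have "card (finv w ` K) = card J"
      using card_image[OF inj_on_subset[OF subgroup_inj[OF subgroup_inv[OF wW]] subset_UNIV]] by simp
    then have "finv w ` K = J" using sub finJ[OF J] by (simp add: card_subset_eq)
    then show "w ` J = K" using inv_right[OF wW] by (force simp: image_iff)
  qed
  have "{G \<in> faces R. face_support R G = supp (pt K)} = (\<lambda>(J, w). cell (w (pt J))) ` (SIGMA J:?cl. P J)"
  proof (intro equalityI subsetI)
    fix G assume G: "G \<in> {G \<in> faces R. face_support R G = supp (pt K)}"
    then have "G \<in> (\<lambda>(K, w). cell (w (pt K))) ` (SIGMA K:Pow \<Delta>. reps K)"
      using bij_betw_imp_surj_on[OF bij_betw_faces] by simp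
    then obtain J w where w: "J \<subseteq> \<Delta>" "w \<in> reps J" "G = cell (w (pt J))" by auto
    have wW: "w \<in> W" using w X_set_subset_W by auto
    have wJ: "w ` J = K" using G w supp_iff by (simp add: face_support_cell)
    then have "K \<in> cls J" using wW K by (auto simp: mem_subset_class_iff)
    from subset_class_sym[OF this w(1)] have "J \<in> ?cl" .
    then show "G \<in> (\<lambda>(J, w). cell (w (pt J))) ` (SIGMA J:?cl. P J)"
      using w wJ wW by (intro image_eqI[of _ _ "(J, w)"]) (auto simp: P_def)
  next
    fix G assume "G \<in> (\<lambda>(J, w). cell (w (pt J))) ` (SIGMA J:?cl. P J)"
    then obtain J w where w: "J \<in> ?cl" "w \<in> P J" "G = cell (w (pt J))" by auto
    have J: "J \<subseteq> \<Delta>" using w(1) by (simp add: mem_subset_class_iff)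
    have "supp (w (pt J)) = supp (pt K)"
      using supp_iff[OF J X[OF J w(2)]] w(2) by (simp add: P_def)
    then show "G \<in> {G \<in> faces R. face_support R G = supp (pt K)}"
      using w by (auto simp: faces_eq face_support_cell)
  qed
  moreover have "inj_on (\<lambda>(J, w). cell (w (pt J))) (SIGMA J:?cl. P J)"
    using X subset_class_subset by (intro inj_on_subset[OF bij_betw_imp_inj_on[OF bij_betw_faces]]) blast
  ultimately have "card {G \<in> faces R. face_support R G = supp (pt K)} = card (SIGMA J:?cl. P J)"
    by (simp add: card_image)
  also have "\<dots> = (\<Sum>J\<in>?cl. card (P J))"
    using finite_subset_class finite_W by (subst card_SigmaI) (auto simp: P_def)
  also have "\<dots> = (\<Sum>J\<in>?cl. card {u \<in> W. u ` K = K})"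
  proof (intro sum.cong refl)
    fix J assume "J \<in> ?cl"
    then obtain v where v: "v \<in> W" "v ` K = J" by (auto simp: mem_subset_class_iff)
    have fv: "finv v ` J = K" using v inv_left[OF v(1)] by (force simp: image_iff)
    show "card (P J) = card {u \<in> W. u ` K = K}"
    proof (rule bij_betw_same_card[of "\<lambda>w. w \<circ> v"], rule bij_betw_byWitness[where f' = "\<lambda>w. w \<circ> finv v"])
      show "\<forall>w\<in>P J. w \<circ> v \<circ> finv v = w" using inv_right[OF v(1)] by (simp add: fun_eq_iff)
      show "\<forall>u\<in>{u \<in> W. u ` K = K}. u \<circ> finv v \<circ> v = u" using inv_left[OF v(1)] by (simp add: fun_eq_iff)
      show "(\<lambda>w. w \<circ> v) ` P J \<subseteq> {u \<in> W. u ` K = K}"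
      proof (rule image_subsetI)
        fix w assume "w \<in> P J"
        then have "w \<circ> v \<in> W" "w ` v ` K = K" using v by (auto simp: P_def intro: comp_in_subgroup)
        then show "w \<circ> v \<in> {u \<in> W. u ` K = K}" by (simp add: image_comp)
      qed
      show "(\<lambda>w. w \<circ> finv v) ` {u \<in> W. u ` K = K} \<subseteq> P J"
      proof (rule image_subsetI)
        fix u assume "u \<in> {u \<in> W. u ` K = K}"
        then have "u \<circ> finv v \<in> W" "u ` finv v ` J = K"
          using fv subgroup_inv[OF v(1)] by (auto intro: comp_in_subgroup)
        then show "u \<circ> finv v \<in> P J" by (simp add: P_def image_comp)
      qed
    qed
  qed
  finally show ?thesis by simp
qed

lemma flat_image:
  assumes "u \<in> W" "X \<in> flats R"
  shows "u ` X \<in> flats R"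
proof -
  obtain p where "supp p = X" using ex_generic_point[OF assms(2)] by blast
  then show ?thesis using image_supp[OF assms(1)] supp_flat by metis
qed

text \<open>By Moebius inversion the polynomials of all flats are determined by the dimensions alone.\<close>

lemma flat_poly_image:
  assumes u: "u \<in> W" and X: "X \<in> flats R"
  shows "flat_poly R (u ` X) x = flat_poly R X x"
proof -
  define L where "L = flats R"
  have finL: "finite L" using finite_flats by (simp add: L_def)
  define h where "h Y = flat_poly R Y x" for Y
  \<comment> \<open>Moebius inversion evaluates the sum of \<open>h\<close> over the flats inside
    \<open>Y\<close>; solved for \<open>h Y\<close> it is a recursion that refers to dimensions
    only.\<close>
  have inv: "h Y = x ^ flat_dim Y - (\<Sum>Z\<in>{Z \<in> L. Z \<subset> Y}. h Z)" if "Y \<in> L" for Y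
  proof -
    have "(\<Sum>Z\<in>{Z \<in> L. Z \<subseteq> Y}. h Z) = x ^ flat_dim Y"
      unfolding h_def flat_poly_def
      using moebius_inversion[OF finL that, of "\<lambda>Z. x ^ flat_dim Z"] by (simp add: L_def)
    moreover have "{Z \<in> L. Z \<subseteq> Y} = insert Y {Z \<in> L. Z \<subset> Y}" using that by auto
    ultimately show ?thesis using finL by simp
  qed
  have img: "{Z \<in> L. Z \<subset> u ` Y} = (`) u ` {Z \<in> L. Z \<subset> Y}" if "Y \<in> L" for Y
  proof (intro equalityI subsetI)
    fix Z assume Z: "Z \<in> {Z \<in> L. Z \<subset> u ` Y}"
    have e: "u ` finv u ` Z = Z" using inv_right[OF u] by (simp add: image_image)
    have "finv u ` u ` Y = Y" using inv_left[OF u] by (simp add: image_image)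
    then have "finv u ` Z \<subset> Y"
      using Z e by (metis (no_types, lifting) image_mono mem_Collect_eq psubset_eq)
    moreover have "finv u ` Z \<in> L" using flat_image[OF subgroup_inv[OF u]] Z by (simp add: L_def)
    ultimately show "Z \<in> (`) u ` {Z \<in> L. Z \<subset> Y}" using e by (intro image_eqI[of _ _ "finv u ` Z"]) auto
  next
    fix Z assume "Z \<in> (`) u ` {Z \<in> L. Z \<subset> Y}"
    then obtain Z' where Z': "Z = u ` Z'" "Z' \<in> L" "Z' \<subset> Y" by auto
    then have "Z \<in> L" using flat_image[OF u] by (simp add: L_def)
    moreover have "u ` Z' \<subset> u ` Y" using Z'(3) subgroup_inj[OF u] by (simp add: image_strict_mono inj_on_subset)
    ultimately show "Z \<in> {Z \<in> L. Z \<subset> u ` Y}" using Z' by simp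
  qed
  have injI: "inj_on ((`) u) S" for S
    using inj_on_image[OF inj_on_subset[OF subgroup_inj[OF u] subset_UNIV]] .
  have "h (u ` Y) = h Y" if "Y \<in> L" for Y
    using that
  proof (induction "card {Z \<in> L. Z \<subset> Y}" arbitrary: Y rule: less_induct)
    case less
    have uY: "u ` Y \<in> L" using flat_image[OF u] less.prems by (simp add: L_def)
    have IH: "h (u ` Z) = h Z" if Z: "Z \<in> {Z \<in> L. Z \<subset> Y}" for Z
    proof (rule less.hyps)
      have "{Z' \<in> L. Z' \<subset> Z} \<subset> {Z \<in> L. Z \<subset> Y}" using Z by auto
      then show "card {Z' \<in> L. Z' \<subset> Z} < card {Z \<in> L. Z \<subset> Y}"
        using finL by (intro psubset_card_mono) auto
      show "Z \<in> L" using Z by simp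
    qed
    have "(\<Sum>Z\<in>{Z \<in> L. Z \<subset> u ` Y}. h Z) = (\<Sum>Z\<in>{Z \<in> L. Z \<subset> Y}. h (u ` Z))"
      unfolding img[OF less.prems] by (simp add: sum.reindex[OF injI])
    also have "\<dots> = (\<Sum>Z\<in>{Z \<in> L. Z \<subset> Y}. h Z)"
      using IH by (rule sum.cong[OF refl])
    finally show ?case
      using inv[OF less.prems] inv[OF uY] flat_dim_image[OF u] by simp
  qed
  then show ?thesis using X by (simp add: h_def L_def)
qed

definition H_coeff :: "real \<Rightarrow> 'a set \<Rightarrow> real" where
  "H_coeff x K = real (card (reflection_subgroup K)) *
      flat_poly R (fixed_space (reflection_subgroup K)) x /
      (x ^ DIM('a) * real (card (normalizer (CG) (reflection_subgroup K))) *
        real (card (cls K)))"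

lemma H_elt_eq:
  assumes w: "w \<in> W"
  shows "H_elt \<Phi> \<Delta> x w = (\<Sum>K\<in>Pow \<Delta>. if w \<in> reps K then H_coeff x K else 0)"
proof -
  have "Pow (\<Delta> - descents \<Delta> w) = {K \<in> Pow \<Delta>. w \<in> reps K}"
    using w by (auto simp: X_set_def)
  then have "H_elt \<Phi> \<Delta> x w = (\<Sum>K\<in>{K \<in> Pow \<Delta>. w \<in> reps K}. H_coeff x K)"
    by (simp only: H_elt_def H_coeff_def)
  also have "\<dots> = (\<Sum>K\<in>Pow \<Delta>. if w \<in> reps K then H_coeff x K else 0)"
    using finite_base by (intro sum.inter_filter) simp
  finally show ?thesis .
qed

text \<open>Support, polynomial and number of faces are compatible with \<open>W\<close>, so the
  face may be taken in the closed fundamental chamber. The order of the parabolic subgroup cancels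
  against the normalizer, and what remains in the denominator is the number of faces with the given
  support.\<close>

lemma H_coeff_eq_face_weight:
  assumes "F \<in> faces R"
  shows "H_coeff x (face_type F) = face_weight R x F"
proof -
  obtain v where "F = cell v" using assms by (auto simp: faces_eq)
  then obtain w K where w: "w \<in> W" "K \<subseteq> \<Delta>" "F = cell (w (pt K))" using ex_face_type[of v] by auto
  have supp: "face_support R F = w ` supp (pt K)"
    by (simp add: w(3) face_support_cell image_supp[OF w(1)])
  let ?S = "\<lambda>X. {G \<in> faces R. face_support R G = X}"
  have "card (?S (supp (pt K))) = card (?S (w ` supp (pt K)))"
  proof (rule bij_betw_same_card)
    have fs: "face_support R (w ` G) = w ` face_support R G" if "G \<in> faces R" for G
    proof -
      obtain v where "G = cell v" using \<open>G \<in> faces R\<close> unfolding faces_eq by blast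
      then show ?thesis by (simp add: image_cell[OF w(1)] face_support_cell image_supp[OF w(1)])
    qed
    have "(`) w ` ?S (supp (pt K)) = ?S (w ` supp (pt K))"
    proof (intro equalityI subsetI)
      fix G assume G: "G \<in> ?S (w ` supp (pt K))"
      then have "G \<in> (`) w ` faces R"
        using bij_betw_imp_surj_on[OF bij_betw_image_faces[OF w(1)]] by simp
      then obtain G' where G': "G' \<in> faces R" "G = w ` G'" by blast
      then have "w ` face_support R G' = w ` supp (pt K)" using fs G by simp
      then have "face_support R G' = supp (pt K)" using subgroup_inj[OF w(1)] by (simp add: inj_image_eq_iff)
      then show "G \<in> (`) w ` ?S (supp (pt K))" using G' by blast
    next
      fix G assume "G \<in> (`) w ` ?S (supp (pt K))"
      then obtain G' where "G' \<in> faces R" "face_support R G' = supp (pt K)" "G = w ` G'" by auto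
      then show "G \<in> ?S (w ` supp (pt K))"
        using fs bij_betw_imp_surj_on[OF bij_betw_image_faces[OF w(1)]] by auto
    qed
    then show "bij_betw ((`) w) (?S (supp (pt K))) (?S (w ` supp (pt K)))"
      using inj_on_subset[OF bij_betw_imp_inj_on[OF bij_betw_image_faces[OF w(1)]]]
      by (simp add: bij_betw_def)
  qed
  then have card_S: "card (?S (w ` supp (pt K))) = card (cls K) * card {u \<in> W. u ` K = K}"
    using card_faces_with_support[OF w(2)] by (simp only:)
  have "face_weight R x F = flat_poly R (supp (pt K)) x /
      (x ^ DIM('a) * (real (card (cls K)) * real (card {u \<in> W. u ` K = K})))"
    unfolding face_weight_def supp card_S flat_poly_image[OF w(1) supp_flat] by simp
  moreover have "card (reflection_subgroup K) > 0"
    using id_in_subgroup[of K] finite_subset[OF subgroup_mono finite_W, of K] w(2) base_subset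
    by (auto simp: card_gt_0_iff)
  ultimately show ?thesis
    unfolding w(3) face_type_cell[OF w(1,2)] H_coeff_def card_normalizer[OF w(2)] fixed_space_eq[OF w(2)]
    by (simp add: field_simps)
qed

lemma weight_below_H_coeff:
  assumes "Y \<in> flats R" "x \<noteq> 0"
  shows "weight_below (\<lambda>F. H_coeff x (face_type F)) Y = 1 / x ^ (DIM('a) - flat_dim Y)"
proof -
  have "weight_below (\<lambda>F. H_coeff x (face_type F)) Y = weight_below (face_weight R x) Y"
    unfolding weight_below_def by (intro sum.cong) (auto simp: H_coeff_eq_face_weight)
  then show ?thesis using weight_below_face_weight[OF assms] by simp
qed

end

theorem theorem2:
  fixes A :: "'a::euclidean_space set set" and \<Phi> \<Delta> :: "'b::euclidean_space set" and x :: real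
  assumes "x \<noteq> 0"
  shows "(hyperplane_arrangement A \<longrightarrow>
            kernel_char_poly (chambers A) (shuffle_kernel A x) =
              (\<Prod>i<DIM('a). [:- (1 / x ^ i), 1:] ^ shuffle_multiplicity A i) *
              [:- (1 / x ^ DIM('a)), 1:] ^ shuffle_multiplicity A (DIM('a)))
         \<and> (root_system \<Phi> \<and> root_base \<Phi> \<Delta> \<longrightarrow>
            kernel_char_poly (carrier (coxeter_group \<Phi>))
                (left_mult_kernel (coxeter_group \<Phi>) (H_elt \<Phi> \<Delta> x)) =
            kernel_char_poly (carrier (coxeter_group \<Phi>))
                (left_mult_kernel (coxeter_group \<Phi>) (M_elt \<Phi> \<Delta> x)))"
proof (intro conjI impI)
  assume "hyperplane_arrangement A"
  then obtain nrm off where "arrangement A nrm off"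
    by (rule hyperplane_arrangement_imp_arrangement)
  then interpret arrangement A nrm off .
  show "kernel_char_poly (chambers A) (shuffle_kernel A x) =
      (\<Prod>i<DIM('a). [:- (1 / x ^ i), 1:] ^ shuffle_multiplicity A i) *
      [:- (1 / x ^ DIM('a)), 1:] ^ shuffle_multiplicity A (DIM('a))"
    by (rule kernel_char_poly_shuffle_kernel[OF assms])
next
  assume "root_system \<Phi> \<and> root_base \<Phi> \<Delta>"
  then interpret based_root_system \<Phi> \<Delta>
    by unfold_locales auto
  show "kernel_char_poly (carrier (coxeter_group \<Phi>))
          (left_mult_kernel (coxeter_group \<Phi>) (H_elt \<Phi> \<Delta> x)) =
      kernel_char_poly (carrier (coxeter_group \<Phi>))
          (left_mult_kernel (coxeter_group \<Phi>) (M_elt \<Phi> \<Delta> x))"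
    unfolding carrier_coxeter_group
    \<comment> \<open>Both sides equal the product over the flats with the same roots
      \<open>1 / x ^ (DIM('b) - flat_dim Y)\<close>.\<close>
    by (rule trans[OF kernel_char_poly_descent_element[OF H_elt_eq weight_below_H_coeff]
        sym[OF kernel_char_poly_descent_element[OF M_elt_eq weight_below_M_coeff]]]) (use assms in auto)
qed

end
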